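(* Let $M:\mathbb{R}^N\times\mathbb{R}^+\to\mathbb{R}^+$ be an $N$-function and let $m$ be a positive integer. Assume that either (A) $M$ satisfies $(\mathcal{M}1)$ and $(\mathcal{M}2)$, or (B) for some $p>1$, $M$ satisfies the growth condition $(\mathrm{G}_p)$, $(\mathcal{M}1)$ and $(\mathcal{M}2p)$ (all conditions with $\Omega=\mathbb{R}^N$). Then: 1) $\mathcal{C}^\infty_0(\mathbb{R}^N)$ is dense in $W^mE_M(\mathbb{R}^N)$ with respect to the norm topology of $W^mL_M(\mathbb{R}^N)$. 2) For every $u\in W^mL_M(\mathbb{R}^N)$ there exist $\lambda>0$ and a sequence of functions $u_k\in\mathcal{C}^\infty_0(\mathbb{R}^N)$ such that for all $|\alpha|\le m$ $$\int_{\mathbb{R}^N}M\Big(x,\frac{|D^\alpha u_k-D^\alpha u|}{\lambda}\Big)dx\to 0\quad\text{as }k\to\infty .$$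
   Context: Let $\Omega\subset\mathbb{R}^N$ be open, $N\ge 1$ (here $\Omega=\mathbb{R}^N$). A function $M:\Omega\times\mathbb{R}^+\to\mathbb{R}^+$ is a $\phi$-function if $x\mapsto M(x,s)$ is measurable for all $s\ge0$, $s\mapsto M(x,s)$ is convex for a.e. $x\in\Omega$ with $M(x,0)=0$, $\operatorname{ess\,inf}_{x\in\Omega}M(x,1)>0$, and $M(x,s)\to+\infty$ as $s\to+\infty$. It is a $\Phi$-function if moreover, for a.e. $x$, $\lim_{s\to0}M(x,s)/s=0$ and $\lim_{s\to\infty}M(x,s)/s=\infty$. An $N$-function is a $\Phi$-function that is strictly increasing in $s$. Conditions: $(\mathcal{M}1)$: for every constant $c>0$ and every compact $K\subset\Omega$, $\int_K M(x,c)\,dx<\infty$. $(\mathcal{M}2)$: there is a function $\varphi:[0,1/2]\times\mathbb{R}^+\to\mathbb{R}^+$, nondecreasing in each of its two variables separately, such that $M(x,s)\le\varphi(|x-y|,s)M(y,s)$ for all $x,y\in\overline\Omega$ with $|x-y|\le\frac12$ (and all $s\ge 0$), and such that $\limsup_{\varepsilon\to0^+}\varphi(\varepsilon,c\,\varepsilon^{-N})<\infty$ for every constant $c>0$. $(\mathrm{G}_p)$: $M(x,s)\ge c|s|^p$ for some constant $c>0$, where $p>1$. $(\mathcal{M}2p)$: same as $(\mathcal{M}2)$ but with the last requirement replaced by $\limsup_{\varepsilon\to0^+}\varphi(\varepsilon,c\,\varepsilon^{-N/p})<\infty$ for every constant $c>0$ (same $p$ as in $(\mathrm{G}_p)$).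 Spaces: $L_M(\Omega)$ (resp. $E_M(\Omega)$) is the set of measurable $u:\Omega\to\mathbb{R}$ with $\int_\Omega M(x,|u(x)|/\lambda)dx<\infty$ for some $\lambda>0$ (resp. for all $\lambda>0$). $W^mL_M(\Omega)$ (resp. $W^mE_M(\Omega)$) is the set of $u$ such that the distributional derivatives $D^\alpha u$ belong to $L_M(\Omega)$ (resp. $E_M(\Omega)$) for all $|\alpha|\le m$, endowed with the norm $\|u\|_{W^mL_M(\Omega)}=\inf\{\lambda>0:\sum_{|\alpha|\le m}\int_\Omega M(x,|D^\alpha u|/\lambda)dx\le1\}$. $\mathcal{C}_0^\infty(\mathbb{R}^N)$ is the set of smooth compactly supported functions. *)

theory Defs
  imports "HOL-Analysis.Analysis"
begin

section \<open>Musielak functions on \<open>\<real>\<^sup>N\<close>\<close>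

text \<open>
  Euclidean space of dimension \<open>N\<close> is \<open>real ^ 'n\<close> with \<open>N = CARD('n)\<close>.
  A function \<open>\<real>\<^sup>N \<times> [0,\<infinity>) \<rightarrow> [0,\<infinity>)\<close> is represented by \<open>M :: real ^ 'n \<Rightarrow> real \<Rightarrow> real\<close>, of which
  only the values at nonnegative second arguments are ever constrained or used.
  Measurability and null sets refer to the Lebesgue \<open>\<sigma>\<close>-algebra and measure.
\<close>

text \<open>The library has only the essential supremum; its definition as a \<open>Limsup\<close> along
  \<open>ae_filter\<close> is dualised here.\<close>

definition essinf :: "'a measure \<Rightarrow> ('a \<Rightarrow> ereal) \<Rightarrow> ereal" where
  "essinf \<mu> f = Liminf (ae_filter \<mu>) f"

definition phi_function :: "(real ^ 'n \<Rightarrow> real \<Rightarrow> real) \<Rightarrow> bool" where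
  "phi_function M \<longleftrightarrow>
     (\<forall>x. \<forall>s\<ge>0. 0 \<le> M x s) \<and>
     (\<forall>s\<ge>0. (\<lambda>x. M x s) \<in> borel_measurable lebesgue) \<and>
     (AE x in lebesgue. convex_on {0..} (M x) \<and> M x 0 = 0) \<and>
     0 < essinf lebesgue (\<lambda>x. ereal (M x 1)) \<and>
     (AE x in lebesgue. filterlim (M x) at_top at_top)"

definition Phi_function :: "(real ^ 'n \<Rightarrow> real \<Rightarrow> real) \<Rightarrow> bool" where
  "Phi_function M \<longleftrightarrow>
     phi_function M \<and>
     (AE x in lebesgue. ((\<lambda>s. M x s / s) \<longlongrightarrow> 0) (at_right 0) \<and>
                        filterlim (\<lambda>s. M x s / s) at_top at_top)"

definition N_function :: "(real ^ 'n \<Rightarrow> real \<Rightarrow> real) \<Rightarrow> bool" where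
  "N_function M \<longleftrightarrow> Phi_function M \<and> (AE x in lebesgue. strict_mono_on {0..} (M x))"

definition cond_M1 :: "(real ^ 'n \<Rightarrow> real \<Rightarrow> real) \<Rightarrow> bool" where
  "cond_M1 M \<longleftrightarrow>
     (\<forall>c>0. \<forall>K. compact K \<longrightarrow> (\<integral>\<^sup>+ x\<in>K. ennreal (M x c) \<partial>lebesgue) < \<infinity>)"

text \<open>The regularity condition with an arbitrary exponent \<open>q\<close> in the requirement
  \<open>limsup \<phi>(\<epsilon>, c \<epsilon>\<^sup>-\<^sup>q) < \<infinity>\<close>; the two conditions of interest have \<open>q = N\<close> and \<open>q = N/p\<close>.\<close>

definition cond_M2_exponent :: "real \<Rightarrow> (real ^ 'n \<Rightarrow> real \<Rightarrow> real) \<Rightarrow> bool" where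
  "cond_M2_exponent q M \<longleftrightarrow>
     (\<exists>\<phi> :: real \<Rightarrow> real \<Rightarrow> real.
        (\<forall>t\<in>{0..1/2}. \<forall>s\<ge>0. 0 \<le> \<phi> t s) \<and>
        (\<forall>s\<ge>0. mono_on {0..1/2} (\<lambda>t. \<phi> t s)) \<and>
        (\<forall>t\<in>{0..1/2}. mono_on {0..} (\<phi> t)) \<and>
        (\<forall>x y. norm (x - y) \<le> 1/2 \<longrightarrow> (\<forall>s\<ge>0. M x s \<le> \<phi> (norm (x - y)) s * M y s)) \<and>
        (\<forall>c>0. Limsup (at_right 0) (\<lambda>\<epsilon>. ereal (\<phi> \<epsilon> (c * \<epsilon> powr (- q)))) < \<infinity>))"

definition cond_M2 :: "(real ^ 'n \<Rightarrow> real \<Rightarrow> real) \<Rightarrow> bool" where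
  "cond_M2 M \<longleftrightarrow> cond_M2_exponent (real CARD('n)) M"

definition cond_M2p :: "real \<Rightarrow> (real ^ 'n \<Rightarrow> real \<Rightarrow> real) \<Rightarrow> bool" where
  "cond_M2p p M \<longleftrightarrow> cond_M2_exponent (real CARD('n) / p) M"

definition cond_G :: "real \<Rightarrow> (real ^ 'n \<Rightarrow> real \<Rightarrow> real) \<Rightarrow> bool" where
  "cond_G p M \<longleftrightarrow> (\<exists>c>0. AE x in lebesgue. \<forall>s\<ge>0. c * s powr p \<le> M x s)"


section \<open>Partial derivatives and test functions\<close>

definition partial :: "'n \<Rightarrow> (real ^ 'n \<Rightarrow> real) \<Rightarrow> real ^ 'n \<Rightarrow> real" where
  "partial i f x = deriv (\<lambda>t. f (x + t *\<^sub>R axis i 1)) 0"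

primrec C_times :: "nat \<Rightarrow> (real ^ 'n \<Rightarrow> real) \<Rightarrow> bool" where
  "C_times 0 f \<longleftrightarrow> continuous_on UNIV f"
| "C_times (Suc k) f \<longleftrightarrow> f differentiable_on UNIV \<and> (\<forall>i. C_times k (partial i f))"

definition test_functions :: "(real ^ 'n \<Rightarrow> real) set" where
  "test_functions = {f. (\<forall>k. C_times k f) \<and> compact (closure {x. f x \<noteq> 0})}"

text \<open>Multi-indices are functions \<open>\<alpha> :: 'n \<Rightarrow> nat\<close>. Since \<open>'n\<close> carries no order, iterated partial
  derivatives are taken along some fixed enumeration of the coordinates; which one is
  irrelevant for smooth functions by symmetry of mixed partial derivatives.\<close>

definition mi_order :: "('n::finite \<Rightarrow> nat) \<Rightarrow> nat" where
  "mi_order \<alpha> = (\<Sum>i\<in>UNIV. \<alpha> i)"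

definition coords :: "'n::finite list" where
  "coords = (SOME xs. distinct xs \<and> set xs = UNIV)"

definition mi_deriv :: "('n \<Rightarrow> nat) \<Rightarrow> (real ^ 'n \<Rightarrow> real) \<Rightarrow> real ^ 'n \<Rightarrow> real" where
  "mi_deriv \<alpha> f = foldr (\<lambda>i g. (partial i ^^ \<alpha> i) g) coords f"


section \<open>Distributional derivatives\<close>

definition locally_integrable :: "(real ^ 'n \<Rightarrow> real) \<Rightarrow> bool" where
  "locally_integrable u \<longleftrightarrow> (\<forall>K. compact K \<longrightarrow> set_integrable lebesgue K u)"

text \<open>The distribution \<open>D\<^sup>\<alpha> u\<close> is represented by the function \<open>v\<close>.\<close>

definition has_distr_deriv ::
  "('n \<Rightarrow> nat) \<Rightarrow> (real ^ 'n \<Rightarrow> real) \<Rightarrow> (real ^ 'n \<Rightarrow> real) \<Rightarrow> bool" where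
  "has_distr_deriv \<alpha> u v \<longleftrightarrow>
     locally_integrable u \<and> locally_integrable v \<and>
     (\<forall>\<psi>\<in>test_functions.
        (LINT x|lebesgue. u x * mi_deriv \<alpha> \<psi> x) =
        (- 1) ^ mi_order \<alpha> * (LINT x|lebesgue. v x * \<psi> x))"

text \<open>A representative of \<open>D\<^sup>\<alpha> u\<close>; if one exists, it is unique up to null sets.\<close>

definition distr_deriv :: "('n \<Rightarrow> nat) \<Rightarrow> (real ^ 'n \<Rightarrow> real) \<Rightarrow> real ^ 'n \<Rightarrow> real" where
  "distr_deriv \<alpha> u = (SOME v. has_distr_deriv \<alpha> u v)"


section \<open>Musielak-Orlicz and Musielak-Orlicz-Sobolev spaces\<close>

text \<open>Elements of the spaces are functions, not classes modulo equality almost everywhere.\<close>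

definition modular ::
  "(real ^ 'n \<Rightarrow> real \<Rightarrow> real) \<Rightarrow> real \<Rightarrow> (real ^ 'n \<Rightarrow> real) \<Rightarrow> ennreal" where
  "modular M l u = (\<integral>\<^sup>+ x. ennreal (M x (\<bar>u x\<bar> / l)) \<partial>lebesgue)"

definition L_space :: "(real ^ 'n \<Rightarrow> real \<Rightarrow> real) \<Rightarrow> (real ^ 'n \<Rightarrow> real) set" where
  "L_space M = {u \<in> borel_measurable lebesgue. \<exists>l>0. modular M l u < \<infinity>}"

definition E_space :: "(real ^ 'n \<Rightarrow> real \<Rightarrow> real) \<Rightarrow> (real ^ 'n \<Rightarrow> real) set" where
  "E_space M = {u \<in> borel_measurable lebesgue. \<forall>l>0. modular M l u < \<infinity>}"

definition WL_space :: "nat \<Rightarrow> (real ^ 'n \<Rightarrow> real \<Rightarrow> real) \<Rightarrow> (real ^ 'n \<Rightarrow> real) set" where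
  "WL_space m M = {u. \<forall>\<alpha>. mi_order \<alpha> \<le> m \<longrightarrow> (\<exists>v\<in>L_space M. has_distr_deriv \<alpha> u v)}"

definition WE_space :: "nat \<Rightarrow> (real ^ 'n \<Rightarrow> real \<Rightarrow> real) \<Rightarrow> (real ^ 'n \<Rightarrow> real) set" where
  "WE_space m M = {u. \<forall>\<alpha>. mi_order \<alpha> \<le> m \<longrightarrow> (\<exists>v\<in>E_space M. has_distr_deriv \<alpha> u v)}"

text \<open>The set of admissible \<open>l\<close> is nonempty for \<open>u \<in> WL_space m M\<close>, the only functions for which the norm
  is meaningful.\<close>

definition W_norm :: "nat \<Rightarrow> (real ^ 'n \<Rightarrow> real \<Rightarrow> real) \<Rightarrow> (real ^ 'n \<Rightarrow> real) \<Rightarrow> real" where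
  "W_norm m M u =
     Inf {l. 0 < l \<and> (\<Sum>\<alpha> | mi_order \<alpha> \<le> m. modular M l (distr_deriv \<alpha> u)) \<le> 1}"

lemma finite_mi_order_le: "finite {\<alpha> :: 'n::finite \<Rightarrow> nat. mi_order \<alpha> \<le> m}"
proof (rule finite_subset)
  show "{\<alpha> :: 'n \<Rightarrow> nat. mi_order \<alpha> \<le> m} \<subseteq> PiE UNIV (\<lambda>_. {..m})"
  proof
    fix \<alpha> :: "'n \<Rightarrow> nat"
    assume "\<alpha> \<in> {\<alpha>. mi_order \<alpha> \<le> m}"
    then have m: "mi_order \<alpha> \<le> m" by simp
    have "\<alpha> i \<le> mi_order \<alpha>" for i
      unfolding mi_order_def by (rule member_le_sum) simp_all
    then have "\<alpha> i \<in> {..m}" for i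
      using m order_trans by blast
    then show "\<alpha> \<in> PiE UNIV (\<lambda>_. {..m})"
      by (intro PiE_I) simp_all
  qed
  show "finite (PiE (UNIV :: 'n set) (\<lambda>_. {..m}))"
    by (rule finite_PiE) simp_all
qed

end

theory Submission
  imports Defs
begin

text \<open>
  A function of the Sobolev space is first multiplied by a smooth cut-off \<open>\<theta>(x/k)\<close> and then mollified.
  The derivatives of the product are dominated by a multiple of \<open>\<Sum>|D\<^sup>\<beta>u|\<close> uniformly in \<open>k\<close>, so the
  truncation error is controlled by dominated convergence. For the mollification let
  \<open>a = |w|/l\<close> with \<open>M(\<cdot>, a)\<close> integrable. Integrability of \<open>a\<close> (or, under \<open>G\<^sub>p\<close>, of \<open>a\<^sup>p\<close>) gives
  \<open>a * \<rho>\<^sub>\<epsilon> \<le> c \<epsilon>\<^sup>-\<^sup>q\<close> with \<open>q = N\<close> (or \<open>N/p\<close>), which is exactly the range where the regularity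
  condition makes \<open>M(x, \<cdot>)\<close> and \<open>M(y, \<cdot>)\<close> comparable for \<open>|x - y| < \<epsilon>\<close>. A supporting line of \<open>M(x, \<cdot>)\<close>
  then yields a Jensen inequality \<open>M(x, a * \<rho>\<^sub>\<epsilon>) \<le> C (M(\<cdot>, a) * \<rho>\<^sub>\<epsilon>)(x)\<close>. Its right-hand side converges in
  \<open>L\<^sup>1\<close>, and generalised dominated convergence along almost everywhere convergent subsequences gives
  modular convergence.
\<close>

section \<open>Smooth functions and iterated partial derivatives\<close>

text \<open>No doubling condition is available, so a finite modular at one scale says nothing about
  smaller scales. Every estimate therefore carries its scale l, splitting a sum doubles it, and
  density is proved once, with a loss factor A fixed before l and the tolerance: on the E-space A is
  harmless because all scales are admissible, on the L-space it is absorbed into the final scale.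
  Truncation comes first because the bound on \<open>a * \<rho>\<close> needs a globally integrable
  \<open>a\<close>, while the derivatives of \<open>u\<close> are only locally integrable. The
  obstacle in the Jensen inequality is that the average runs over \<open>y\<close> while
  \<open>M x\<close> is frozen at \<open>x\<close>, and the two functions are comparable only for
  arguments of size \<open>e powr (- q)\<close>. The average of \<open>a\<close> stays in that
  range, the values of \<open>a\<close> do not. Replacing \<open>M x\<close> by its supporting line
  at the average leaves an affine function, which can be compared with \<open>M y\<close> at every
  argument.\<close>

lemma has_derivative_partial:
  fixes f :: "real ^ 'n \<Rightarrow> real"
  assumes "(f has_derivative f') (at x)"
  shows "partial i f x = f' (axis i 1)"
proof -
  interpret bounded_linear f' by (rule has_derivative_bounded_linear[OF assms])
  have "((\<lambda>t::real. x + t *\<^sub>R axis i 1) has_derivative (\<lambda>t. t *\<^sub>R axis i 1)) (at 0)"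
    by (auto intro!: derivative_eq_intros)
  then have "((\<lambda>t. f (x + t *\<^sub>R axis i 1)) has_derivative (\<lambda>t. f' (t *\<^sub>R axis i 1))) (at 0)"
    using has_derivative_compose[of "\<lambda>t::real. x + t *\<^sub>R axis i 1" _ 0 UNIV f f'] assms by simp
  then have "((\<lambda>t. f (x + t *\<^sub>R axis i 1)) has_real_derivative f' (axis i 1)) (at 0)"
    unfolding has_field_derivative_def by (simp add: scaleR mult.commute[of _ "f' (axis i 1)"])
  then show ?thesis
    unfolding partial_def by (rule DERIV_imp_deriv)
qed

lemma has_derivative_sum_partial:
  fixes f :: "real ^ 'n \<Rightarrow> real"
  assumes "f differentiable (at x)"
  shows "(f has_derivative (\<lambda>h. \<Sum>i\<in>UNIV. h $ i * partial i f x)) (at x)"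
proof -
  obtain f' where f': "(f has_derivative f') (at x)"
    using assms by (auto simp: differentiable_def)
  interpret bounded_linear f' by (rule has_derivative_bounded_linear[OF f'])
  have "f' h = (\<Sum>i\<in>UNIV. h $ i * partial i f x)" for h
  proof -
    have "f' h = f' (\<Sum>i\<in>UNIV. h $ i *\<^sub>R axis i 1)"
      using basis_expansion[of h] by (simp add: scalar_mult_eq_scaleR)
    also have "\<dots> = (\<Sum>i\<in>UNIV. h $ i * f' (axis i 1))"
      by (simp add: sum scaleR)
    finally show ?thesis by (simp add: has_derivative_partial[OF f'])
  qed
  then have "f' = (\<lambda>h. \<Sum>i\<in>UNIV. h $ i * partial i f x)" by blast
  with f' show ?thesis by simp
qed

section \<open>Closure of smoothness under sums, products and affine substitutions\<close>

lemma C_times_SucD: "C_times (Suc k) f \<Longrightarrow> C_times k f"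
proof (induction k arbitrary: f)
  case 0
  then show ?case by (auto intro: differentiable_imp_continuous_on)
qed auto

lemma partial_const: "partial i (\<lambda>_. c) = (\<lambda>_. 0)"
  by (simp add: partial_def fun_eq_iff)

lemma C_times_const: "C_times k (\<lambda>_. c)"
  by (induction k arbitrary: c) (simp_all add: partial_const)

lemma partial_add:
  assumes "f differentiable_on UNIV" "g differentiable_on UNIV"
  shows "partial i (\<lambda>x. f x + g x) = (\<lambda>x. partial i f x + partial i g x)"
proof
  fix x
  have *: "f differentiable (at x)" "g differentiable (at x)"
    using assms by (auto simp: differentiable_on_def)
  show "partial i (\<lambda>x. f x + g x) x = partial i f x + partial i g x"
    by (subst has_derivative_partial[OF has_derivative_add[OF *[THEN has_derivative_sum_partial]]])
       (simp add: axis_def if_distrib[of "\<lambda>c. c * _"] cong: if_cong)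
qed

lemma partial_mult:
  assumes "f differentiable_on UNIV" "g differentiable_on UNIV"
  shows "partial i (\<lambda>x. f x * g x) = (\<lambda>x. f x * partial i g x + partial i f x * g x)"
proof
  fix x
  have *: "f differentiable (at x)" "g differentiable (at x)"
    using assms by (auto simp: differentiable_on_def)
  show "partial i (\<lambda>x. f x * g x) x = f x * partial i g x + partial i f x * g x"
    by (subst has_derivative_partial[OF has_derivative_mult[OF *[THEN has_derivative_sum_partial]]])
       (simp add: axis_def if_distrib[of "\<lambda>c. c * _"] cong: if_cong)
qed

lemma C_times_add: "C_times k f \<Longrightarrow> C_times k g \<Longrightarrow> C_times k (\<lambda>x. f x + g x)"
  by (induction k arbitrary: f g)
     (auto simp: partial_add intro!: continuous_intros differentiable_on_add)

lemma C_times_mult: "C_times k f \<Longrightarrow> C_times k g \<Longrightarrow> C_times k (\<lambda>x. f x * g x)"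
proof (induction k arbitrary: f g)
  case (Suc k)
  then show ?case using C_times_SucD[of k f] C_times_SucD[of k g]
    by (auto simp: partial_mult intro!: C_times_add differentiable_on_mult)
qed (auto intro: continuous_intros)

definition smooth :: "(real ^ 'n \<Rightarrow> real) \<Rightarrow> bool" where
  "smooth f \<longleftrightarrow> (\<forall>k. C_times k f)"

lemma smooth_differentiable: "smooth f \<Longrightarrow> f differentiable_on UNIV"
  unfolding smooth_def by (metis C_times.simps(2))

lemma smooth_continuous: "smooth f \<Longrightarrow> continuous_on UNIV f"
  unfolding smooth_def by (metis C_times.simps(1))

lemma smooth_partial: "smooth f \<Longrightarrow> smooth (partial i f)"
  unfolding smooth_def by (metis C_times.simps(2))

lemma smooth_const: "smooth (\<lambda>_. c)"
  by (simp add: smooth_def C_times_const)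

lemma smooth_add: "smooth f \<Longrightarrow> smooth g \<Longrightarrow> smooth (\<lambda>x. f x + g x)"
  by (simp add: smooth_def C_times_add)

lemma smooth_mult: "smooth f \<Longrightarrow> smooth g \<Longrightarrow> smooth (\<lambda>x. f x * g x)"
  by (simp add: smooth_def C_times_mult)

lemma smooth_cmult: "smooth f \<Longrightarrow> smooth (\<lambda>x. c * f x)"
  by (intro smooth_mult smooth_const)

lemma smooth_prod: "finite I \<Longrightarrow> (\<And>i. i \<in> I \<Longrightarrow> smooth (f i)) \<Longrightarrow> smooth (\<lambda>x. \<Prod>i\<in>I. f i x)"
  by (induction I rule: finite_induct) (auto intro: smooth_mult smooth_const)

text \<open>Serves families whose partial derivatives stay in the family up to a changed parameter:
  a scaled affine substitution, or a convolution with another test function.\<close>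

lemma smooth_coinduct:
  assumes "P f"
    and "\<And>f. P f \<Longrightarrow> f differentiable_on UNIV"
    and "\<And>f i. P f \<Longrightarrow> P (partial i f)"
  shows "smooth f"
proof -
  have "C_times k f" if "P f" for k f
    using that by (induction k arbitrary: f) (use assms in \<open>auto intro: differentiable_imp_continuous_on\<close>)
  with assms(1) show ?thesis by (simp add: smooth_def)
qed

lemma partial_cmult:
  assumes "f differentiable_on UNIV"
  shows "partial i (\<lambda>x. c * f x) = (\<lambda>x. c * partial i f x)"
proof -
  have "partial i (\<lambda>_. c) = (\<lambda>_. 0)" by (simp add: partial_def fun_eq_iff)
  then show ?thesis using partial_mult[of "\<lambda>_. c" f i] assms by simp
qed

lemma differentiable_affine:
  assumes "f differentiable_on UNIV"
  shows "(\<lambda>x. f (b + a *\<^sub>R x)) differentiable_on UNIV"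
proof -
  have "(\<lambda>x. f (b + a *\<^sub>R x)) differentiable (at x)" for x
    using differentiable_chain_at[of "\<lambda>x. b + a *\<^sub>R x" x f] assms
    by (simp add: differentiable_on_def o_def)
  then show ?thesis by (simp add: differentiable_on_def)
qed

lemma partial_affine:
  fixes f :: "real ^ 'n \<Rightarrow> real"
  assumes "f differentiable_on UNIV"
  shows "partial i (\<lambda>x. f (b + a *\<^sub>R x)) = (\<lambda>x. a * partial i f (b + a *\<^sub>R x))"
proof
  fix x :: "real ^ 'n"
  have f: "f differentiable (at (b + a *\<^sub>R x))"
    using assms by (auto simp: differentiable_on_def)
  have "((\<lambda>x. b + a *\<^sub>R x) has_derivative (\<lambda>h. a *\<^sub>R h)) (at x)"
    by (auto intro!: derivative_eq_intros)
  then have "((\<lambda>x. f (b + a *\<^sub>R x)) has_derivative (\<lambda>h. \<Sum>i\<in>UNIV. (a *\<^sub>R h) $ i * partial i f (b + a *\<^sub>R x))) (at x)"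
    by (rule has_derivative_compose) (rule has_derivative_sum_partial[OF f])
  from has_derivative_partial[OF this]
  show "partial i (\<lambda>x. f (b + a *\<^sub>R x)) x = a * partial i f (b + a *\<^sub>R x)"
    by (simp add: axis_def if_distrib[of "\<lambda>c. c * _"]  if_distrib[of "\<lambda>c. _ * c"] cong: if_cong)
qed

text \<open>Words of coordinates replace multi-indices in all inductions, because a word loses one
  derivative at a time. The return to multi-indices goes through
  \<open>mi_deriv_eq_iter_partial\<close> and \<open>mi_deriv_count_list\<close>.\<close>

primrec iter_partial :: "'n list \<Rightarrow> (real ^ 'n \<Rightarrow> real) \<Rightarrow> real ^ 'n \<Rightarrow> real" where
  "iter_partial [] f = f"
| "iter_partial (i # is) f = partial i (iter_partial is f)"

lemma iter_partial_append: "iter_partial (is @ js) f = iter_partial is (iter_partial js f)"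
  by (induction "is") auto

lemma smooth_iter_partial: "smooth f \<Longrightarrow> smooth (iter_partial is f)"
  by (induction "is") (auto intro: smooth_partial)

lemma iter_partial_cmult:
  "smooth f \<Longrightarrow> iter_partial is (\<lambda>x. c * f x) = (\<lambda>x. c * iter_partial is f x)"
  by (induction "is") (auto simp: partial_cmult smooth_differentiable smooth_iter_partial)

lemma iter_partial_affine:
  "smooth f \<Longrightarrow> iter_partial is (\<lambda>x. f (b + a *\<^sub>R x)) = (\<lambda>x. a ^ length is * iter_partial is f (b + a *\<^sub>R x))"
proof (induction "is")
  case (Cons i "is")
  have d: "iter_partial is f differentiable_on UNIV"
    using Cons.prems by (intro smooth_differentiable smooth_iter_partial)
  show ?case using Cons
    by (simp add: partial_cmult[OF differentiable_affine[OF d]] partial_affine[OF d] mult_ac)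
qed simp

lemma smooth_affine:
  fixes f :: "real ^ 'n \<Rightarrow> real"
  assumes "smooth f"
  shows "smooth (\<lambda>x. f (b + a *\<^sub>R x))"
proof (rule smooth_coinduct[where P = "\<lambda>g. \<exists>f c. smooth f \<and> g = (\<lambda>x. c * f (b + a *\<^sub>R x))"])
  show "\<exists>g c. smooth g \<and> (\<lambda>x. f (b + a *\<^sub>R x)) = (\<lambda>x. c * g (b + a *\<^sub>R x))"
    using assms by (intro exI[of _ f] exI[of _ 1]) simp
next
  fix g :: "real ^ 'n \<Rightarrow> real" assume "\<exists>f c. smooth f \<and> g = (\<lambda>x. c * f (b + a *\<^sub>R x))"
  then obtain f c where f: "smooth f" and g: "g = (\<lambda>x. c * f (b + a *\<^sub>R x))" by auto
  have d: "(\<lambda>x. f (b + a *\<^sub>R x)) differentiable_on UNIV"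
    by (intro differentiable_affine smooth_differentiable f)
  then show "g differentiable_on UNIV" unfolding g
    by (intro differentiable_on_mult) auto
  fix i
  have "partial i g = (\<lambda>x. (c * a) * partial i f (b + a *\<^sub>R x))"
    unfolding g by (simp add: partial_cmult[OF d] partial_affine[OF smooth_differentiable[OF f]] mult_ac)
  with f show "\<exists>f c. smooth f \<and> partial i g = (\<lambda>x. c * f (b + a *\<^sub>R x))"
    using smooth_partial by blast
qed

section \<open>Symmetry of mixed partial derivatives\<close>

lemma has_field_derivative_axis:
  fixes f :: "real ^ 'n \<Rightarrow> real"
  assumes "smooth f"
  shows "((\<lambda>s. f (x + s *\<^sub>R axis i 1)) has_real_derivative partial i f (x + s *\<^sub>R axis i 1)) (at s)"
proof -
  have f: "f differentiable (at (x + s *\<^sub>R axis i 1))"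
    using smooth_differentiable[OF assms] by (auto simp: differentiable_on_def)
  have "((\<lambda>s. x + s *\<^sub>R axis i 1) has_derivative (\<lambda>t. t *\<^sub>R axis i 1)) (at s)"
    by (auto intro!: derivative_eq_intros)
  then have "((\<lambda>s. f (x + s *\<^sub>R axis i 1)) has_derivative
     (\<lambda>t. \<Sum>k\<in>UNIV. (t *\<^sub>R axis i 1) $ k * partial k f (x + s *\<^sub>R axis i 1))) (at s)"
    by (rule has_derivative_compose) (rule has_derivative_sum_partial[OF f])
  then show ?thesis
    unfolding has_field_derivative_def
    by (simp add: axis_def if_distrib[of "\<lambda>c. c * _"]  if_distrib[of "\<lambda>c. _ * c"] mult.commute[of _ "partial i f _"] cong: if_cong)
qed

text \<open>Mean value theorem twice: along direction \<open>i\<close> for the increment of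
  \<open>f\<close> in direction \<open>j\<close>, then along \<open>j\<close> for
  \<open>partial i f\<close>. The left-hand side is symmetric in \<open>i\<close> and
  \<open>j\<close>, which is what \<open>partial_commute\<close> exploits.\<close>

lemma second_difference_mean_value:
  fixes f :: "real ^ 'n \<Rightarrow> real"
  assumes "smooth f" "0 < h"
  shows "\<exists>a b. 0 < a \<and> a < h \<and> 0 < b \<and> b < h \<and>
    f (x + h *\<^sub>R axis i 1 + h *\<^sub>R axis j 1) - f (x + h *\<^sub>R axis i 1) - f (x + h *\<^sub>R axis j 1) + f x
    = h * h * partial j (partial i f) (x + a *\<^sub>R axis i 1 + b *\<^sub>R axis j 1)"
proof -
  define G where "G s = f (x + h *\<^sub>R axis j 1 + s *\<^sub>R axis i 1) - f (x + s *\<^sub>R axis i 1)" for s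
  define G' where "G' s = partial i f (x + h *\<^sub>R axis j 1 + s *\<^sub>R axis i 1) - partial i f (x + s *\<^sub>R axis i 1)" for s
  have "(G has_real_derivative G' s) (at s)" for s
    unfolding G_def G'_def using has_field_derivative_axis[OF assms(1)]
    by (intro derivative_intros)
  then have "\<exists>a>0. a < h \<and> G h - G 0 = (h - 0) * G' a"
    by (intro MVT2) (use assms in auto)
  then obtain a where a: "0 < a" "a < h" "G h - G 0 = h * G' a" by auto
  define K where "K t = partial i f (x + a *\<^sub>R axis i 1 + t *\<^sub>R axis j 1)" for t
  define K' where "K' t = partial j (partial i f) (x + a *\<^sub>R axis i 1 + t *\<^sub>R axis j 1)" for t
  have "(K has_real_derivative K' t) (at t)" for t
    unfolding K_def K'_def using has_field_derivative_axis[OF smooth_partial[OF assms(1)]] .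
  then have "\<exists>b>0. b < h \<and> K h - K 0 = (h - 0) * K' b"
    by (intro MVT2) (use assms in auto)
  then obtain b where b: "0 < b" "b < h" "K h - K 0 = h * K' b" by auto
  have "G' a = K h - K 0" unfolding G'_def K_def by (simp add: algebra_simps)
  with a b have "G h - G 0 = h * h * K' b" by simp
  moreover have "G h - G 0 = f (x + h *\<^sub>R axis i 1 + h *\<^sub>R axis j 1) - f (x + h *\<^sub>R axis i 1) - f (x + h *\<^sub>R axis j 1) + f x"
    unfolding G_def by (simp add: algebra_simps)
  ultimately show ?thesis using a b unfolding K'_def by metis
qed

text \<open>Both mixed derivatives, taken at suitable points near \<open>x\<close>, equal the same
  second difference divided by the squared step. Continuity removes the intermediate points as the
  step tends to 0.\<close>

lemma partial_commute:
  fixes f :: "real ^ 'n \<Rightarrow> real"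
  assumes "smooth f"
  shows "partial i (partial j f) = partial j (partial i f)"
proof
  fix x :: "real ^ 'n"
  let ?P = "\<lambda>h i j a b. 0 < a \<and> a < h \<and> 0 < b \<and> b < h \<and>
    f (x + h *\<^sub>R axis i 1 + h *\<^sub>R axis j 1) - f (x + h *\<^sub>R axis i 1) - f (x + h *\<^sub>R axis j 1) + f x
    = h * h * partial j (partial i f) (x + a *\<^sub>R axis i 1 + b *\<^sub>R axis j 1)"
  define h :: "nat \<Rightarrow> real" where "h n = inverse (real (Suc n))" for n
  have hpos: "h n > 0" for n by (simp add: h_def)
  have h0: "h \<longlonglongrightarrow> 0" unfolding h_def by (rule LIMSEQ_inverse_real_of_nat)
  \<comment> \<open>Stated for arbitrary directions, since it is instantiated in both orders; the
    two instances yield different sequences of intermediate points.\<close>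
  have lim: "\<exists>p. p \<longlonglongrightarrow> x \<and> (\<forall>n. f (x + h n *\<^sub>R axis i 1 + h n *\<^sub>R axis j 1) - f (x + h n *\<^sub>R axis i 1) - f (x + h n *\<^sub>R axis j 1) + f x
       = h n * h n * partial j (partial i f) (p n))" for i j
  proof -
    have "\<forall>n. \<exists>a b. ?P (h n) i j a b"
      using second_difference_mean_value[OF assms hpos] by blast
    then obtain a b where ab: "\<And>n. ?P (h n) i j (a n) (b n)" by metis
    have "a \<longlonglongrightarrow> 0" "b \<longlonglongrightarrow> 0"
      by (rule real_tendsto_sandwich[OF _ _ tendsto_const h0]; use ab in \<open>force intro: always_eventually less_imp_le\<close>)+
    then have "(\<lambda>n. x + a n *\<^sub>R axis i 1 + b n *\<^sub>R axis j 1) \<longlonglongrightarrow> x + 0 *\<^sub>R axis i 1 + 0 *\<^sub>R axis j 1"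
      by (intro tendsto_intros)
    with ab show ?thesis
      by (intro exI[of _ "\<lambda>n. x + a n *\<^sub>R axis i 1 + b n *\<^sub>R axis j 1"]) auto
  qed
  obtain p where p: "p \<longlonglongrightarrow> x" "\<And>n. f (x + h n *\<^sub>R axis i 1 + h n *\<^sub>R axis j 1) - f (x + h n *\<^sub>R axis i 1) - f (x + h n *\<^sub>R axis j 1) + f x
       = h n * h n * partial j (partial i f) (p n)" using lim[of i j] by auto
  obtain q where q: "q \<longlonglongrightarrow> x" "\<And>n. f (x + h n *\<^sub>R axis j 1 + h n *\<^sub>R axis i 1) - f (x + h n *\<^sub>R axis j 1) - f (x + h n *\<^sub>R axis i 1) + f x
       = h n * h n * partial i (partial j f) (q n)" using lim[of j i] by auto
  have "partial j (partial i f) (p n) = partial i (partial j f) (q n)" for n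
  proof -
    have "h n * h n * partial j (partial i f) (p n) = h n * h n * partial i (partial j f) (q n)"
      unfolding p(2)[symmetric] q(2)[symmetric] by (simp add: algebra_simps)
    then show ?thesis using hpos[of n] by simp
  qed
  moreover have "isCont (partial j (partial i f)) x" "isCont (partial i (partial j f)) x"
    using smooth_continuous[OF smooth_partial[OF smooth_partial[OF assms]]]
    by (auto simp: continuous_on_eq_continuous_at)
  then have "(\<lambda>n. partial j (partial i f) (p n)) \<longlonglongrightarrow> partial j (partial i f) x"
      "(\<lambda>n. partial i (partial j f) (q n)) \<longlonglongrightarrow> partial i (partial j f) x"
    using p(1) q(1) by (auto intro: isCont_tendsto_compose)
  ultimately show "partial i (partial j f) x = partial j (partial i f) x"
    using LIMSEQ_unique by force
qed

lemma iter_partial_commute: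
  "smooth f \<Longrightarrow> iter_partial is (partial i f) = partial i (iter_partial is f)"
  by (induction "is") (auto simp: partial_commute smooth_iter_partial)

lemma iter_partial_perm:
  assumes "smooth f" "mset is = mset js"
  shows "iter_partial is f = iter_partial js f"
  using assms(2)
proof (induction "is" arbitrary: js)
  case (Cons i "is")
  then have "i \<in> set js" by (metis list.set_intros(1) mset_eq_setD)
  then obtain js1 js2 where js: "js = js1 @ i # js2" by (meson split_list)
  with Cons have "iter_partial is f = iter_partial (js1 @ js2) f" by auto
  then show ?case
    using assms(1) by (simp add: js iter_partial_append iter_partial_commute smooth_iter_partial)
qed simp

section \<open>Passage between multi-indices and words of coordinates\<close>

definition index_list :: "('n::finite \<Rightarrow> nat) \<Rightarrow> 'n list" where
  "index_list \<alpha> = concat (map (\<lambda>i. replicate (\<alpha> i) i) coords)"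

lemma mi_deriv_eq_iter_partial:
  fixes f :: "real ^ 'n \<Rightarrow> real"
  shows "mi_deriv \<alpha> f = iter_partial (index_list \<alpha>) f"
proof -
  have *: "iter_partial (replicate n i) g = (partial i ^^ n) g" for n g and i :: 'n
    by (induction n) auto
  have "foldr (\<lambda>i g. (partial i ^^ \<alpha> i) g) xs f = iter_partial (concat (map (\<lambda>i. replicate (\<alpha> i) i) xs)) f" for xs
    by (induction xs) (auto simp: iter_partial_append *)
  then show ?thesis by (simp add: mi_deriv_def index_list_def)
qed

lemma coords: "distinct (coords :: 'n::finite list)" "set (coords :: 'n list) = UNIV"
proof -
  have "\<exists>xs :: 'n list. distinct xs \<and> set xs = UNIV"
    using finite_distinct_list[of "UNIV :: 'n set"] by auto
  from someI_ex[OF this] show "distinct (coords :: 'n::finite list)" "set (coords :: 'n list) = UNIV"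
    by (auto simp: coords_def)
qed

text \<open>\<open>count_list\<close> reads off the multi-index of a word, and
  \<open>index_list\<close> is a right inverse of it. The enumeration \<open>coords\<close> enters
  only through being distinct and exhaustive.\<close>

lemma count_index_list:
  fixes \<alpha> :: "'n::finite \<Rightarrow> nat"
  shows "count_list (index_list \<alpha>) = \<alpha>"
proof
  fix j :: 'n
  have "count_list (replicate n i) j = (if i = j then n else 0)" for n and i :: 'n
    by (induction n) auto
  then have "count_list (concat (map (\<lambda>i. replicate (\<alpha> i) i) xs)) j = (if j \<in> set xs then \<alpha> j else 0)"
    if "distinct xs" for xs
    using that by (induction xs) auto
  from this[OF coords(1)] show "count_list (index_list \<alpha>) j = \<alpha> j"
    by (simp add: index_list_def coords(2))
qed

lemma mi_order_count_list: "mi_order (count_list is) = length is"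
  unfolding mi_order_def using sum_count_set[of "is" UNIV] by simp

lemma length_index_list: "length (index_list \<alpha>) = mi_order \<alpha>"
  by (metis count_index_list mi_order_count_list)

text \<open>Frees \<open>mi_deriv\<close> from the arbitrary enumeration: any word with the same
  multiplicities gives the same derivative, by symmetry of mixed partials.\<close>

lemma mi_deriv_count_list:
  assumes "smooth f"
  shows "mi_deriv (count_list is) f = iter_partial is f"
  unfolding mi_deriv_eq_iter_partial
proof (rule iter_partial_perm[OF assms], rule multiset_eqI)
  fix i
  have "count (mset xs) i = count_list xs i" for xs :: "'a list"
    by (simp add: count_mset count_list_eq_length_filter)
  then show "count (mset (index_list (count_list is))) i = count (mset is) i"
    by (simp add: count_index_list)
qed

text \<open>The Leibniz formula solved for the term \<open>\<theta> D\<^sup>\<alpha>\<psi>\<close>, so that every derivative falls on a product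
  with \<open>\<psi>\<close>: this is the form that can be tested against a distributional derivative.\<close>

lemma iter_partial_leibniz:
  fixes "is" :: "'n::finite list"
  shows "\<exists>L. (\<forall>(c, bs, gs) \<in> set L. length bs \<le> length is \<and> gs \<noteq> []) \<and>
    (\<forall>\<theta> \<psi>. smooth \<theta> \<longrightarrow> smooth \<psi> \<longrightarrow>
      (\<forall>x. \<theta> x * iter_partial is \<psi> x = iter_partial is (\<lambda>x. \<theta> x * \<psi> x) x +
        (\<Sum>(c, bs, gs) \<leftarrow> L. c * iter_partial bs (\<lambda>x. \<psi> x * iter_partial gs \<theta> x) x)))"
    (is "\<exists>L. ?A is L \<and> (\<forall>\<theta> \<psi>. smooth \<theta> \<longrightarrow> smooth \<psi> \<longrightarrow> ?B is \<theta> \<psi> L)")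
proof (induction "is")
  case Nil
  show ?case by (intro exI[of _ "[]"]) simp
next
  case (Cons i "is")
  then obtain L where L: "?A is L" "\<And>\<theta> \<psi>. smooth \<theta> \<Longrightarrow> smooth \<psi> \<Longrightarrow> ?B is \<theta> \<psi> L" by blast
  define S where "S L \<theta> \<psi> x = (\<Sum>(c, bs, gs) \<leftarrow> L. c * iter_partial bs (\<lambda>x. \<psi> x * iter_partial gs \<theta> x) x)"
    for L :: "(real \<times> 'n list \<times> 'n list) list" and \<theta> \<psi> :: "real ^ 'n \<Rightarrow> real" and x
  \<comment> \<open>The product rule gives \<open>\<theta> * \<partial>(D\<psi>)\<close> as
    \<open>\<partial>(\<theta> * D\<psi>) - (\<partial>\<theta>) * D\<psi>\<close>, with
    \<open>D\<close> for the derivatives along \<open>is\<close>. \<open>L1\<close> comes from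
    differentiating the old correction terms. \<open>L2\<close> is minus the induction hypothesis
    with \<open>partial i \<theta>\<close> in place of \<open>\<theta>\<close>, hence the sign
    change and the \<open>i\<close> appended at the inner end of \<open>gs\<close>. In each new term
    \<open>\<theta>\<close> carries at least one derivative.\<close>
  define L1 where "L1 = map (\<lambda>(c, bs, gs). (c, i # bs, gs)) L"
  define L2 where "L2 = (-1, is, [i]) # map (\<lambda>(c, bs, gs). (- c, bs, gs @ [i])) L"
  have SC: "S (t # L) \<theta> \<psi> x = (case t of (c, bs, gs) \<Rightarrow> c * iter_partial bs (\<lambda>x. \<psi> x * iter_partial gs \<theta> x) x) + S L \<theta> \<psi> x"
    "S [] \<theta> \<psi> x = 0" for t L \<theta> \<psi> x by (simp_all add: S_def)
  have sm: "smooth (iter_partial bs (\<lambda>x. \<psi> x * iter_partial gs \<theta> x))" if "smooth \<theta>" "smooth \<psi>" for \<theta> \<psi> bs gs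
    using that by (intro smooth_iter_partial smooth_mult)
  have smS: "smooth (S L \<theta> \<psi>)" if "smooth \<theta>" "smooth \<psi>" for \<theta> \<psi> L
  proof (induction L)
    case (Cons t L)
    then show ?case by (cases t) (auto simp: SC[abs_def] intro!: smooth_add smooth_cmult sm that)
  qed (simp add: SC[abs_def] smooth_const)
  have pS: "partial i (S L \<theta> \<psi>) x = S (map (\<lambda>(c, bs, gs). (c, i # bs, gs)) L) \<theta> \<psi> x" if "smooth \<theta>" "smooth \<psi>" for \<theta> \<psi> L x
  proof (induction L)
    case (Cons t L)
    obtain c bs gs where t: "t = (c, bs, gs)" by (cases t)
    have "partial i (S (t # L) \<theta> \<psi>) x = c * partial i (iter_partial bs (\<lambda>x. \<psi> x * iter_partial gs \<theta> x)) x + partial i (S L \<theta> \<psi>) x"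
      unfolding SC[abs_def] t by (simp add: partial_add partial_cmult sm[THEN smooth_differentiable] that smS[THEN smooth_differentiable]
          smooth_cmult[OF sm, THEN smooth_differentiable])
    also have "\<dots> = S (map (\<lambda>(c, bs, gs). (c, i # bs, gs)) (t # L)) \<theta> \<psi> x"
      using Cons by (simp add: t SC)
    finally show ?case .
  qed (simp add: SC[abs_def] partial_const)
  have nS: "S (map (\<lambda>(c, bs, gs). (- c, bs, gs @ [i])) L) \<theta> \<psi> x = - S L (partial i \<theta>) \<psi> x" for \<theta> \<psi> L x
    by (induction L) (auto simp: SC iter_partial_append)
  have "?B (i # is) \<theta> \<psi> (L1 @ L2)" if s: "smooth \<theta>" "smooth \<psi>" for \<theta> \<psi>
  proof
    fix x
    have d: "iter_partial is \<psi> differentiable_on UNIV" "\<theta> differentiable_on UNIV"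
      "iter_partial is (\<lambda>x. \<theta> x * \<psi> x) differentiable_on UNIV" "S L \<theta> \<psi> differentiable_on UNIV"
      using s by (auto intro!: smooth_differentiable smooth_iter_partial smooth_mult smS)
    have e1: "(\<lambda>x. \<theta> x * iter_partial is \<psi> x) = (\<lambda>x. iter_partial is (\<lambda>x. \<theta> x * \<psi> x) x + S L \<theta> \<psi> x)"
      using L(2)[OF s] by (simp add: S_def fun_eq_iff)
    have "\<theta> x * iter_partial (i # is) \<psi> x = partial i (\<lambda>x. \<theta> x * iter_partial is \<psi> x) x - partial i \<theta> x * iter_partial is \<psi> x"
      using d by (simp add: partial_mult)
    also have "partial i (\<lambda>x. \<theta> x * iter_partial is \<psi> x) x = partial i (iter_partial is (\<lambda>x. \<theta> x * \<psi> x)) x + S L1 \<theta> \<psi> x"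
      unfolding e1 using d by (simp add: partial_add pS[OF s] L1_def)
    also have "partial i \<theta> x * iter_partial is \<psi> x = iter_partial is (\<lambda>x. \<psi> x * partial i \<theta> x) x + S L (partial i \<theta>) \<psi> x"
      using L(2)[OF smooth_partial[OF s(1), of i] s(2)] by (simp add: S_def mult.commute)
    finally have "\<theta> x * iter_partial (i # is) \<psi> x = iter_partial (i # is) (\<lambda>x. \<theta> x * \<psi> x) x + (S L1 \<theta> \<psi> x + S L2 \<theta> \<psi> x)"
      by (simp add: L2_def SC nS)
    then show "\<theta> x * iter_partial (i # is) \<psi> x = iter_partial (i # is) (\<lambda>x. \<theta> x * \<psi> x) x +
        (\<Sum>(c, bs, gs) \<leftarrow> L1 @ L2. c * iter_partial bs (\<lambda>x. \<psi> x * iter_partial gs \<theta> x) x)"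
      by (simp add: S_def)
  qed
  moreover have "?A (i # is) (L1 @ L2)"
    using L(1) by (fastforce simp: L1_def L2_def)
  ultimately show ?case by (intro exI[of _ "L1 @ L2"]) blast
qed

section \<open>Test functions and convolution\<close>

lemma test_functions_iff: "f \<in> test_functions \<longleftrightarrow> smooth f \<and> bounded {x. f x \<noteq> 0}"
  by (simp add: test_functions_def smooth_def compact_closure)

lemma partial_locally_constant:
  fixes f :: "real ^ 'n \<Rightarrow> real"
  assumes "open S" "x \<in> S" "\<And>y. y \<in> S \<Longrightarrow> f y = c"
  shows "partial i f x = 0"
proof -
  have "(f has_derivative (\<lambda>_. 0)) (at x)"
    by (rule has_derivative_transform_within_open[OF has_derivative_const[of c] assms(1,2)])
       (simp add: assms(3))
  then show ?thesis by (rule has_derivative_partial)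
qed

lemma partial_eq_0:
  fixes f :: "real ^ 'n \<Rightarrow> real"
  assumes "x \<notin> closure {x. f x \<noteq> 0}"
  shows "partial i f x = 0"
  using assms closure_subset[of "{x. f x \<noteq> 0}"]
  by (intro partial_locally_constant[of "- closure {x. f x \<noteq> 0}" _ _ 0]) auto

lemma test_partial: "f \<in> test_functions \<Longrightarrow> partial i f \<in> test_functions"
  using partial_eq_0[of _ f i] bounded_subset[OF bounded_closure, of "{x. f x \<noteq> 0}" "{x. partial i f x \<noteq> 0}"]
  by (auto simp: test_functions_iff smooth_partial)

lemma test_iter_partial: "f \<in> test_functions \<Longrightarrow> iter_partial is f \<in> test_functions"
  by (induction "is") (auto intro: test_partial)

lemma test_mult: "f \<in> test_functions \<Longrightarrow> smooth g \<Longrightarrow> (\<lambda>x. f x * g x) \<in> test_functions"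
  by (auto simp: test_functions_iff smooth_mult elim: bounded_subset)

lemma test_mult': "f \<in> test_functions \<Longrightarrow> smooth g \<Longrightarrow> (\<lambda>x. g x * f x) \<in> test_functions"
  by (auto simp: test_functions_iff smooth_mult elim: bounded_subset)

lemma test_smooth: "f \<in> test_functions \<Longrightarrow> smooth f"
  by (simp add: test_functions_iff)

lemma test_affine:
  fixes f :: "real ^ 'n \<Rightarrow> real"
  assumes "f \<in> test_functions" "a \<noteq> 0"
  shows "(\<lambda>x. f (b + a *\<^sub>R x)) \<in> test_functions"
proof -
  have "{x. f (b + a *\<^sub>R x) \<noteq> 0} \<subseteq> (\<lambda>y. (1 / a) *\<^sub>R y) ` (\<lambda>y. - b + y) ` {y. f y \<noteq> 0}"
    using assms(2) by (force simp: image_iff)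
  moreover have "bounded ((\<lambda>y. (1 / a) *\<^sub>R y) ` (\<lambda>y. - b + y) ` {y. f y \<noteq> 0})"
    using assms(1) by (intro bounded_scaling bounded_translation) (simp add: test_functions_iff)
  ultimately show ?thesis
    using assms(1) by (auto simp: test_functions_iff intro!: smooth_affine elim: bounded_subset)
qed

lemma test_support:
  assumes "f \<in> test_functions"
  obtains R where "R > 0" "\<And>x. norm x \<ge> R \<Longrightarrow> f x = 0"
proof -
  obtain b where b: "\<forall>x. f x \<noteq> 0 \<longrightarrow> norm x \<le> b"
    using assms by (auto simp: test_functions_iff bounded_iff)
  have "f x = 0" if "norm x \<ge> \<bar>b\<bar> + 1" for x
    using b[rule_format, of x] that by force
  then show ?thesis using that[of "\<bar>b\<bar> + 1"] by auto
qed

lemma test_bounded: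
  fixes f :: "real ^ 'n \<Rightarrow> real"
  assumes "f \<in> test_functions"
  obtains B where "B > 0" "\<And>x. \<bar>f x\<bar> \<le> B"
proof -
  obtain R where R: "R > 0" "\<And>x. norm x \<ge> R \<Longrightarrow> f x = 0" by (meson test_support[OF assms])
  have "compact (f ` cball 0 R)"
    using smooth_continuous[OF test_smooth[OF assms]]
    by (intro compact_continuous_image) (auto elim: continuous_on_subset)
  then obtain B where B: "B > 0" "\<forall>y \<in> f ` cball 0 R. norm y \<le> B"
    using compact_imp_bounded bounded_pos by blast
  have "\<bar>f x\<bar> \<le> B" for x
    using B R(2)[of x] by (cases "norm x \<le> R") auto
  with B that show ?thesis by blast
qed

lemma smooth_measurable_borel: "smooth f \<Longrightarrow> f \<in> borel_measurable borel"
  by (intro borel_measurable_continuous_onI smooth_continuous)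

lemma smooth_measurable: "smooth f \<Longrightarrow> f \<in> borel_measurable lebesgue"
  by (rule measurable_completion) (simp add: smooth_measurable_borel)

lemma integrable_mult_bounded:
  fixes f g :: "real ^ 'n \<Rightarrow> real"
  assumes "integrable lebesgue f" "g \<in> borel_measurable lebesgue" "\<And>x. \<bar>g x\<bar> \<le> B"
  shows "integrable lebesgue (\<lambda>x. f x * g x)"
proof (rule Bochner_Integration.integrable_bound)
  show "integrable lebesgue (\<lambda>x. B * f x)" using assms by simp
  show "AE x in lebesgue. norm (f x * g x) \<le> norm (B * f x)"
  proof (rule AE_I2)
    fix x
    have "\<bar>g x\<bar> \<le> \<bar>B\<bar>" using assms(3)[of x] by linarith
    then show "norm (f x * g x) \<le> norm (B * f x)"
      by (simp add: abs_mult mult.commute[of "\<bar>f x\<bar>"] mult_right_mono)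
  qed
qed (use assms in measurable)

lemma integrable_mult_test:
  assumes "locally_integrable u" "\<psi> \<in> test_functions"
  shows "integrable lebesgue (\<lambda>x. u x * \<psi> x)"
proof -
  obtain R where R: "R > 0" "\<And>x. norm x \<ge> R \<Longrightarrow> \<psi> x = 0" by (meson test_support[OF assms(2)])
  obtain B where B: "B > 0" "\<And>x. \<bar>\<psi> x\<bar> \<le> B" by (meson test_bounded[OF assms(2)])
  have "integrable lebesgue (\<lambda>x. (indicat_real (cball 0 R) x * u x) * \<psi> x)"
    by (rule integrable_mult_bounded[where B = B])
      (use assms B in \<open>auto simp: locally_integrable_def set_integrable_def smooth_measurable test_smooth\<close>)
  also have "(\<lambda>x. (indicat_real (cball 0 R) x * u x) * \<psi> x) = (\<lambda>x. u x * \<psi> x)"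
    using R(2) by (fastforce simp: indicator_def fun_eq_iff)
  finally show ?thesis .
qed

lemma locally_integrable_mult_continuous:
  fixes u g :: "real ^ 'n \<Rightarrow> real"
  assumes "locally_integrable u" "continuous_on UNIV g"
  shows "locally_integrable (\<lambda>x. u x * g x)"
  unfolding locally_integrable_def
proof safe
  fix K :: "(real ^ 'n) set" assume K: "compact K"
  have "compact (g ` K)"
    using assms(2) K by (intro compact_continuous_image) (auto elim: continuous_on_subset)
  then obtain B where B: "B > 0" "\<forall>y \<in> g ` K. norm y \<le> B"
    using compact_imp_bounded bounded_pos by blast
  have m: "g \<in> borel_measurable lebesgue" "indicat_real K \<in> borel_measurable lebesgue"
    using borel_measurable_continuous_onI[OF assms(2)] lmeasurable_compact[OF K]
    by (auto intro!: measurable_completion borel_measurable_indicator)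
  have "integrable lebesgue (\<lambda>x. (indicat_real K x * u x) * (indicat_real K x * g x))"
  proof (rule integrable_mult_bounded[where B = B])
    show "integrable lebesgue (\<lambda>x. indicat_real K x * u x)"
      using assms(1) K by (simp add: locally_integrable_def set_integrable_def)
    show "\<bar>indicat_real K x * g x\<bar> \<le> B" for x
      using B by (auto simp: indicator_def)
  qed (use m in measurable)
  also have "(\<lambda>x. (indicat_real K x * u x) * (indicat_real K x * g x)) = (\<lambda>x. indicat_real K x *\<^sub>R (u x * g x))"
    by (auto simp: indicator_def)
  finally show "set_integrable lebesgue K (\<lambda>x. u x * g x)"
    unfolding set_integrable_def .
qed

lemma continuous_locally_integrable:
  fixes u :: "real ^ 'n \<Rightarrow> real"
  assumes "continuous_on UNIV u"
  shows "locally_integrable u"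
proof -
  have "set_integrable lebesgue K (\<lambda>_. 1::real)" if "compact K" for K :: "(real ^ 'n) set"
    using fmeasurableD[OF lmeasurable_compact[OF that]] fmeasurableD2[OF lmeasurable_compact[OF that]]
    unfolding set_integrable_def by (simp add: integrable_indicator_iff top.not_eq_extremum)
  then have "locally_integrable (\<lambda>_ :: real ^ 'n. 1)" by (simp add: locally_integrable_def)
  from locally_integrable_mult_continuous[OF this assms] show ?thesis by simp
qed

lemma test_integrable: "f \<in> test_functions \<Longrightarrow> integrable lebesgue f"
  using integrable_mult_test[of "\<lambda>_. 1" f] continuous_locally_integrable[of "\<lambda>_. 1"] by simp

section \<open>Convolution of an integrable function with a test function\<close>

lemma lborel_distr_reflect: "distr lborel borel (\<lambda>y. x - y) = (lborel :: (real ^ 'n) measure)"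
  using lborel_affine[of "-1" x] by (simp add: density_1)

lemma lborel_integral_reflect:
  fixes f :: "real ^ 'n \<Rightarrow> real"
  assumes "f \<in> borel_measurable borel"
  shows "(LINT y|lborel. f (x - y)) = (LINT y|lborel. f y)"
  using integral_distr[of "\<lambda>y. x - y" lborel borel f] assms by (simp add: lborel_distr_reflect)

lemma lebesgue_integral_lborel:
  fixes f :: "real ^ 'n \<Rightarrow> real"
  assumes "f \<in> borel_measurable borel"
  shows "(LINT y|lebesgue. f y) = (LINT y|lborel. f y)"
  using integral_completion[of f lborel] assms by simp

text \<open>The variable \<open>x\<close> sits in the kernel only, so every derivative falls on
  \<open>\<rho>\<close> and no regularity of \<open>f\<close> is involved.\<close>

definition conv :: "(real ^ 'n \<Rightarrow> real) \<Rightarrow> (real ^ 'n \<Rightarrow> real) \<Rightarrow> real ^ 'n \<Rightarrow> real" where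
  "conv f \<rho> x = (LINT y|lebesgue. f y * \<rho> (x - y))"

lemma test_reflect: "\<rho> \<in> test_functions \<Longrightarrow> (\<lambda>y. \<rho> (x - y)) \<in> test_functions"
  using test_affine[of \<rho> "-1" x] by simp

lemma conv_integrable:
  assumes "integrable lebesgue f" "\<rho> \<in> test_functions"
  shows "integrable lebesgue (\<lambda>y. f y * \<rho> (x - y))"
  using test_bounded[OF test_reflect[OF assms(2)]] 
   integrable_mult_bounded[OF assms(1) smooth_measurable[OF test_smooth[OF test_reflect[OF assms(2)]]]]
  by metis

text \<open>A single \<open>L\<close> bounds both the increments and the linear part; their sum
  \<open>2 * L\<close> is the constant of the dominating function in
  \<open>conv_has_derivative\<close>.\<close>

lemma test_Lipschitz:
  fixes \<rho> :: "real ^ 'n \<Rightarrow> real"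
  assumes "\<rho> \<in> test_functions"
  obtains L where "L > 0" "\<And>x y. \<bar>\<rho> x - \<rho> y\<bar> \<le> L * norm (x - y)"
    "\<And>x h. \<bar>\<Sum>i\<in>UNIV. h $ i * partial i \<rho> x\<bar> \<le> L * norm h"
proof -
  have "\<exists>B>0. \<forall>x. \<bar>partial i \<rho> x\<bar> \<le> B" for i
    using test_bounded[OF test_partial[OF assms]] by metis
  then obtain B where B: "\<And>i. B i > 0" "\<And>i x. \<bar>partial i \<rho> x\<bar> \<le> B i" by metis
  define L where "L = (\<Sum>i\<in>UNIV. B i)"
  have L: "L > 0" unfolding L_def using B(1) by (intro sum_pos) auto
  have b: "\<bar>\<Sum>i\<in>UNIV. h $ i * partial i \<rho> x\<bar> \<le> L * norm h" for x h
  proof -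
    have "\<bar>\<Sum>i\<in>UNIV. h $ i * partial i \<rho> x\<bar> \<le> (\<Sum>i\<in>UNIV. \<bar>h $ i * partial i \<rho> x\<bar>)" by (rule sum_abs)
    also have "\<dots> \<le> (\<Sum>i\<in>UNIV. norm h * B i)"
      using component_le_norm_cart[of h] B(2)
      by (intro sum_mono) (auto simp: abs_mult intro!: mult_mono)
    finally show ?thesis by (simp add: L_def sum_distrib_left mult.commute)
  qed
  have "norm (\<rho> x - \<rho> y) \<le> L * norm (x - y)" for x y
  proof (rule differentiable_bound[of UNIV \<rho> "\<lambda>x h. \<Sum>i\<in>UNIV. h $ i * partial i \<rho> x"])
    fix x
    show "(\<rho> has_derivative (\<lambda>h. \<Sum>i\<in>UNIV. h $ i * partial i \<rho> x)) (at x within UNIV)"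
      using smooth_differentiable[OF test_smooth[OF assms]]
      by (auto intro: has_derivative_sum_partial simp: differentiable_on_def)
    show "onorm (\<lambda>h. \<Sum>i\<in>UNIV. h $ i * partial i \<rho> x) \<le> L"
      using b L by (intro onorm_bound) auto
  qed auto
  with L b show ?thesis by (intro that[of L]) auto
qed

text \<open>Differentiation under the integral sign. \<open>E y z\<close> is the first-order
  remainder of \<open>\<rho>\<close> at \<open>x - z\<close>; divided by \<open>norm (y - x)\<close>
  it tends to 0 pointwise and stays below \<open>2 * L\<close>, so dominated convergence with the
  majorant \<open>2 * L * \<bar>f\<bar>\<close> applies.\<close>

lemma conv_has_derivative:
  fixes \<rho> :: "real ^ 'n \<Rightarrow> real"
  assumes f: "integrable lebesgue f" and \<rho>: "\<rho> \<in> test_functions"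
  shows "(conv f \<rho> has_derivative (\<lambda>h. \<Sum>i\<in>UNIV. h $ i * conv f (partial i \<rho>) x)) (at x)"
proof -
  obtain L where L: "L > 0" "\<And>x y. \<bar>\<rho> x - \<rho> y\<bar> \<le> L * norm (x - y)"
    "\<And>x h. \<bar>\<Sum>i\<in>UNIV. h $ i * partial i \<rho> x\<bar> \<le> L * norm h" by (rule test_Lipschitz[OF \<rho>]) blast
  define E where "E y z = \<rho> (y - z) - \<rho> (x - z) - (\<Sum>i\<in>UNIV. (y - x) $ i * partial i \<rho> (x - z))" for y z
  have I: "integrable lebesgue (\<lambda>z. f z * \<rho> (y - z))" "integrable lebesgue (\<lambda>z. f z * partial i \<rho> (y - z))" for y i
    using f \<rho> by (auto intro: conv_integrable test_partial)
  have fE: "f z * E y z = f z * \<rho> (y - z) - f z * \<rho> (x - z) - (\<Sum>i\<in>UNIV. (y - x) $ i * (f z * partial i \<rho> (x - z)))" for y z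
    by (simp add: E_def algebra_simps sum_distrib_left)
  have IE: "integrable lebesgue (\<lambda>z. f z * E y z)" for y
    unfolding fE using I by auto
  have eq: "conv f \<rho> y - conv f \<rho> x - (\<Sum>i\<in>UNIV. (y - x) $ i * conv f (partial i \<rho>) x) = (LINT z|lebesgue. f z * E y z)" for y
    unfolding fE conv_def using I by simp
  have Eb: "\<bar>E y z\<bar> \<le> 2 * L * norm (y - x)" for y z
    using L(2)[of "y - z" "x - z"] L(3)[of "y - x" "x - z"] unfolding E_def by auto
  have E0: "((\<lambda>y. E y z / norm (y - x)) \<longlongrightarrow> 0) (at x)" for z
  proof -
    have r: "(\<rho> has_derivative (\<lambda>h. \<Sum>i\<in>UNIV. h $ i * partial i \<rho> (x - z))) (at (x - z))"
      using smooth_differentiable[OF test_smooth[OF \<rho>]]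
      by (auto intro: has_derivative_sum_partial simp: differentiable_on_def)
    have "((\<lambda>y. y - z) has_derivative (\<lambda>h. h)) (at x)" by (auto intro!: derivative_eq_intros)
    then have "((\<lambda>y. \<rho> (y - z)) has_derivative (\<lambda>h. \<Sum>i\<in>UNIV. h $ i * partial i \<rho> (x - z))) (at x)"
      by (rule has_derivative_compose) (rule r)
    then have "((\<lambda>y. norm (E y z) / norm (y - x)) \<longlongrightarrow> 0) (at x)"
      unfolding has_derivative_iff_norm E_def by auto
    then show ?thesis
      by (subst tendsto_norm_zero_iff[symmetric]) simp
  qed
  show ?thesis unfolding has_derivative_iff_norm
  proof (intro conjI)
    show "bounded_linear (\<lambda>h. \<Sum>i\<in>UNIV. h $ i * conv f (partial i \<rho>) x)"
      by (intro bounded_linear_sum bounded_linear_mult_const bounded_linear_vec_nth)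
    show "((\<lambda>y. norm (conv f \<rho> y - conv f \<rho> x - (\<Sum>i\<in>UNIV. (y - x) $ i * conv f (partial i \<rho>) x)) / norm (y - x)) \<longlongrightarrow> 0) (at x)"
      \<comment> \<open>Dominated convergence is a statement about sequences, so the limit at
        \<open>x\<close> is tested along arbitrary sequences avoiding \<open>x\<close>.\<close>
      unfolding eq tendsto_at_iff_sequentially o_def
    proof safe
      fix s :: "nat \<Rightarrow> real ^ 'n" assume s: "\<forall>i. s i \<in> UNIV - {x}" "s \<longlonglongrightarrow> x"
      have sx: "norm (s n - x) > 0" for n using s(1) by auto
      have "(\<lambda>n. LINT z|lebesgue. f z * (E (s n) z / norm (s n - x))) \<longlonglongrightarrow> (LINT z::real^'n|lebesgue. 0)"
      proof (rule integral_dominated_convergence)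
        show "integrable lebesgue (\<lambda>z. 2 * L * \<bar>f z\<bar>)" using f by auto
        show "AE z in lebesgue. (\<lambda>n. f z * (E (s n) z / norm (s n - x))) \<longlonglongrightarrow> 0"
        proof (rule AE_I2)
          fix z
          have "(\<lambda>n. E (s n) z / norm (s n - x)) \<longlonglongrightarrow> 0"
            using E0[of z, unfolded tendsto_at_iff_sequentially o_def] s by blast
          from tendsto_mult[OF tendsto_const this, of "f z"]
          show "(\<lambda>n. f z * (E (s n) z / norm (s n - x))) \<longlonglongrightarrow> 0" by simp
        qed
        show "AE z in lebesgue. norm (f z * (E (s n) z / norm (s n - x))) \<le> 2 * L * \<bar>f z\<bar>" for n
        proof (rule AE_I2)
          fix z
          have "\<bar>E (s n) z\<bar> / norm (s n - x) \<le> 2 * L"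
            using Eb[of "s n" z] sx[of n] by (simp add: divide_le_eq)
          from mult_left_mono[OF this, of "\<bar>f z\<bar>"]
          show "norm (f z * (E (s n) z / norm (s n - x))) \<le> 2 * L * \<bar>f z\<bar>"
            by (simp add: abs_mult mult.commute)
        qed
        show "(\<lambda>z. f z * (E (s n) z / norm (s n - x))) \<in> borel_measurable lebesgue" for n
          using borel_measurable_integrable[OF IE[of "s n"]] borel_measurable_divide[of "\<lambda>z. f z * E (s n) z" lebesgue "\<lambda>_. norm (s n - x)"]
          by simp
      qed simp
      then have "(\<lambda>n. (LINT z|lebesgue. f z * E (s n) z) / norm (s n - x)) \<longlonglongrightarrow> 0" by simp
      from tendsto_norm[OF this]
      show "(\<lambda>n. norm (LINT z|lebesgue. f z * E (s n) z) / norm (s n - x)) \<longlonglongrightarrow> 0" by simp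
    qed
  qed
qed

lemma partial_conv:
  assumes "integrable lebesgue f" "\<rho> \<in> test_functions"
  shows "partial i (conv f \<rho>) = conv f (partial i \<rho>)"
proof
  fix x
  show "partial i (conv f \<rho>) x = conv f (partial i \<rho>) x"
    by (subst has_derivative_partial[OF conv_has_derivative[OF assms]])
       (simp add: axis_def if_distrib[of "\<lambda>c. c * _"] cong: if_cong)
qed

lemma smooth_conv:
  assumes "integrable lebesgue f" "\<rho> \<in> test_functions"
  shows "smooth (conv f \<rho>)"
proof (rule smooth_coinduct[where P = "\<lambda>F. \<exists>\<rho>\<in>test_functions. F = conv f \<rho>"])
  show "\<exists>\<rho>'\<in>test_functions. conv f \<rho> = conv f \<rho>'" using assms by blast
  fix F assume "\<exists>\<rho>\<in>test_functions. F = conv f \<rho>"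
  then obtain \<rho> where r: "\<rho> \<in> test_functions" "F = conv f \<rho>" by blast
  show "F differentiable_on UNIV"
    using conv_has_derivative[OF assms(1) r(1)] unfolding r(2) differentiable_on_def differentiable_def by auto
  show "\<exists>\<rho>\<in>test_functions. partial i F = conv f \<rho>" for i
    using partial_conv[OF assms(1) r(1)] test_partial[OF r(1)] unfolding r(2) by blast
qed

lemma iter_partial_conv:
  assumes "integrable lebesgue f" "\<rho> \<in> test_functions"
  shows "iter_partial is (conv f \<rho>) = conv f (iter_partial is \<rho>)"
  by (induction "is") (auto simp: partial_conv assms test_iter_partial)

lemma test_conv:
  fixes f :: "real ^ 'n \<Rightarrow> real"
  assumes "integrable lebesgue f" "\<And>x. norm x \<ge> R \<Longrightarrow> f x = 0" "\<rho> \<in> test_functions"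
  shows "conv f \<rho> \<in> test_functions"
proof -
  obtain S where S: "S > 0" "\<And>x. norm x \<ge> S \<Longrightarrow> \<rho> x = 0" by (meson test_support[OF assms(3)])
  have "conv f \<rho> x = 0" if "norm x > R + S" for x
  proof -
    have "f y * \<rho> (x - y) = 0" for y
    proof (cases "norm y \<ge> R")
      case False
      then have "norm (x - y) \<ge> S" using that norm_triangle_ineq2[of x y] by linarith
      then show ?thesis by (simp add: S)
    qed (simp add: assms)
    then have "(\<lambda>y. f y * \<rho> (x - y)) = (\<lambda>_. 0)" by blast
    then show ?thesis by (simp add: conv_def)
  qed
  then have "{x. conv f \<rho> x \<noteq> 0} \<subseteq> cball 0 (R + S)" by (force simp: not_less[symmetric])
  then show ?thesis using smooth_conv[OF assms(1,3)]
    by (auto simp: test_functions_iff intro: bounded_subset[OF bounded_cball])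
qed

text \<open>Convolving with the indicator of a large ball gives a function that is constant near the origin.\<close>

lemma integral_partial_eq_0:
  fixes F :: "real ^ 'n \<Rightarrow> real"
  assumes F: "F \<in> test_functions"
  shows "(LINT x|lebesgue. partial i F x) = 0"
proof -
  obtain R where R: "R > 0" "\<And>x. norm x \<ge> R \<Longrightarrow> F x = 0" by (meson test_support[OF F])
  obtain R' where R': "R' > 0" "\<And>x. norm x \<ge> R' \<Longrightarrow> partial i F x = 0" by (meson test_support[OF test_partial[OF F]])
  \<comment> \<open>For \<open>norm x < 1\<close> a ball of radius \<open>R + R' + 1\<close>
    contains every \<open>y\<close> with \<open>x - y\<close> in the support of \<open>F\<close> or
    of its derivative. Multiplication by the indicator then changes neither integrand, and both
    convolutions reduce to plain integrals.\<close>
  define f where "f = indicat_real (cball (0::real^'n) (R + R' + 1))"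
  have f: "integrable lebesgue f"
    unfolding f_def by (intro integrable_real_indicator) (use emeasure_bounded_finite[of "cball (0::real^'n) (R + R' + 1)"] in auto)
  have eq: "(LINT y|lebesgue. f y * G (x - y)) = (LINT y|lebesgue. G y)"
    if "norm x < 1" "\<And>x. norm x \<ge> R + R' \<Longrightarrow> G x = 0" "smooth G" for G :: "real ^ 'n \<Rightarrow> real" and x
  proof -
    have "f y * G (x - y) = G (x - y)" for y
    proof (cases "norm y \<le> R + R' + 1")
      case False
      then have "norm (x - y) \<ge> R + R'" using that(1) norm_triangle_ineq2[of y x]
        by (simp add: norm_minus_commute)
      then show ?thesis using that by simp
    qed (simp add: f_def)
    then have e: "(\<lambda>y. f y * G (x - y)) = (\<lambda>y. G (x - y))" by blast
    have G: "G \<in> borel_measurable borel" using that(3) by (rule smooth_measurable_borel)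
    have G': "(\<lambda>y. G (x - y)) \<in> borel_measurable borel"
      using smooth_affine[OF that(3), of x "-1"] by (intro smooth_measurable_borel) simp
    show ?thesis
      unfolding e lebesgue_integral_lborel[OF G] lebesgue_integral_lborel[OF G']
      by (rule lborel_integral_reflect[OF G])
  qed
  have "conv f F x = (LINT y|lebesgue. F y)" if "norm x < 1" for x
    unfolding conv_def using that R R' F by (intro eq) (auto simp: test_smooth)
  then have "partial i (conv f F) 0 = 0"
    by (intro partial_locally_constant[of "ball 0 1"]) (auto simp: dist_norm)
  moreover have "conv f (partial i F) 0 = (LINT y|lebesgue. partial i F y)"
    unfolding conv_def using R R' F by (intro eq) (auto simp: test_smooth test_partial)
  ultimately show ?thesis by (simp add: partial_conv[OF f F])
qed

section \<open>Integration by parts\<close>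

lemma integral_by_parts:
  fixes u \<psi> :: "real ^ 'n \<Rightarrow> real"
  assumes "smooth u" "\<psi> \<in> test_functions"
  shows "(LINT x|lebesgue. u x * partial i \<psi> x) = - (LINT x|lebesgue. partial i u x * \<psi> x)"
proof -
  have "(LINT x|lebesgue. partial i (\<lambda>x. u x * \<psi> x) x) = 0"
    using assms by (intro integral_partial_eq_0 test_mult')
  moreover have "integrable lebesgue (\<lambda>x. u x * partial i \<psi> x)" "integrable lebesgue (\<lambda>x. partial i u x * \<psi> x)"
    using assms by (auto intro!: test_integrable test_mult' test_partial smooth_partial)
  ultimately show ?thesis
    using assms by (simp add: partial_mult smooth_differentiable test_smooth)
qed

text \<open>The outermost derivative of \<open>\<psi>\<close> is moved to \<open>u\<close>, and the
  induction hypothesis is applied to the new \<open>u\<close>. Commutation then brings this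
  derivative back to the front.\<close>

lemma integral_iter_by_parts:
  fixes u \<psi> :: "real ^ 'n \<Rightarrow> real"
  assumes "smooth u" "\<psi> \<in> test_functions"
  shows "(LINT x|lebesgue. u x * iter_partial is \<psi> x) = (-1) ^ length is * (LINT x|lebesgue. iter_partial is u x * \<psi> x)"
  using assms(1)
proof (induction "is" arbitrary: u)
  case (Cons i "is")
  then show ?case
    by (simp add: integral_by_parts test_iter_partial assms(2) smooth_partial iter_partial_commute)
qed simp

section \<open>Mollifiers\<close>

text \<open>The classical flat function multiplied by negative powers. The parameter
  \<open>n\<close> makes the family closed under differentiation, since the derivative combines the
  members \<open>n + 1\<close> and \<open>n + 2\<close>. Smoothness is then one induction for all
  \<open>n\<close>.\<close>

definition flat_exp :: "nat \<Rightarrow> real \<Rightarrow> real" where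
  "flat_exp n t = (if t > 0 then (1 / t) ^ n * exp (- (1 / t)) else 0)"

lemma flat_exp_nonneg: "flat_exp n t \<ge> 0"
  by (simp add: flat_exp_def)

lemma flat_exp_tendsto_0: "(flat_exp n \<longlongrightarrow> 0) (at 0)"
proof -
  have "filterlim (\<lambda>t::real. 1 / t) at_top (at_right 0)"
    using filterlim_inverse_at_top_right by (simp add: inverse_eq_divide)
  from filterlim_compose[OF tendsto_power_div_exp_0 this]
  have "((\<lambda>t::real. (1 / t) ^ n / exp (1 / t)) \<longlongrightarrow> 0) (at_right 0)" .
  then have "(flat_exp n \<longlongrightarrow> 0) (at_right 0)"
    by (rule Lim_transform_eventually)
       (auto simp: eventually_at_filter flat_exp_def exp_minus field_simps)
  moreover have "(flat_exp n \<longlongrightarrow> 0) (at_left 0)"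
    by (rule Lim_transform_eventually[OF tendsto_const])
       (auto simp: eventually_at_filter flat_exp_def)
  ultimately show ?thesis
    by (simp add: filterlim_at_split)
qed

lemma flat_exp_has_derivative:
  "(flat_exp n has_real_derivative flat_exp (n + 2) t - real n * flat_exp (n + 1) t) (at t)"
proof -
  consider "t > 0" | "t < 0" | "t = 0" by linarith
  then show ?thesis
  proof cases
    case 1
    have "((\<lambda>t. (1 / t) ^ n * exp (- (1 / t))) has_real_derivative
        real n * (1 / t) ^ (n - 1) * (- (1 / t\<^sup>2)) * exp (- (1 / t)) + (1 / t) ^ n * (exp (- (1 / t)) * (1 / t\<^sup>2))) (at t)"
      using 1 by (auto intro!: derivative_eq_intros simp: power2_eq_square)
    moreover have "real n * (1 / t) ^ (n - 1) * (- (1 / t\<^sup>2)) * exp (- (1 / t)) + (1 / t) ^ n * (exp (- (1 / t)) * (1 / t\<^sup>2))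
       = flat_exp (n + 2) t - real n * flat_exp (n + 1) t"
      using 1 by (cases n) (auto simp: flat_exp_def power2_eq_square field_simps)
    ultimately have "((\<lambda>t. (1 / t) ^ n * exp (- (1 / t))) has_real_derivative flat_exp (n + 2) t - real n * flat_exp (n + 1) t) (at t)"
      by simp
    then show ?thesis
      by (rule has_field_derivative_transform_within_open[where S = "{0<..}"]) (use 1 in \<open>auto simp: flat_exp_def\<close>)
  next
    case 2
    have "((\<lambda>t. 0) has_real_derivative 0) (at t)" by simp
    then have "(flat_exp n has_real_derivative 0) (at t)"
      by (rule has_field_derivative_transform_within_open[where S = "{..<0}"]) (use 2 in \<open>auto simp: flat_exp_def\<close>)
    then show ?thesis using 2 by (simp add: flat_exp_def)
  next
    case 3
    \<comment> \<open>Away from 0 the difference quotient of \<open>flat_exp n\<close> at 0 is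
      exactly \<open>flat_exp (n + 1)\<close>, whose limit is already known to be 0.\<close>
    have "((\<lambda>h. (flat_exp n (0 + h) - flat_exp n 0) / h) \<longlongrightarrow> 0) (at 0)"
      using flat_exp_tendsto_0[of "n + 1"]
      by (rule Lim_transform_eventually) (auto simp: eventually_at_filter flat_exp_def)
    then have "(flat_exp n has_real_derivative 0) (at 0)" unfolding DERIV_def by simp
    then show ?thesis using 3 by (simp add: flat_exp_def)
  qed
qed

lemma flat_exp_axis_has_derivative:
  "((\<lambda>x. flat_exp n (a * x $ i + b)) has_derivative
    (\<lambda>h. (flat_exp (n + 2) (a * x $ i + b) - real n * flat_exp (n + 1) (a * x $ i + b)) * (a * h $ i))) (at x)"
proof -
  have "((\<lambda>x. a * x $ i + b) has_derivative (\<lambda>h. a * h $ i)) (at x)"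
    by (auto intro!: derivative_eq_intros bounded_linear.has_derivative[OF bounded_linear_vec_nth])
  then show ?thesis
    by (rule has_derivative_compose)
       (use flat_exp_has_derivative[of n "a * x $ i + b"] in \<open>simp add: has_field_derivative_def\<close>)
qed

lemma smooth_flat_exp_axis: "smooth (\<lambda>x :: real ^ 'n. flat_exp n (a * x $ i + b))"
proof -
  have d: "(\<lambda>x :: real ^ 'n. flat_exp n (a * x $ i + b)) differentiable_on UNIV" for n
    using flat_exp_axis_has_derivative unfolding differentiable_on_def differentiable_def by blast
  have p: "partial j (\<lambda>x :: real ^ 'n. flat_exp n (a * x $ i + b)) =
     (\<lambda>x. (if j = i then a else 0) * flat_exp (n + 2) (a * x $ i + b) +
          (if j = i then - real n * a else 0) * flat_exp (n + 1) (a * x $ i + b))" for j n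
  proof
    fix x :: "real ^ 'n"
    show "partial j (\<lambda>x. flat_exp n (a * x $ i + b)) x =
     (if j = i then a else 0) * flat_exp (n + 2) (a * x $ i + b) +
          (if j = i then - real n * a else 0) * flat_exp (n + 1) (a * x $ i + b)"
      by (subst has_derivative_partial[OF flat_exp_axis_has_derivative]) (auto simp: axis_def algebra_simps)
  qed
  have "C_times k (\<lambda>x :: real ^ 'n. flat_exp n (a * x $ i + b))" for k n
  proof (induction k arbitrary: n)
    case 0
    then show ?case using d by (simp add: differentiable_imp_continuous_on)
  next
    case (Suc k)
    show ?case unfolding C_times.simps p
      by (intro conjI allI d C_times_add C_times_mult C_times_const Suc)
  qed
  then show ?thesis by (simp add: smooth_def)
qed

text \<open>A product of one-variable functions, so smoothness needs no composition with the
  Euclidean norm. The slope \<open>CARD('n)\<close> confines each coordinate to modulus below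
  \<open>1 / CARD('n)\<close>; the l1 norm, and with it the Euclidean norm, is then below 1.\<close>

definition bump :: "real ^ 'n \<Rightarrow> real" where
  "bump x = (\<Prod>i\<in>UNIV. flat_exp 0 (- real CARD('n) * x $ i + 1) * flat_exp 0 (real CARD('n) * x $ i + 1))"

lemma smooth_bump: "smooth bump"
  unfolding bump_def by (intro smooth_prod smooth_mult smooth_flat_exp_axis) auto

lemma bump_nonneg: "bump x \<ge> 0"
  unfolding bump_def by (intro prod_nonneg) (auto simp: flat_exp_nonneg)

lemma bump_0: "bump (0 :: real ^ 'n) > 0"
  unfolding bump_def by (intro prod_pos) (auto simp: flat_exp_def)

lemma bump_rescale_tendsto:
  fixes x :: "real ^ 'n"
  shows "(\<lambda>k. bump ((1 / real (Suc k)) *\<^sub>R x)) \<longlonglongrightarrow> bump (0 :: real ^ 'n)"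
proof -
  have "isCont bump (0 :: real ^ 'n)"
    using smooth_continuous[OF smooth_bump] by (auto simp: continuous_on_eq_continuous_at)
  moreover have "(\<lambda>k. (1 / real (Suc k)) *\<^sub>R x) \<longlonglongrightarrow> 0 *\<^sub>R x"
    using LIMSEQ_inverse_real_of_nat by (intro tendsto_scaleR tendsto_const) (simp add: inverse_eq_divide)
  ultimately show ?thesis
    using isCont_tendsto_compose[of 0 bump "\<lambda>k. (1 / real (Suc k)) *\<^sub>R x"] by simp
qed

lemma bump_support:
  fixes x :: "real ^ 'n"
  assumes "bump x \<noteq> 0"
  shows "norm x < 1"
proof -
  have "\<bar>x $ i\<bar> < 1 / real CARD('n)" for i
  proof -
    have "flat_exp 0 (- real CARD('n) * x $ i + 1) \<noteq> 0" "flat_exp 0 (real CARD('n) * x $ i + 1) \<noteq> 0"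
      using assms by (auto simp: bump_def)
    then have "- real CARD('n) * x $ i + 1 > 0" "real CARD('n) * x $ i + 1 > 0"
      by (auto simp: flat_exp_def split: if_splits)
    then have "real CARD('n) * \<bar>x $ i\<bar> < 1" by (auto simp: abs_if)
    then show ?thesis by (simp add: field_simps)
  qed
  then have "(\<Sum>i\<in>UNIV. \<bar>x $ i\<bar>) < (\<Sum>i\<in>(UNIV :: 'n set). 1 / real CARD('n))"
    by (intro sum_strict_mono) auto
  then show ?thesis using norm_le_l1_cart[of x] by simp
qed

lemma bump_test: "bump \<in> (test_functions :: (real ^ 'n \<Rightarrow> real) set)"
  unfolding test_functions_iff
proof
  have "{x :: real ^ 'n. bump x \<noteq> 0} \<subseteq> ball 0 1" using bump_support by auto
  then show "bounded {x :: real ^ 'n. bump x \<noteq> 0}" using bounded_ball bounded_subset by blast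
qed (rule smooth_bump)

text \<open>A nonnegative function with zero integral vanishes almost everywhere, but here the set
  of nonzero values is open and contains the origin.\<close>

lemma integral_bump_pos: "(LINT x|lebesgue. bump (x :: real ^ 'n)) > 0"
proof (rule ccontr)
  let ?S = "{x :: real ^ 'n. bump x \<noteq> 0}"
  assume "\<not> ?thesis"
  moreover have "(LINT x|lebesgue. bump (x :: real ^ 'n)) \<ge> 0"
    by (intro integral_nonneg_AE) (simp add: bump_nonneg)
  ultimately have "(LINT x|lebesgue. bump (x :: real ^ 'n)) = 0" by simp
  then have "AE x :: real ^ 'n in lebesgue. bump x = 0"
    by (subst (asm) integral_nonneg_eq_0_iff_AE) (auto simp: bump_nonneg bump_test test_integrable)
  then have "negligible ?S"
    by (auto simp: negligible_iff_null_sets eventually_ae_filter intro: null_sets_completion_subset)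
  moreover have "open ?S"
    using smooth_continuous[OF smooth_bump] by (intro open_Collect_neq continuous_on_const)
  moreover have "0 \<in> ?S" using bump_0[where 'n = 'n] by simp
  ultimately show False using open_not_negligible[of ?S] by blast
qed

definition mollifier :: "real \<Rightarrow> real ^ 'n \<Rightarrow> real" where
  "mollifier e x = bump ((1 / e) *\<^sub>R x) / (e ^ CARD('n) * (LINT x|lebesgue. bump (x :: real ^ 'n)))"

lemma mollifier_nonneg: "e > 0 \<Longrightarrow> mollifier e x \<ge> 0"
  unfolding mollifier_def
  by (intro divide_nonneg_nonneg mult_nonneg_nonneg bump_nonneg less_imp_le[OF integral_bump_pos]) auto

lemma mollifier_support: "e > 0 \<Longrightarrow> mollifier e x \<noteq> 0 \<Longrightarrow> norm x < e"
  using bump_support[of "(1 / e) *\<^sub>R x"] by (auto simp: mollifier_def)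

lemma mollifier_test:
  assumes "e > 0"
  shows "mollifier e \<in> (test_functions :: (real ^ 'n \<Rightarrow> real) set)"
proof -
  have "(\<lambda>x :: real ^ 'n. bump (0 + (1 / e) *\<^sub>R x) * (1 / (e ^ CARD('n) * (LINT x|lebesgue. bump (x :: real ^ 'n))))) \<in> test_functions"
    using assms by (intro test_mult test_affine bump_test smooth_const) auto
  then show ?thesis by (simp add: mollifier_def[abs_def])
qed

text \<open>The constant is uniform in \<open>e\<close>. This power of \<open>e\<close> is the
  origin of the exponent N in \<open>cond_M2\<close>.\<close>

lemma mollifier_bound:
  "\<exists>K>0. \<forall>e>0. \<forall>x. mollifier e (x :: real ^ 'n) \<le> K / e ^ CARD('n)"
proof -
  obtain B where B: "B > 0" "\<And>x :: real ^ 'n. \<bar>bump x\<bar> \<le> B" by (meson test_bounded[OF bump_test])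
  let ?I = "LINT x|lebesgue. bump (x :: real ^ 'n)"
  have "mollifier e (x :: real ^ 'n) \<le> (B / ?I) / e ^ CARD('n)" if "e > 0" for e x
  proof -
    have "bump ((1 / e) *\<^sub>R x) / (e ^ CARD('n) * ?I) \<le> B / (e ^ CARD('n) * ?I)"
      using that integral_bump_pos[where 'n = 'n] B(2)[of "(1 / e) *\<^sub>R x"] by (intro divide_right_mono) auto
    then show ?thesis by (simp add: mollifier_def mult.commute)
  qed
  then show ?thesis using B(1) integral_bump_pos[where 'n = 'n] by (intro exI[of _ "B / ?I"]) auto
qed

lemma integral_mollifier:
  assumes "e > 0"
  shows "(LINT x|lebesgue. mollifier e (x :: real ^ 'n)) = 1"
proof -
  have b: "bump \<in> borel_measurable (borel :: (real ^ 'n) measure)"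
    by (rule smooth_measurable_borel[OF smooth_bump])
  have mb: "mollifier e \<in> borel_measurable (borel :: (real ^ 'n) measure)"
    by (rule smooth_measurable_borel[OF test_smooth[OF mollifier_test[OF assms]]])
  have "(LINT x|lborel. bump (x :: real ^ 'n)) = (LINT x|density (distr lborel borel (\<lambda>x. 0 + (1 / e) *\<^sub>R x)) (\<lambda>_. \<bar>1 / e\<bar> ^ DIM(real ^ 'n)). bump (x :: real ^ 'n))"
    using lborel_affine[of "1 / e" "0 :: real ^ 'n"] assms by simp
  also have "\<dots> = (1 / e) ^ CARD('n) * (LINT x|lborel. bump ((1 / e) *\<^sub>R x :: real ^ 'n))"
    using assms b by (subst integral_density) (auto simp: integral_distr)
  finally have "(LINT x|lborel. bump ((1 / e) *\<^sub>R x :: real ^ 'n)) = e ^ CARD('n) * (LINT x|lborel. bump (x :: real ^ 'n))"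
    using assms by (simp add: field_simps)
  moreover have "(LINT x|lborel. bump (x :: real ^ 'n)) > 0"
    using integral_bump_pos[where 'n = 'n] unfolding lebesgue_integral_lborel[OF b] .
  ultimately show ?thesis
    using assms unfolding lebesgue_integral_lborel[OF mb] by (simp add: mollifier_def[abs_def] lebesgue_integral_lborel[OF b])
qed

lemma integral_mollifier_reflect:
  assumes "e > 0"
  shows "(LINT y|lebesgue. mollifier e (x - y :: real ^ 'n)) = 1"
proof -
  have mb: "mollifier e \<in> borel_measurable (borel :: (real ^ 'n) measure)"
    by (rule smooth_measurable_borel[OF test_smooth[OF mollifier_test[OF assms]]])
  have "(\<lambda>y. mollifier e (x - y :: real ^ 'n)) \<in> borel_measurable borel"
    by (rule smooth_measurable_borel[OF test_smooth[OF test_reflect[OF mollifier_test[OF assms]]]])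
  from lebesgue_integral_lborel[OF this] show ?thesis
    using integral_mollifier[OF assms, where 'n = 'n] lborel_integral_reflect[OF mb, of x]
    unfolding lebesgue_integral_lborel[OF mb] by simp
qed

section \<open>Mollification in mean and distributional derivatives\<close>

lemma lborel_integrable_translate:
  fixes f :: "real ^ 'n \<Rightarrow> real"
  assumes "integrable lborel f"
  shows "integrable lborel (\<lambda>x. f (x - h))"
  using assms integrable_distr_eq[of "(+) (- h)" lborel borel f]
  by (simp add: lborel_distr_plus)

lemma lborel_integral_translate:
  fixes f :: "real ^ 'n \<Rightarrow> real"
  assumes "f \<in> borel_measurable borel"
  shows "(LINT x|lborel. f (x - h)) = (LINT x|lborel. f x)"
  using assms integral_distr[of "(+) (- h)" lborel borel f]
  by (simp add: lborel_distr_plus)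

context
  fixes h :: "nat \<Rightarrow> real ^ 'n"
  assumes h: "h \<longlonglongrightarrow> 0"
begin

text \<open>Three-epsilon argument: by translation invariance the shifted approximation error equals
  the unshifted one, so the property passes to limits in the mean.\<close>

lemma translation_continuous_approx:
  fixes f :: "real ^ 'n \<Rightarrow> real"
  assumes f: "integrable lborel f"
    and approx: "\<And>e. e > 0 \<Longrightarrow> \<exists>g. integrable lborel g \<and>
      (\<lambda>n. LINT x|lborel. \<bar>g (x - h n) - g x\<bar>) \<longlonglongrightarrow> 0 \<and> (LINT x|lborel. \<bar>g x - f x\<bar>) < e"
  shows "(\<lambda>n. LINT x|lborel. \<bar>f (x - h n) - f x\<bar>) \<longlonglongrightarrow> 0"
proof (rule LIMSEQ_I)
  fix e :: real assume e: "e > 0"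
  then obtain g where g: "integrable lborel g" "(\<lambda>n. LINT x|lborel. \<bar>g (x - h n) - g x\<bar>) \<longlonglongrightarrow> 0"
    "(LINT x|lborel. \<bar>g x - f x\<bar>) < e / 3" using approx[of "e / 3"] by auto
  have gt: "integrable lborel (\<lambda>x. g (x - a))" for a by (rule lborel_integrable_translate[OF g(1)])
  have ft: "integrable lborel (\<lambda>x. f (x - a))" for a by (rule lborel_integrable_translate[OF f])
  obtain N where N: "\<And>n. n \<ge> N \<Longrightarrow> \<bar>LINT x|lborel. \<bar>g (x - h n) - g x\<bar>\<bar> < e / 3"
    using LIMSEQ_D[OF g(2), of "e / 3"] e by auto
  have "\<bar>LINT x|lborel. \<bar>f (x - h n) - f x\<bar>\<bar> < e" if "n \<ge> N" for n
  proof -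
    have "(LINT x|lborel. \<bar>f (x - h n) - f x\<bar>) \<le>
       (LINT x|lborel. \<bar>g (x - h n) - f (x - h n)\<bar> + \<bar>g (x - h n) - g x\<bar> + \<bar>g x - f x\<bar>)"
      by (intro integral_mono) (use f g ft gt in auto)
    also have "\<dots> = (LINT x|lborel. \<bar>g (x - h n) - f (x - h n)\<bar>) + (LINT x|lborel. \<bar>g (x - h n) - g x\<bar>) + (LINT x|lborel. \<bar>g x - f x\<bar>)"
      using f g ft gt by simp
    also have "(LINT x|lborel. \<bar>g (x - h n) - f (x - h n)\<bar>) = (LINT x|lborel. \<bar>g x - f x\<bar>)"
      using f g by (intro lborel_integral_translate[where f = "\<lambda>x. \<bar>g x - f x\<bar>"]) simp
    finally have "(LINT x|lborel. \<bar>f (x - h n) - f x\<bar>) < e" using g(3) N[OF that] by linarith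
    moreover have "(LINT x|lborel. \<bar>f (x - h n) - f x\<bar>) \<ge> 0" by (intro integral_nonneg_AE) simp
    ultimately show ?thesis by simp
  qed
  then show "\<exists>no. \<forall>n\<ge>no. norm ((LINT x|lborel. \<bar>f (x - h n) - f x\<bar>) - 0) < e" by auto
qed

text \<open>Openness controls only the points lost by a shift: \<open>p n\<close> tends to 0
  pointwise and is dominated by the indicator. Since shifting preserves the measure, gains and
  losses have equal integral, and the full difference is twice the lost part.\<close>

lemma translation_continuous_open:
  fixes U :: "(real ^ 'n) set"
  assumes U: "open U" "emeasure lborel U < \<infinity>"
  shows "(\<lambda>n. LINT x|lborel. \<bar>indicat_real U (x - h n) - indicat_real U x\<bar>) \<longlonglongrightarrow> 0"
proof -
  let ?u = "indicat_real U"
  define p where "p n x = max 0 (?u x - ?u (x - h n))" for n x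
  have iu: "integrable lborel ?u" using U by simp
  have it: "integrable lborel (\<lambda>x. ?u (x - a))" for a by (rule lborel_integrable_translate[OF iu])
  have ip: "integrable lborel (p n)" for n unfolding p_def using iu it by auto
  have "(\<lambda>n. LINT x|lborel. p n x) \<longlonglongrightarrow> (LINT x::real^'n|lborel. 0)"
  proof (rule integral_dominated_convergence)
    show "AE x in lborel. (\<lambda>n. p n x) \<longlonglongrightarrow> 0"
    proof (rule AE_I2)
      fix x
      show "(\<lambda>n. p n x) \<longlonglongrightarrow> 0"
      proof (cases "x \<in> U")
        case True
        have "(\<lambda>n. x - h n) \<longlonglongrightarrow> x - 0" by (intro tendsto_intros h)
        then have "eventually (\<lambda>n. x - h n \<in> U) sequentially"
          using U(1) True by (auto elim: topological_tendstoD)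
        then have "eventually (\<lambda>n. p n x = 0) sequentially"
          by eventually_elim (auto simp: p_def indicator_def)
        then show ?thesis by (rule tendsto_eventually)
      qed (simp add: p_def indicator_def)
    qed
    show "AE x in lborel. norm (p n x) \<le> ?u x" for n
      by (auto simp: p_def indicator_def)
  qed (use iu ip in auto)
  then have "(\<lambda>n. 2 * (LINT x|lborel. p n x) - ((LINT x|lborel. ?u x) - (LINT x|lborel. ?u x))) \<longlonglongrightarrow> 0"
    using tendsto_mult_right_zero by fastforce
  moreover have "(LINT x|lborel. \<bar>?u (x - h n) - ?u x\<bar>) = 2 * (LINT x|lborel. p n x) - ((LINT x|lborel. ?u x) - (LINT x|lborel. ?u x))" for n
  proof -
    have "(LINT x|lborel. \<bar>?u (x - h n) - ?u x\<bar>) = (LINT x|lborel. 2 * p n x - (?u x - ?u (x - h n)))"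
      by (intro Bochner_Integration.integral_cong) (auto simp: p_def max_def)
    also have "\<dots> = 2 * (LINT x|lborel. p n x) - ((LINT x|lborel. ?u x) - (LINT x|lborel. ?u (x - h n)))"
      using iu it[of "h n"] ip[of n] by simp
    also have "(LINT x|lborel. ?u (x - h n)) = (LINT x|lborel. ?u x)"
      using U by (intro lborel_integral_translate) auto
    finally show ?thesis .
  qed
  ultimately show ?thesis by simp
qed

text \<open>Outer regularity approximates the set from outside by an open set of finite measure, to
  which the previous case applies.\<close>

lemma translation_continuous_borel:
  fixes A :: "(real ^ 'n) set"
  assumes A: "A \<in> sets borel" "emeasure lborel A < \<infinity>"
  shows "(\<lambda>n. LINT x|lborel. \<bar>indicat_real A (x - h n) - indicat_real A x\<bar>) \<longlonglongrightarrow> 0"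
proof (rule translation_continuous_approx)
  show "integrable lborel (indicat_real A)" using A by simp
  fix e :: real assume e: "e > 0"
  then obtain U where U: "open U" "A \<subseteq> U" "emeasure lborel (U - A) < ennreal e"
    using outer_regular_lborel[OF A(1)] by blast
  have fD: "emeasure lborel (U - A) < \<infinity>" using U(3) by (auto intro: order.strict_trans)
  have "emeasure lborel U = emeasure lborel A + emeasure lborel (U - A)"
    using U(1,2) A by (subst plus_emeasure) (auto intro: arg_cong[where f = "emeasure lborel"])
  then have fU: "emeasure lborel U < \<infinity>" using A(2) fD by simp
  have "(LINT x|lborel. \<bar>indicat_real U x - indicat_real A x\<bar>) = (LINT x|lborel. indicat_real (U - A) x)"
    using U(2) by (intro Bochner_Integration.integral_cong) (auto simp: indicator_def)
  also have "\<dots> = measure lborel (U - A)" by simp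
  also have "\<dots> < e" using U(3) e fD
    by (simp add: emeasure_eq_ennreal_measure ennreal_less_iff)
  finally show "\<exists>g. integrable lborel g \<and>
      (\<lambda>n. LINT x|lborel. \<bar>g (x - h n) - g x\<bar>) \<longlonglongrightarrow> 0 \<and> (LINT x|lborel. \<bar>g x - indicat_real A x\<bar>) < e"
    using translation_continuous_open[OF U(1) fU] U(1) fU by (intro exI[of _ "indicat_real U"]) auto
qed

lemma translation_continuous_L1:
  fixes f :: "real ^ 'n \<Rightarrow> real"
  assumes "integrable lborel f"
  shows "(\<lambda>n. LINT x|lborel. \<bar>f (x - h n) - f x\<bar>) \<longlonglongrightarrow> 0"
  using assms
proof (induction rule: integrable_induct)
  case (base A c)
  have "(LINT x|lborel. \<bar>indicat_real A (x - h n) *\<^sub>R c - indicat_real A x *\<^sub>R c\<bar>)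
     = (LINT x|lborel. \<bar>c\<bar> * \<bar>indicat_real A (x - h n) - indicat_real A x\<bar>)" for n
    by (intro Bochner_Integration.integral_cong) (auto simp: abs_mult[symmetric] algebra_simps)
  moreover have "(\<lambda>n. \<bar>c\<bar> * (LINT x|lborel. \<bar>indicat_real A (x - h n) - indicat_real A x\<bar>)) \<longlonglongrightarrow> 0"
    using base by (intro tendsto_mult_right_zero translation_continuous_borel) auto
  ultimately show ?case by simp
next
  case (add f g)
  have t: "integrable lborel (\<lambda>x. f (x - a))" "integrable lborel (\<lambda>x. g (x - a))" for a
    using add by (auto intro: lborel_integrable_translate)
  have "(\<lambda>n. (LINT x|lborel. \<bar>f (x - h n) - f x\<bar>) + (LINT x|lborel. \<bar>g (x - h n) - g x\<bar>)) \<longlonglongrightarrow> 0"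
    using tendsto_add[OF add(3,4)] by simp
  then show ?case
  proof (rule real_tendsto_sandwich[OF _ _ tendsto_const, rotated 2])
    show "\<forall>\<^sub>F n in sequentially. (LINT x|lborel. \<bar>f (x - h n) + g (x - h n) - (f x + g x)\<bar>)
       \<le> (LINT x|lborel. \<bar>f (x - h n) - f x\<bar>) + (LINT x|lborel. \<bar>g (x - h n) - g x\<bar>)"
    proof (rule always_eventually, rule allI)
      fix n
      have "(LINT x|lborel. \<bar>f (x - h n) + g (x - h n) - (f x + g x)\<bar>) \<le>
        (LINT x|lborel. \<bar>f (x - h n) - f x\<bar> + \<bar>g (x - h n) - g x\<bar>)"
        using add t by (intro integral_mono) auto
      then show "(LINT x|lborel. \<bar>f (x - h n) + g (x - h n) - (f x + g x)\<bar>)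
       \<le> (LINT x|lborel. \<bar>f (x - h n) - f x\<bar>) + (LINT x|lborel. \<bar>g (x - h n) - g x\<bar>)"
        using add t by simp
    qed
  qed (auto intro!: always_eventually integral_nonneg_AE)
next
  \<comment> \<open>The approximating functions are dominated by \<open>2 * norm (f x)\<close>, so
    the pointwise limit is also a limit in the mean and some \<open>s i\<close> lies within
    \<open>e\<close> of \<open>f\<close>.\<close>
  case (lim f s)
  show ?case
  proof (rule translation_continuous_approx)
    show "integrable lborel f" by (fact lim)
    fix e :: real assume e: "e > 0"
    have "(\<lambda>i. \<integral>\<^sup>+ x. ennreal (norm (f x - s i x)) \<partial>lborel) \<longlonglongrightarrow> 0"
    proof (rule nn_integral_dominated_convergence_norm[where w = "\<lambda>x. 2 * norm (f x)"])
      show "(\<integral>\<^sup>+ x. ennreal (2 * norm (f x)) \<partial>lborel) < \<infinity>"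
      proof -
        have "integrable lborel (\<lambda>x. 2 * norm (f x))" using lim by auto
        then show ?thesis by (subst nn_integral_eq_integral) auto
      qed
    qed (use lim in auto)
    moreover have "(\<integral>\<^sup>+ x. ennreal (norm (f x - s i x)) \<partial>lborel) = ennreal (LINT x|lborel. \<bar>s i x - f x\<bar>)" for i
      using lim by (subst nn_integral_eq_integral) (auto simp: abs_minus_commute)
    ultimately have "(\<lambda>i. ennreal (LINT x|lborel. \<bar>s i x - f x\<bar>)) \<longlonglongrightarrow> ennreal 0" by simp
    then have "(\<lambda>i. LINT x|lborel. \<bar>s i x - f x\<bar>) \<longlonglongrightarrow> 0"
      by (subst (asm) tendsto_ennreal_iff) (auto intro!: always_eventually integral_nonneg_AE)
    from LIMSEQ_D[OF this e] obtain i where "(LINT x|lborel. \<bar>s i x - f x\<bar>) < e" by auto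
    then show "\<exists>g. integrable lborel g \<and>
      (\<lambda>n. LINT x|lborel. \<bar>g (x - h n) - g x\<bar>) \<longlonglongrightarrow> 0 \<and> (LINT x|lborel. \<bar>g x - f x\<bar>) < e"
      using lim by blast
  qed
qed

end

lemma translation_modulus:
  fixes f :: "real ^ 'n \<Rightarrow> real"
  assumes "integrable lborel f" "\<eta> > 0"
  shows "\<exists>d>0. \<forall>h. norm h < d \<longrightarrow> (LINT x|lborel. \<bar>f (x - h) - f x\<bar>) \<le> \<eta>"
proof -
  have "((\<lambda>h. LINT x|lborel. \<bar>f (x - h) - f x\<bar>) \<longlongrightarrow> 0) (at 0)"
    unfolding tendsto_at_iff_sequentially o_def using translation_continuous_L1[OF _ assms(1)] by blast
  then obtain d where d: "d > 0" "\<And>h. h \<noteq> 0 \<Longrightarrow> norm h < d \<Longrightarrow> \<bar>LINT x|lborel. \<bar>f (x - h) - f x\<bar>\<bar> < \<eta>"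
    using assms(2) unfolding tendsto_iff eventually_at dist_norm by fastforce
  have "(LINT x|lborel. \<bar>f (x - h) - f x\<bar>) \<le> \<eta>" if "norm h < d" for h
    using d(2)[of h] that assms(2) by (cases "h = 0") auto
  with d(1) show ?thesis by blast
qed

section \<open>Mollifiers as an approximate identity in the mean\<close>

lemma conv_cong_AE:
  assumes "AE x in lebesgue. f x = g x" "f \<in> borel_measurable lebesgue" "g \<in> borel_measurable lebesgue" "\<rho> \<in> test_functions"
  shows "conv f \<rho> = conv g \<rho>"
proof
  fix x
  have "(\<lambda>y. \<rho> (x - y)) \<in> borel_measurable lebesgue"
    by (intro smooth_measurable test_smooth test_reflect assms)
  then show "conv f \<rho> x = conv g \<rho> x"
    unfolding conv_def using assms by (intro integral_cong_AE) auto
qed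

text \<open>As the kernel has mass one, the error at \<open>x\<close> is the average of
  \<open>f (x - y) - f x\<close> over \<open>y\<close>. Interchanging the integrals leaves the
  average of the translation errors over shifts shorter than \<open>e\<close>.\<close>

lemma conv_mollifier_estimate:
  fixes f :: "real ^ 'n \<Rightarrow> real"
  assumes f: "integrable lborel f" and e: "e > 0"
    and b: "\<And>h. norm h < e \<Longrightarrow> (LINT x|lborel. \<bar>f (x - h) - f x\<bar>) \<le> \<eta>"
  shows "(\<integral>\<^sup>+x. ennreal \<bar>conv f (mollifier e) x - f x\<bar> \<partial>lborel) \<le> ennreal \<eta>"
proof -
  let ?\<rho> = "mollifier e :: real ^ 'n \<Rightarrow> real"
  have \<rho>: "?\<rho> \<in> test_functions" by (rule mollifier_test[OF e])
  have m: "?\<rho> \<in> borel_measurable borel" "f \<in> borel_measurable borel"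
    using smooth_measurable_borel[OF test_smooth[OF \<rho>]] f by auto
  note [measurable] = m
  have i\<rho>: "integrable lborel ?\<rho>"
    using test_integrable[OF \<rho>] m(1) by (simp add: integrable_completion)
  have i1: "(LINT y|lborel. ?\<rho> y) = 1"
    using integral_mollifier[OF e, where 'n = 'n] lebesgue_integral_lborel[OF m(1)] by simp
  have fl: "integrable lebesgue f" using f m by (simp add: integrable_completion)
  have ptw: "ennreal \<bar>conv f ?\<rho> x - f x\<bar> \<le> (\<integral>\<^sup>+y. ennreal (\<bar>f (x - y) - f x\<bar> * ?\<rho> y) \<partial>lborel)" for x
  proof -
    have m': "(\<lambda>y. f y * ?\<rho> (x - y)) \<in> borel_measurable borel" using m by measurable
    have a: "integrable lborel (\<lambda>y. f y * ?\<rho> (x - y))"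
      using conv_integrable[OF fl \<rho>, of x] integrable_completion[of "\<lambda>y. f y * ?\<rho> (x - y)" lborel] m' by simp
    have a': "integrable lborel (\<lambda>y. f (x - y) * ?\<rho> y)"
      using a integrable_distr_eq[of "\<lambda>y. x - y" lborel borel "\<lambda>y. f (x - y) * ?\<rho> y"] m
      by (simp add: lborel_distr_reflect)
    have "conv f ?\<rho> x = (LINT y|lborel. f y * ?\<rho> (x - y))"
      unfolding conv_def by (rule lebesgue_integral_lborel[OF m'])
    also have "\<dots> = (LINT y|lborel. f (x - y) * ?\<rho> y)"
      using lborel_integral_reflect[of "\<lambda>y. f (x - y) * ?\<rho> y" x] m by simp
    finally have "conv f ?\<rho> x - f x = (LINT y|lborel. f (x - y) * ?\<rho> y) - f x * (LINT y|lborel. ?\<rho> y)"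
      by (simp add: i1)
    also have "\<dots> = (LINT y|lborel. (f (x - y) - f x) * ?\<rho> y)"
      using a' i\<rho> by (simp add: left_diff_distrib)
    finally have "ennreal \<bar>conv f ?\<rho> x - f x\<bar> = ennreal (norm (LINT y|lborel. (f (x - y) - f x) * ?\<rho> y))" by simp
    also have "\<dots> \<le> (\<integral>\<^sup>+y. ennreal (norm ((f (x - y) - f x) * ?\<rho> y)) \<partial>lborel)"
      using a' i\<rho> by (intro integral_norm_bound_ennreal) (simp add: left_diff_distrib)
    also have "\<dots> = (\<integral>\<^sup>+y. ennreal (\<bar>f (x - y) - f x\<bar> * ?\<rho> y) \<partial>lborel)"
      by (simp add: abs_mult mollifier_nonneg[OF e])
    finally show ?thesis .
  qed
  have "(\<integral>\<^sup>+x. ennreal \<bar>conv f ?\<rho> x - f x\<bar> \<partial>lborel) \<le> (\<integral>\<^sup>+x. (\<integral>\<^sup>+y. ennreal (\<bar>f (x - y) - f x\<bar> * ?\<rho> y) \<partial>lborel) \<partial>lborel)"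
    by (intro nn_integral_mono ptw)
  also have "\<dots> = (\<integral>\<^sup>+y. (\<integral>\<^sup>+x. ennreal (\<bar>f (x - y) - f x\<bar> * ?\<rho> y) \<partial>lborel) \<partial>lborel)"
    by (intro lborel_pair.Fubini'[symmetric]) measurable
  also have "\<dots> = (\<integral>\<^sup>+y. (\<integral>\<^sup>+x. ennreal \<bar>f (x - y) - f x\<bar> \<partial>lborel) * ennreal (?\<rho> y) \<partial>lborel)"
    using m by (simp add: ennreal_mult mollifier_nonneg[OF e] nn_integral_multc)
  also have "\<dots> \<le> (\<integral>\<^sup>+y. ennreal \<eta> * ennreal (?\<rho> y) \<partial>lborel)"
  proof (intro nn_integral_mono)
    fix y
    have "(\<integral>\<^sup>+x. ennreal \<bar>f (x - y) - f x\<bar> \<partial>lborel) = ennreal (LINT x|lborel. \<bar>f (x - y) - f x\<bar>)"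
      using f lborel_integrable_translate[OF f] by (intro nn_integral_eq_integral) auto
    then show "(\<integral>\<^sup>+x. ennreal \<bar>f (x - y) - f x\<bar> \<partial>lborel) * ennreal (?\<rho> y) \<le> ennreal \<eta> * ennreal (?\<rho> y)"
      using b[of y] mollifier_support[OF e, of y]
      by (cases "?\<rho> y = 0") (auto intro!: mult_right_mono ennreal_leI)
  qed
  also have "\<dots> = ennreal \<eta> * ennreal 1"
    using i\<rho> m by (simp add: nn_integral_cmult nn_integral_eq_integral mollifier_nonneg[OF e] i1)
  finally show ?thesis by simp
qed

text \<open>The interchange of integrals above is carried out for Borel functions. Passing to a
  Borel representative is harmless, because convolutions with test functions do not see null
  sets.\<close>

lemma lebesgue_borel_representative:
  fixes f :: "real ^ 'n \<Rightarrow> real"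
  assumes "integrable lebesgue f"
  obtains g where "g \<in> borel_measurable borel" "integrable lborel g" "AE x in lebesgue. f x = g x"
    "\<And>\<rho>. \<rho> \<in> test_functions \<Longrightarrow> conv f \<rho> = conv g \<rho>"
proof -
  obtain g where g: "g \<in> borel_measurable lborel" "AE x in lborel. f x = g x"
    using completion_ex_borel_measurable_real[OF borel_measurable_integrable[OF assms]] by blast
  have ae: "AE x in lebesgue. f x = g x" using g(2) by (rule AE_completion)
  have gl: "g \<in> borel_measurable lebesgue" using g(1) by (rule measurable_completion)
  have "integrable lebesgue g"
    using assms ae gl by (subst integrable_cong_AE[symmetric, of f]) auto
  then have "integrable lborel g" using g(1) by (simp add: integrable_completion)
  moreover have "conv f \<rho> = conv g \<rho>" if "\<rho> \<in> test_functions" for \<rho>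
    using ae assms gl that by (intro conv_cong_AE) auto
  ultimately show ?thesis using that[of g] g(1) ae by simp
qed

text \<open>The estimate is used with the crude modulus \<open>\<eta>\<close> equal to twice the
  integral of \<open>\<bar>g\<bar>\<close>, valid for every shift; it makes the difference of the
  convolution and \<open>g\<close> integrable.\<close>

lemma integrable_conv_mollifier:
  fixes f :: "real ^ 'n \<Rightarrow> real"
  assumes f: "integrable lebesgue f" and e: "e > 0"
  shows "integrable lebesgue (conv f (mollifier e))"
proof -
  obtain g where g: "g \<in> borel_measurable borel" "integrable lborel g" "AE x in lebesgue. f x = g x"
    "\<And>\<rho>. \<rho> \<in> test_functions \<Longrightarrow> conv f \<rho> = conv g \<rho>" using lebesgue_borel_representative[OF f] by metis
  let ?c = "conv g (mollifier e)"
  have fg: "conv f (mollifier e) = ?c" by (intro g(4) mollifier_test e)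
  have mc: "?c \<in> borel_measurable borel"
    using smooth_measurable_borel[OF smooth_conv[OF f mollifier_test[OF e]]] by (simp add: fg)
  have "(LINT x|lborel. \<bar>g (x - h) - g x\<bar>) \<le> (LINT x|lborel. \<bar>g (x - h)\<bar> + \<bar>g x\<bar>)" for h
    using g(2) lborel_integrable_translate[OF g(2)] by (intro integral_mono) auto
  also have "(LINT x|lborel. \<bar>g (x - h)\<bar> + \<bar>g x\<bar>) = 2 * (LINT x|lborel. \<bar>g x\<bar>)" for h
    using g(2) lborel_integrable_translate[OF g(2), of h] lborel_integral_translate[of "\<lambda>x. \<bar>g x\<bar>" h] g(1) by simp
  finally have "(\<integral>\<^sup>+x. ennreal \<bar>?c x - g x\<bar> \<partial>lborel) \<le> ennreal (2 * (LINT x|lborel. \<bar>g x\<bar>))"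
    using conv_mollifier_estimate[OF g(2) e] by blast
  then have "integrable lborel (\<lambda>x. ?c x - g x)"
    using mc g(1) by (auto simp: integrable_iff_bounded intro: le_less_trans)
  then have "integrable lborel (\<lambda>x. (?c x - g x) + g x)" using g(2) by (rule Bochner_Integration.integrable_add)
  then show ?thesis using mc by (simp add: integrable_completion fg)
qed

lemma conv_mollifier_L1_tendsto:
  fixes f :: "real ^ 'n \<Rightarrow> real"
  assumes f: "integrable lebesgue f" and e: "\<And>n. e n > 0" "e \<longlonglongrightarrow> 0"
  shows "(\<lambda>n. LINT x|lebesgue. \<bar>conv f (mollifier (e n)) x - f x\<bar>) \<longlonglongrightarrow> 0"
proof -
  obtain g where g: "g \<in> borel_measurable borel" "integrable lborel g" "AE x in lebesgue. f x = g x"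
    "\<And>\<rho>. \<rho> \<in> test_functions \<Longrightarrow> conv f \<rho> = conv g \<rho>" using lebesgue_borel_representative[OF f] by metis
  have gl: "integrable lebesgue g" using g(1,2) by (simp add: integrable_completion)
  have nn: "ennreal (LINT x|lebesgue. \<bar>conv f (mollifier d) x - f x\<bar>) = (\<integral>\<^sup>+x. ennreal \<bar>conv g (mollifier d) x - g x\<bar> \<partial>lborel)" if "d > 0" for d
  proof -
    have c: "conv f (mollifier d) = conv g (mollifier d)" using that by (intro g(4) mollifier_test)
    have ic: "integrable lebesgue (conv g (mollifier d))" using integrable_conv_mollifier[OF gl that] .
    have "(LINT x|lebesgue. \<bar>conv f (mollifier d) x - f x\<bar>) = (LINT x|lebesgue. \<bar>conv g (mollifier d) x - g x\<bar>)"
      unfolding c using g(3) ic f gl by (intro integral_cong_AE) auto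
    also have "ennreal \<dots> = (\<integral>\<^sup>+x. ennreal \<bar>conv g (mollifier d) x - g x\<bar> \<partial>lebesgue)"
      using ic gl by (subst nn_integral_eq_integral) auto
    finally show ?thesis by (simp add: nn_integral_completion)
  qed
  show ?thesis
  proof (rule LIMSEQ_I)
    fix r :: real assume r: "r > 0"
    obtain d where d: "d > 0" "\<And>h. norm h < d \<Longrightarrow> (LINT x|lborel. \<bar>g (x - h) - g x\<bar>) \<le> r / 2"
      using translation_modulus[OF g(2), of "r / 2"] r by auto
    obtain N where N: "\<And>n. n \<ge> N \<Longrightarrow> e n < d" using LIMSEQ_D[OF e(2) d(1)] e(1) by fastforce
    have "norm ((LINT x|lebesgue. \<bar>conv f (mollifier (e n)) x - f x\<bar>) - 0) < r" if "n \<ge> N" for n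
    proof -
      have "ennreal (LINT x|lebesgue. \<bar>conv f (mollifier (e n)) x - f x\<bar>) \<le> ennreal (r / 2)"
        unfolding nn[OF e(1)] using d(2) N[OF that] by (intro conv_mollifier_estimate g e(1)) auto
      then have "(LINT x|lebesgue. \<bar>conv f (mollifier (e n)) x - f x\<bar>) \<le> r / 2"
        using r by (simp add: ennreal_le_iff)
      moreover have "(LINT x|lebesgue. \<bar>conv f (mollifier (e n)) x - f x\<bar>) \<ge> 0" by (intro integral_nonneg_AE) simp
      ultimately show ?thesis using r by simp
    qed
    then show "\<exists>no. \<forall>n\<ge>no. norm ((LINT x|lebesgue. \<bar>conv f (mollifier (e n)) x - f x\<bar>) - 0) < r" by blast
  qed
qed

text \<open>For a test function \<open>\<theta>\<close> the product \<open>v * \<theta>\<close> is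
  integrable, and its mollification at \<open>x\<close> is the pairing of \<open>v\<close> with the
  test function \<open>\<theta> y * mollifier (e n) (x - y)\<close>, hence 0. Convergence in the
  mean forces \<open>v * \<theta>\<close> to vanish almost everywhere.\<close>

lemma du_Bois_Reymond:
  fixes v :: "real ^ 'n \<Rightarrow> real"
  assumes v: "locally_integrable v" and 0: "\<And>\<psi>. \<psi> \<in> test_functions \<Longrightarrow> (LINT x|lebesgue. v x * \<psi> x) = 0"
  shows "AE x in lebesgue. v x = 0"
proof -
  have *: "AE x in lebesgue. v x * \<theta> x = 0" if \<theta>: "\<theta> \<in> test_functions" for \<theta>
  proof -
    let ?f = "\<lambda>x. v x * \<theta> x"
    define e where "e = (\<lambda>n. inverse (real (Suc n)))"
    have e: "e n > 0" "e \<longlonglongrightarrow> 0" for n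
      unfolding e_def by (simp, rule LIMSEQ_inverse_real_of_nat)
    have f: "integrable lebesgue ?f" by (rule integrable_mult_test[OF v \<theta>])
    have "conv ?f (mollifier (e n)) x = 0" for n x
    proof -
      have "conv ?f (mollifier (e n)) x = (LINT y|lebesgue. v y * (\<theta> y * mollifier (e n) (x - y)))"
        unfolding conv_def by (simp add: mult.assoc)
      also have "\<dots> = 0"
        by (intro 0 test_mult \<theta> test_smooth test_reflect mollifier_test e)
      finally show ?thesis .
    qed
    with conv_mollifier_L1_tendsto[OF f e] have "(\<lambda>n::nat. LINT x|lebesgue. \<bar>?f x\<bar>) \<longlonglongrightarrow> 0" by simp
    then have "(LINT x|lebesgue. \<bar>?f x\<bar>) = 0" by (simp add: LIMSEQ_const_iff)
    then show ?thesis using f by (subst (asm) integral_nonneg_eq_0_iff_AE) auto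
  qed
  \<comment> \<open>Countably many dilated bumps suffice to cover the whole space: at each point
    they converge to the positive value \<open>bump 0\<close>, so one of them is positive
    there.\<close>
  have "AE x in lebesgue. \<forall>k::nat. v x * bump ((1 / real (Suc k)) *\<^sub>R x) = 0"
    unfolding AE_all_countable
  proof
    fix k :: nat
    have "(\<lambda>x :: real ^ 'n. bump (0 + (1 / real (Suc k)) *\<^sub>R x)) \<in> test_functions"
      by (intro test_affine bump_test) auto
    from *[OF this] show "AE x in lebesgue. v x * bump ((1 / real (Suc k)) *\<^sub>R x) = 0" by simp
  qed
  then show ?thesis
  proof eventually_elim
    case (elim x)
    have "(\<lambda>k. bump ((1 / real (Suc k)) *\<^sub>R x)) \<longlonglongrightarrow> bump (0 :: real ^ 'n)"
      by (rule bump_rescale_tendsto)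
    then have "eventually (\<lambda>k. bump ((1 / real (Suc k)) *\<^sub>R x) > 0) sequentially"
      using bump_0 by (rule order_tendstoD)
    then obtain k where "bump ((1 / real (Suc k)) *\<^sub>R x) > 0" by (auto simp: eventually_sequentially)
    with elim[rule_format, of k] show ?case by auto
  qed
qed

section \<open>Calculus of distributional derivatives\<close>

lemma locally_integrable_diff:
  "locally_integrable u \<Longrightarrow> locally_integrable v \<Longrightarrow> locally_integrable (\<lambda>x. u x - v x)"
  by (auto simp: locally_integrable_def)

lemma locally_integrable_add:
  "locally_integrable u \<Longrightarrow> locally_integrable v \<Longrightarrow> locally_integrable (\<lambda>x. u x + v x)"
  by (auto simp: locally_integrable_def)

lemma locally_integrable_cmult:
  "locally_integrable u \<Longrightarrow> locally_integrable (\<lambda>x. c * u x)"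
  by (auto simp: locally_integrable_def)

lemma has_distr_deriv_unique:
  assumes "has_distr_deriv \<alpha> u v" "has_distr_deriv \<alpha> u w"
  shows "AE x in lebesgue. v x = w x"
proof -
  have l: "locally_integrable v" "locally_integrable w" using assms by (auto simp: has_distr_deriv_def)
  have "(LINT x|lebesgue. (v x - w x) * \<psi> x) = 0" if \<psi>: "\<psi> \<in> test_functions" for \<psi>
  proof -
    have "(LINT x|lebesgue. u x * mi_deriv \<alpha> \<psi> x) = (-1) ^ mi_order \<alpha> * (LINT x|lebesgue. v x * \<psi> x)"
      "(LINT x|lebesgue. u x * mi_deriv \<alpha> \<psi> x) = (-1) ^ mi_order \<alpha> * (LINT x|lebesgue. w x * \<psi> x)"
      using assms \<psi> by (blast dest: has_distr_deriv_def[THEN iffD1])+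
    then have "(LINT x|lebesgue. v x * \<psi> x) = (LINT x|lebesgue. w x * \<psi> x)" by simp
    moreover have "(LINT x|lebesgue. (v x - w x) * \<psi> x) = (LINT x|lebesgue. v x * \<psi> x) - (LINT x|lebesgue. w x * \<psi> x)"
      unfolding left_diff_distrib using l \<psi>
      by (intro Bochner_Integration.integral_diff integrable_mult_test)
    ultimately show ?thesis by simp
  qed
  then have "AE x in lebesgue. v x - w x = 0"
    by (intro du_Bois_Reymond locally_integrable_diff l) auto
  then show ?thesis by eventually_elim simp
qed

lemma distr_deriv_AE:
  assumes "has_distr_deriv \<alpha> u v"
  shows "AE x in lebesgue. distr_deriv \<alpha> u x = v x"
  using has_distr_deriv_unique[OF _ assms] assms
  unfolding distr_deriv_def by (metis someI)

lemma has_distr_deriv_smooth: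
  fixes u :: "real ^ 'n \<Rightarrow> real"
  assumes "smooth u"
  shows "has_distr_deriv \<alpha> u (mi_deriv \<alpha> u)"
  unfolding has_distr_deriv_def
proof (intro conjI ballI)
  show "locally_integrable u" "locally_integrable (mi_deriv \<alpha> u)"
    using assms by (auto simp: mi_deriv_eq_iter_partial intro!: continuous_locally_integrable smooth_continuous smooth_iter_partial)
  fix \<psi> :: "real ^ 'n \<Rightarrow> real" assume "\<psi> \<in> test_functions"
  then show "(LINT x|lebesgue. u x * mi_deriv \<alpha> \<psi> x) = (- 1) ^ mi_order \<alpha> * (LINT x|lebesgue. mi_deriv \<alpha> u x * \<psi> x)"
    using integral_iter_by_parts[OF assms] by (simp add: mi_deriv_eq_iter_partial length_index_list)
qed

lemma test_mi_deriv: "\<psi> \<in> test_functions \<Longrightarrow> mi_deriv \<alpha> \<psi> \<in> test_functions"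
  by (simp add: mi_deriv_eq_iter_partial test_iter_partial)

lemma has_distr_deriv_diff:
  assumes "has_distr_deriv \<alpha> u v" "has_distr_deriv \<alpha> u' v'"
  shows "has_distr_deriv \<alpha> (\<lambda>x. u x - u' x) (\<lambda>x. v x - v' x)"
  using assms unfolding has_distr_deriv_def
  by (auto simp: locally_integrable_diff left_diff_distrib integrable_mult_test test_mi_deriv right_diff_distrib)

text \<open>The reflected kernel \<open>\<eta>\<close> is an admissible test function. Reflection
  produces the sign \<open>(-1) ^ mi_order \<alpha>\<close>, which cancels the one in the definition
  of the distributional derivative.\<close>

lemma mi_deriv_conv:
  assumes "has_distr_deriv \<alpha> u v" "integrable lebesgue u" "\<rho> \<in> test_functions"
  shows "mi_deriv \<alpha> (conv u \<rho>) = conv v \<rho>"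
proof
  fix x
  let ?is = "index_list \<alpha>" and ?s = "(-1 :: real) ^ mi_order \<alpha>"
  define \<eta> where "\<eta> y = \<rho> (x - y)" for y
  have \<eta>: "\<eta> \<in> test_functions" unfolding \<eta>_def by (rule test_reflect[OF assms(3)])
  have me: "mi_deriv \<alpha> \<eta> = (\<lambda>y. ?s * iter_partial ?is \<rho> (x - y))"
    using iter_partial_affine[OF test_smooth[OF assms(3)], of ?is x "-1"]
    by (simp add: mi_deriv_eq_iter_partial \<eta>_def[abs_def] length_index_list)
  have "(LINT y|lebesgue. u y * mi_deriv \<alpha> \<eta> y) = ?s * (LINT y|lebesgue. v y * \<eta> y)"
    using assms(1) \<eta> unfolding has_distr_deriv_def by blast
  then have "?s * (LINT y|lebesgue. v y * \<eta> y) = (LINT y|lebesgue. u y * (?s * iter_partial ?is \<rho> (x - y)))"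
    unfolding me by (rule sym)
  also have "(LINT y|lebesgue. u y * (?s * iter_partial ?is \<rho> (x - y))) = (LINT y|lebesgue. ?s * (u y * iter_partial ?is \<rho> (x - y)))"
    by (simp only: mult.left_commute)
  also have "\<dots> = ?s * (LINT y|lebesgue. u y * iter_partial ?is \<rho> (x - y))" by simp
  finally have "?s * (LINT y|lebesgue. v y * \<eta> y) = ?s * (LINT y|lebesgue. u y * iter_partial ?is \<rho> (x - y))" .
  then show "mi_deriv \<alpha> (conv u \<rho>) x = conv v \<rho> x"
    by (simp add: mi_deriv_eq_iter_partial iter_partial_conv[OF assms(2,3)] conv_def \<eta>_def)
qed

text \<open>Testing \<open>u\<close> against \<open>\<theta> * D\<psi>\<close> turns each correction
  term into a pairing of \<open>u\<close> with a derivative of the test function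
  \<open>\<psi> * iter_partial gs \<theta>\<close>. Moving it to \<open>V\<close> costs the sign
  \<open>(-1) ^ length bs\<close>; factoring out the global sign adds
  \<open>mi_order \<alpha>\<close> to the exponent. The list \<open>L\<close> is a parameter, so one
  list can serve a whole sequence of cut-offs.\<close>

lemma has_distr_deriv_mult:
  fixes u \<theta> :: "real ^ 'n \<Rightarrow> real"
  assumes V: "\<And>\<beta>. mi_order \<beta> \<le> mi_order \<alpha> \<Longrightarrow> has_distr_deriv \<beta> u (V \<beta>)"
    and \<theta>: "smooth \<theta>"
    and L: "\<forall>(c, bs, gs) \<in> set L. length bs \<le> mi_order \<alpha>"
    and leibniz: "\<And>\<psi> x. smooth \<psi> \<Longrightarrow> \<theta> x * iter_partial (index_list \<alpha>) \<psi> x =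
        iter_partial (index_list \<alpha>) (\<lambda>x. \<theta> x * \<psi> x) x +
        (\<Sum>(c, bs, gs) \<leftarrow> L. c * iter_partial bs (\<lambda>x. \<psi> x * iter_partial gs \<theta> x) x)"
  shows "has_distr_deriv \<alpha> (\<lambda>x. u x * \<theta> x) (\<lambda>x. V \<alpha> x * \<theta> x +
     (\<Sum>(c, bs, gs) \<leftarrow> L. (- 1) ^ (length bs + mi_order \<alpha>) * c * (V (count_list bs) x * iter_partial gs \<theta> x)))"
    (is "has_distr_deriv \<alpha> _ (\<lambda>x. _ + ?S2 L x)")
  unfolding has_distr_deriv_def
proof (intro conjI ballI)
  have u: "locally_integrable u" using V[of \<alpha>] by (simp add: has_distr_deriv_def)
  have lV: "locally_integrable (V \<beta>)" if "mi_order \<beta> \<le> mi_order \<alpha>" for \<beta>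
    using V[OF that] by (simp add: has_distr_deriv_def)
  show "locally_integrable (\<lambda>x. u x * \<theta> x)"
    by (intro locally_integrable_mult_continuous u smooth_continuous \<theta>)
  have l2: "locally_integrable (?S2 K)" if "\<forall>(c, bs, gs) \<in> set K. length bs \<le> mi_order \<alpha>" for K
    using that
  proof (induction K)
    case Nil
    then show ?case by (simp add: continuous_locally_integrable)
  next
    case (Cons t K)
    obtain c bs gs where t: "t = (c, bs, gs)" by (cases t)
    have "locally_integrable (\<lambda>x. (- 1) ^ (length bs + mi_order \<alpha>) * c * (V (count_list bs) x * iter_partial gs \<theta> x))"
      using Cons.prems by (intro locally_integrable_cmult locally_integrable_mult_continuous lV
          smooth_continuous smooth_iter_partial \<theta>) (auto simp: t mi_order_count_list)
    then show ?case using Cons by (auto simp: t intro: locally_integrable_add)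
  qed
  have lm: "locally_integrable (\<lambda>x. V \<alpha> x * \<theta> x)"
    by (intro locally_integrable_mult_continuous lV smooth_continuous \<theta>) simp
  with l2[OF L] show "locally_integrable (\<lambda>x. V \<alpha> x * \<theta> x + ?S2 L x)"
    by (intro locally_integrable_add)
  fix \<psi> :: "real ^ 'n \<Rightarrow> real" assume \<psi>: "\<psi> \<in> test_functions"
  let ?S1 = "\<lambda>K x. \<Sum>(c, bs, gs) \<leftarrow> K. c * iter_partial bs (\<lambda>x. \<psi> x * iter_partial gs \<theta> x) x"
  have t: "(\<lambda>x. \<psi> x * iter_partial gs \<theta> x) \<in> test_functions" for gs
    by (intro test_mult \<psi> smooth_iter_partial \<theta>)
  \<comment> \<open>Integrability is part of the induction claim, because splitting the integral of
    the next sum requires it.\<close>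
  have S: "integrable lebesgue (\<lambda>x. u x * ?S1 K x) \<and>
     (LINT x|lebesgue. u x * ?S1 K x) = (- 1) ^ mi_order \<alpha> * (LINT x|lebesgue. ?S2 K x * \<psi> x)"
    if "\<forall>(c, bs, gs) \<in> set K. length bs \<le> mi_order \<alpha>" for K
    using that
  proof (induction K)
    case (Cons k K)
    obtain c bs gs where k: "k = (c, bs, gs)" by (cases k)
    let ?q = "(- 1) ^ (length bs + mi_order \<alpha>) * c :: real"
    have i1: "integrable lebesgue (\<lambda>x. u x * iter_partial bs (\<lambda>x. \<psi> x * iter_partial gs \<theta> x) x)"
      by (intro integrable_mult_test u test_iter_partial t)
    have i2: "integrable lebesgue (\<lambda>x. V (count_list bs) x * (\<psi> x * iter_partial gs \<theta> x))"
      using Cons.prems by (intro integrable_mult_test lV t) (auto simp: k mi_order_count_list)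
    have i3: "integrable lebesgue (\<lambda>x. ?S2 K x * \<psi> x)"
      using Cons.prems by (intro integrable_mult_test l2 \<psi>) auto
    have IH: "integrable lebesgue (\<lambda>x. u x * ?S1 K x)"
      "(LINT x|lebesgue. u x * ?S1 K x) = (- 1) ^ mi_order \<alpha> * (LINT x|lebesgue. ?S2 K x * \<psi> x)"
      using Cons by auto
    have d: "(LINT x|lebesgue. u x * iter_partial bs (\<lambda>x. \<psi> x * iter_partial gs \<theta> x) x) =
       (- 1) ^ length bs * (LINT x|lebesgue. V (count_list bs) x * (\<psi> x * iter_partial gs \<theta> x))"
      using V[of "count_list bs"] Cons.prems t[of gs]
      by (simp add: k mi_order_count_list has_distr_deriv_def mi_deriv_count_list test_smooth)
    have e1: "u x * ?S1 (k # K) x = c * (u x * iter_partial bs (\<lambda>x. \<psi> x * iter_partial gs \<theta> x) x) + u x * ?S1 K x" for x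
      by (simp add: k algebra_simps)
    have e2: "?S2 (k # K) x * \<psi> x = ?q * (V (count_list bs) x * (\<psi> x * iter_partial gs \<theta> x)) + ?S2 K x * \<psi> x" for x
      by (simp add: k algebra_simps)
    have "(LINT x|lebesgue. u x * ?S1 (k # K) x) =
        c * (LINT x|lebesgue. u x * iter_partial bs (\<lambda>x. \<psi> x * iter_partial gs \<theta> x) x) + (LINT x|lebesgue. u x * ?S1 K x)"
      unfolding e1 using i1 IH(1)
      by (subst Bochner_Integration.integral_add) (auto simp del: sum_list.Cons)
    moreover have "(LINT x|lebesgue. ?S2 (k # K) x * \<psi> x) =
        ?q * (LINT x|lebesgue. V (count_list bs) x * (\<psi> x * iter_partial gs \<theta> x)) + (LINT x|lebesgue. ?S2 K x * \<psi> x)"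
      unfolding e2 using i2 i3
      by (subst Bochner_Integration.integral_add) auto
    moreover have "c * ((- 1) ^ length bs * z) + (- 1) ^ mi_order \<alpha> * z' = (- 1) ^ mi_order \<alpha> * (?q * z + z')" for z z' :: real
      by (cases "even (mi_order \<alpha>)") (auto simp: power_add distrib_left)
    moreover have "integrable lebesgue (\<lambda>x. u x * ?S1 (k # K) x)"
      unfolding e1 using i1 IH(1) by (intro Bochner_Integration.integrable_add integrable_mult_right)
    ultimately show ?case by (simp only: IH(2) d)
  qed simp
  have i0: "integrable lebesgue (\<lambda>x. u x * iter_partial (index_list \<alpha>) (\<lambda>x. \<theta> x * \<psi> x) x)"
    by (intro integrable_mult_test u test_iter_partial test_mult' \<psi> \<theta>)
  have d0: "(LINT x|lebesgue. u x * iter_partial (index_list \<alpha>) (\<lambda>x. \<theta> x * \<psi> x) x) = (-1) ^ mi_order \<alpha> * (LINT x|lebesgue. V \<alpha> x * (\<theta> x * \<psi> x))"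
    using V[of \<alpha>] test_mult'[OF \<psi> \<theta>] by (simp add: has_distr_deriv_def mi_deriv_eq_iter_partial)
  have i4: "integrable lebesgue (\<lambda>x. (V \<alpha> x * \<theta> x) * \<psi> x)"
    by (intro integrable_mult_test lm \<psi>)
  have i5: "integrable lebesgue (\<lambda>x. ?S2 L x * \<psi> x)"
    by (intro integrable_mult_test l2 L \<psi>)
  have e3: "u x * \<theta> x * mi_deriv \<alpha> \<psi> x = u x * iter_partial (index_list \<alpha>) (\<lambda>x. \<theta> x * \<psi> x) x + u x * ?S1 L x" for x
    unfolding mi_deriv_eq_iter_partial mult.assoc leibniz[OF test_smooth[OF \<psi>]] by (simp add: distrib_left)
  show "(LINT x|lebesgue. u x * \<theta> x * mi_deriv \<alpha> \<psi> x) = (- 1) ^ mi_order \<alpha> * (LINT x|lebesgue. (V \<alpha> x * \<theta> x + ?S2 L x) * \<psi> x)"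
    unfolding e3 distrib_right using i0 i4 i5 S[OF L] d0 by (simp add: distrib_left mult.assoc)
qed

section \<open>Modular convergence of mollifications\<close>

definition young :: "(real \<Rightarrow> real) \<Rightarrow> bool" where
  "young f \<longleftrightarrow> convex_on {0..} f \<and> f 0 = 0 \<and> (\<forall>s\<ge>0. 0 \<le> f s)"

lemma young_nonneg: "young f \<Longrightarrow> 0 \<le> s \<Longrightarrow> 0 \<le> f s"
  by (simp add: young_def)

lemma young_scale:
  assumes "young f" "0 \<le> c" "c \<le> 1" "0 \<le> s"
  shows "f (c * s) \<le> c * f s"
proof -
  have "f ((1 - c) *\<^sub>R 0 + c *\<^sub>R s) \<le> (1 - c) * f 0 + c * f s"
    using assms by (intro convex_onD[of "{0..}"]) (auto simp: young_def)
  then show ?thesis using assms by (simp add: young_def)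
qed

lemma young_mono:
  assumes "young f" "0 \<le> s" "s \<le> t"
  shows "f s \<le> f t"
proof (cases "t = 0")
  case False
  then have t: "t > 0" using assms by simp
  have "f ((s / t) * t) \<le> (s / t) * f t"
    using assms t by (intro young_scale[OF assms(1)]) auto
  also have "\<dots> \<le> 1 * f t"
    using assms t by (intro mult_right_mono young_nonneg[OF assms(1)]) auto
  finally show ?thesis using t by simp
next
  case True
  then have "s = t" using assms by simp
  then show ?thesis by simp
qed

lemma young_isCont:
  assumes "young f" "0 < t"
  shows "isCont f t"
proof -
  have "convex_on {0<..} f"
    using assms(1) by (auto simp: young_def intro: convex_on_subset)
  then have "continuous_on {0<..} f" by (intro convex_on_continuous) auto
  then show ?thesis using assms(2) by (simp add: continuous_on_eq_continuous_at)
qed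

text \<open>Convexity yields continuity only in the interior. At the end point the chord bound
  \<open>f s \<le> s * f 1\<close> for small \<open>s\<close> takes its place.\<close>

lemma young_tendsto_0:
  assumes "young f" "\<And>n. 0 \<le> s n" "s \<longlonglongrightarrow> 0"
  shows "(\<lambda>n. f (s n)) \<longlonglongrightarrow> 0"
proof (rule real_tendsto_sandwich[OF _ _ tendsto_const])
  show "eventually (\<lambda>n. 0 \<le> f (s n)) sequentially"
    by (intro always_eventually allI young_nonneg[OF assms(1)] assms)
  have "eventually (\<lambda>n. s n < 1) sequentially"
    using assms(3) by (rule order_tendstoD) simp
  then show "eventually (\<lambda>n. f (s n) \<le> s n * f 1) sequentially"
  proof eventually_elim
    case (elim n)
    then show ?case using young_scale[OF assms(1), of "s n" 1] assms(2)[of n] by simp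
  qed
  show "(\<lambda>n. s n * f 1) \<longlonglongrightarrow> 0" using tendsto_mult_right[OF assms(3), of "f 1"] by simp
qed

text \<open>\<open>\<kappa>\<close> is the infimum of the difference quotients to the right of
  \<open>t\<close>, i.e. the right derivative. It is nonnegative because the line lies below
  \<open>f 0 = 0\<close> at the origin while \<open>f t \<ge> 0\<close>.\<close>

lemma young_subgradient:
  assumes "young f" "0 < t"
  obtains \<kappa> where "\<kappa> \<ge> 0" "\<And>s. s \<ge> 0 \<Longrightarrow> f t + \<kappa> * (s - t) \<le> f s"
proof -
  define \<kappa> where "\<kappa> = (INF s\<in>{t<..} \<inter> {0..}. (f t - f s) / (t - s))"
  have k: "f t + \<kappa> * (s - t) \<le> f s" if "s \<ge> 0" for s
    unfolding \<kappa>_def using assms that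
    by (intro convex_le_Inf_differential) (auto simp: young_def)
  from k[of 0] have "\<kappa> * t \<ge> f t" using assms by (simp add: young_def)
  moreover have "f t \<ge> 0" using assms young_nonneg[OF assms(1), of t] by simp
  ultimately have "\<kappa> \<ge> 0" using assms(2) by (smt (verit) mult_neg_pos)
  with k that show ?thesis by blast
qed

text \<open>A comparison \<open>f \<le> C g\<close> known only on \<open>[0, 2s]\<close> passes, up to a factor 2, to every supporting line of
  \<open>f\<close> at a point of \<open>(0, s]\<close> on the whole half-line: beyond \<open>2s\<close> the line grows linearly with slope at most
  \<open>f(2s)/s\<close>, whereas \<open>g\<close> grows at least linearly. This replaces the biconjugate of \<open>inf\<^sub>y M(y, \<cdot>)\<close>.\<close>

lemma supporting_line_le:
  assumes f: "young f" and g: "young g" and t: "0 < t" "t \<le> s" and C: "0 \<le> C"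
    and le: "\<And>r. 0 \<le> r \<Longrightarrow> r \<le> 2 * s \<Longrightarrow> f r \<le> C * g r"
    and k: "\<kappa> \<ge> 0" "\<And>r. r \<ge> 0 \<Longrightarrow> f t + \<kappa> * (r - t) \<le> f r" and r: "r \<ge> 0"
  shows "f t + \<kappa> * (r - t) \<le> 2 * C * g r"
proof (cases "r \<le> 2 * s")
  case True
  then have "f t + \<kappa> * (r - t) \<le> C * g r" using le[OF r True] k(2)[OF r] by linarith
  also have "\<dots> \<le> 2 * (C * g r)" using C young_nonneg[OF g r] by simp
  finally show ?thesis by simp
next
  case False
  have s: "s > 0" using t by simp
  have r0: "r > 0" using False s by simp
  have "f t + \<kappa> * (0 - t) \<le> 0" using k(2)[of 0] f by (simp add: young_def)
  then have "f t + \<kappa> * (r - t) \<le> \<kappa> * r" by (simp add: algebra_simps)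
  also have "\<dots> = (\<kappa> * s) * (r / s)" using s by simp
  also have "\<dots> \<le> (C * g (2 * s)) * (r / s)"
  proof (intro mult_right_mono)
    \<comment> \<open>Since \<open>t \<le> s\<close>, the line has run at least the length
      \<open>s\<close> by the time it reaches \<open>2 * s\<close>, where it still lies below
      \<open>f\<close>. This extra length is the reason for comparing up to \<open>2 * s\<close> and
      not only up to \<open>s\<close>.\<close>
    have "\<kappa> * s \<le> \<kappa> * (2 * s - t)" using k(1) t by (intro mult_left_mono) auto
    also have "\<dots> \<le> f (2 * s)" using k(2)[of "2 * s"] s young_nonneg[OF f, of t] t by simp
    also have "\<dots> \<le> C * g (2 * s)" using s by (intro le) auto
    finally show "\<kappa> * s \<le> C * g (2 * s)" .
  qed (use r0 s in auto)
  also have "\<dots> \<le> (C * ((2 * s / r) * g r)) * (r / s)"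
  proof (intro mult_right_mono mult_left_mono C)
    \<comment> \<open>Linear growth of \<open>g\<close> beyond \<open>2 * s\<close>: the chord from
      the origin to \<open>r\<close> lies above \<open>g\<close> at \<open>2 * s\<close>.\<close>
    have "g ((2 * s / r) * r) \<le> (2 * s / r) * g r"
      using False s r0 by (intro young_scale[OF g]) auto
    then show "g (2 * s) \<le> (2 * s / r) * g r" using r0 by simp
  qed (use r0 s in auto)
  also have "\<dots> = 2 * C * g r" using r0 s by (simp add: field_simps)
  finally show ?thesis .
qed

section \<open>Modulars: measurability, monotonicity and convergence\<close>

definition musielak :: "(real ^ 'n \<Rightarrow> real \<Rightarrow> real) \<Rightarrow> bool" where
  "musielak M \<longleftrightarrow> (\<forall>s\<ge>0. (\<lambda>x. M x s) \<in> borel_measurable lebesgue) \<and> (AE x in lebesgue. young (M x))"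

lemma N_function_musielak: "N_function M \<Longrightarrow> musielak M"
  unfolding N_function_def Phi_function_def phi_function_def musielak_def young_def by auto

text \<open>Caratheodory argument: \<open>a\<close> is approximated by the countably valued
  functions \<open>b k\<close>, for which only sections at fixed arguments occur, and continuity in
  the second variable gives the limit. Since continuity holds only for almost every
  \<open>x\<close>, \<open>M'\<close> is set to 0 on the exceptional null set.\<close>

lemma musielak_measurable:
  fixes M :: "real ^ 'n \<Rightarrow> real \<Rightarrow> real"
  assumes M: "musielak M" and a: "a \<in> borel_measurable lebesgue" "\<And>x. 0 \<le> a x"
  shows "(\<lambda>x. M x (a x)) \<in> borel_measurable lebesgue"
proof -
  define M' where "M' x s = (if young (M x) then M x s else 0)" for x s
  have ae: "AE x in lebesgue. M x s = M' x s" for s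
    using M unfolding musielak_def M'_def by auto
  have y: "young (M' x)" for x
    by (cases "young (M x)") (auto simp: M'_def[abs_def] young_def convex_on_def)
  have m: "(\<lambda>x. M' x s) \<in> borel_measurable lebesgue" if "s \<ge> 0" for s
    using M that by (intro borel_measurable_AE[OF _ ae]) (auto simp: musielak_def)
  define b where "b k x = real_of_int \<lfloor>a x * real (Suc k)\<rfloor> / real (Suc k)" for k x
  have b0: "b k x \<ge> 0" for k x
    using a(2)[of x] by (auto simp: b_def)
  have bl: "(\<lambda>k. b k x) \<longlonglongrightarrow> a x" for x
  proof (rule real_tendsto_sandwich)
    show "eventually (\<lambda>k. a x - inverse (real (Suc k)) \<le> b k x) sequentially"
    proof (rule always_eventually, rule allI)
      fix k
      have "a x * real (Suc k) - 1 \<le> real_of_int \<lfloor>a x * real (Suc k)\<rfloor>" by linarith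
      then have "(a x * real (Suc k) - 1) / real (Suc k) \<le> b k x"
        unfolding b_def by (intro divide_right_mono) auto
      then show "a x - inverse (real (Suc k)) \<le> b k x"
        by (simp add: diff_divide_distrib inverse_eq_divide)
    qed
    show "eventually (\<lambda>k. b k x \<le> a x) sequentially"
      by (intro always_eventually allI) (simp add: b_def divide_le_eq del: of_nat_Suc)
    show "(\<lambda>k. a x - inverse (real (Suc k))) \<longlonglongrightarrow> a x"
      using tendsto_diff[OF tendsto_const LIMSEQ_inverse_real_of_nat, of "a x"] by simp
  qed simp
  have bm: "(\<lambda>x. M' x (b k x)) \<in> borel_measurable lebesgue" for k
  proof -
    \<comment> \<open>The composition rule needs measurable sections for all integers, while they
      are known only at nonnegative arguments; \<open>max 0\<close> repairs this without changing
      any value actually taken.\<close>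
    have "(\<lambda>x. M' x (real_of_int (max 0 \<lfloor>a x * real (Suc k)\<rfloor>) / real (Suc k))) \<in> borel_measurable lebesgue"
    proof (rule measurable_compose_countable[where f = "\<lambda>i x. M' x (real_of_int (max 0 i) / real (Suc k))" and g = "\<lambda>x. \<lfloor>a x * real (Suc k)\<rfloor>"])
      show "(\<lambda>x. \<lfloor>a x * real (Suc k)\<rfloor>) \<in> lebesgue \<rightarrow>\<^sub>M count_space UNIV"
        using a(1) by measurable
      show "(\<lambda>x. M' x (real_of_int (max 0 i) / real (Suc k))) \<in> borel_measurable lebesgue" for i
        by (intro m) simp
    qed
    moreover have "max 0 \<lfloor>a x * real (Suc k)\<rfloor> = \<lfloor>a x * real (Suc k)\<rfloor>" for x
      using a(2)[of x] by (auto simp: max_def not_le)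
    ultimately show ?thesis by (simp add: b_def)
  qed
  have "(\<lambda>x. M' x (a x)) \<in> borel_measurable lebesgue"
  proof (rule borel_measurable_LIMSEQ_real[OF _ bm])
    fix x
    show "(\<lambda>k. M' x (b k x)) \<longlonglongrightarrow> M' x (a x)"
    proof (cases "a x = 0")
      case True
      then have "(\<lambda>k. M' x (b k x)) \<longlonglongrightarrow> 0" using bl[of x] by (intro young_tendsto_0[OF y] b0) simp
      then show ?thesis using True y[of x] by (simp add: young_def)
    next
      case False
      then have "isCont (M' x) (a x)" using a(2)[of x] by (intro young_isCont[OF y]) simp
      then show ?thesis using bl by (rule isCont_tendsto_compose)
    qed
  qed
  moreover have "AE x in lebesgue. M' x (a x) = M x (a x)"
    using M unfolding musielak_def M'_def by auto
  ultimately show ?thesis by (rule borel_measurable_AE)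
qed

lemma modular_mono:
  assumes M: "musielak M" and "l > 0" "l' > 0" and le: "AE x in lebesgue. \<bar>u x\<bar> / l \<le> \<bar>v x\<bar> / l'"
  shows "modular M l u \<le> modular M l' v"
  unfolding modular_def
proof (rule nn_integral_mono_AE)
  have "AE x in lebesgue. young (M x)" using M by (simp add: musielak_def)
  with le show "AE x in lebesgue. ennreal (M x (\<bar>u x\<bar> / l)) \<le> ennreal (M x (\<bar>v x\<bar> / l'))"
  proof eventually_elim
    case (elim x)
    have "M x (\<bar>u x\<bar> / l) \<le> M x (\<bar>v x\<bar> / l')"
      using assms(2) elim(1) by (intro young_mono[OF elim(2)]) auto
    then show ?case by (rule ennreal_leI)
  qed
qed

lemma modular_cong_AE:
  assumes "AE x in lebesgue. u x = v x"
  shows "modular M l u = modular M l v"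
  unfolding modular_def using assms by (intro nn_integral_cong_AE) auto

text \<open>Substitute for the triangle inequality: half of \<open>\<bar>u + v\<bar>\<close> is at
  most the larger of the two moduli, so monotonicity bounds the integrand by one of the two terms.
  The price is the doubled scale.\<close>

lemma modular_add:
  fixes M :: "real ^ 'n \<Rightarrow> real \<Rightarrow> real"
  assumes M: "musielak M" and l: "l > 0"
    and m: "u \<in> borel_measurable lebesgue" "v \<in> borel_measurable lebesgue"
  shows "modular M (2 * l) (\<lambda>x. u x + v x) \<le> modular M l u + modular M l v"
proof -
  have "modular M (2 * l) (\<lambda>x. u x + v x) \<le> (\<integral>\<^sup>+ x. ennreal (M x (\<bar>u x\<bar> / l)) + ennreal (M x (\<bar>v x\<bar> / l)) \<partial>lebesgue)"
    unfolding modular_def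
  proof (rule nn_integral_mono_AE)
    have "AE x in lebesgue. young (M x)" using M by (simp add: musielak_def)
    then show "AE x in lebesgue. ennreal (M x (\<bar>u x + v x\<bar> / (2 * l))) \<le> ennreal (M x (\<bar>u x\<bar> / l)) + ennreal (M x (\<bar>v x\<bar> / l))"
    proof eventually_elim
      case (elim x)
      have "M x (\<bar>u x + v x\<bar> / (2 * l)) \<le> M x (max \<bar>u x\<bar> \<bar>v x\<bar> / l)"
        using l by (intro young_mono[OF elim]) (auto simp: field_simps)
      then have "ennreal (M x (\<bar>u x + v x\<bar> / (2 * l))) \<le> ennreal (M x (max \<bar>u x\<bar> \<bar>v x\<bar> / l))" by (rule ennreal_leI)
      also have "\<dots> \<le> ennreal (M x (\<bar>u x\<bar> / l)) + ennreal (M x (\<bar>v x\<bar> / l))"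
        by (cases "\<bar>u x\<bar> \<le> \<bar>v x\<bar>") (auto simp: max_def)
      finally show ?case .
    qed
  qed
  also have "\<dots> = modular M l u + modular M l v"
    unfolding modular_def using m l musielak_measurable[OF M, of "\<lambda>x. \<bar>u x\<bar> / l"] musielak_measurable[OF M, of "\<lambda>x. \<bar>v x\<bar> / l"]
    by (intro nn_integral_add) auto
  finally show ?thesis .
qed

text \<open>Dominated convergence with moving majorants \<open>h n\<close>. The part of the
  integrand below \<open>\<bar>h0\<bar>\<close> is handled by the ordinary theorem, the excess is at
  most \<open>\<bar>h n - h0\<bar>\<close>.\<close>

lemma modular_tendsto_0_AE:
  fixes M :: "real ^ 'n \<Rightarrow> real \<Rightarrow> real"
  assumes M: "musielak M" and l: "l > 0"
    and d: "\<And>n. d n \<in> borel_measurable lebesgue" "AE x in lebesgue. (\<lambda>n. d n x) \<longlonglongrightarrow> 0"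
    and h: "\<And>n. integrable lebesgue (h n)" "integrable lebesgue h0" "(\<lambda>n. LINT x|lebesgue. \<bar>h n x - h0 x\<bar>) \<longlonglongrightarrow> 0"
    and le: "\<And>n. AE x in lebesgue. M x (\<bar>d n x\<bar> / l) \<le> h n x"
  shows "(\<lambda>n. modular M l (d n)) \<longlonglongrightarrow> 0"
proof -
  define F where "F n x = M x (\<bar>d n x\<bar> / l)" for n x
  have y: "AE x in lebesgue. young (M x)" using M by (simp add: musielak_def)
  have Fm: "F n \<in> borel_measurable lebesgue" for n
    unfolding F_def using d(1)[of n] l by (intro musielak_measurable[OF M]) auto
  have hm: "h0 \<in> borel_measurable lebesgue" "h n \<in> borel_measurable lebesgue" for n using h by auto
  have "(\<lambda>n. \<integral>\<^sup>+x. ennreal (min (F n x) \<bar>h0 x\<bar>) \<partial>lebesgue) \<longlonglongrightarrow> (\<integral>\<^sup>+x. 0 \<partial>(lebesgue :: (real ^ 'n) measure))"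
  proof (rule nn_integral_dominated_convergence[where w = "\<lambda>x. ennreal \<bar>h0 x\<bar>"])
    show "(\<integral>\<^sup>+x. ennreal \<bar>h0 x\<bar> \<partial>lebesgue) < \<infinity>" using h(2) by (simp add: integrable_iff_bounded)
    show "AE x in lebesgue. (\<lambda>n. ennreal (min (F n x) \<bar>h0 x\<bar>)) \<longlonglongrightarrow> 0"
      using y d(2)
    proof eventually_elim
      case (elim x)
      have "(\<lambda>n. \<bar>d n x\<bar> / l) \<longlonglongrightarrow> \<bar>0\<bar> / l" using l elim(2) by (intro tendsto_intros) auto
      then have "(\<lambda>n. F n x) \<longlonglongrightarrow> 0" unfolding F_def using l by (intro young_tendsto_0[OF elim(1)]) auto
      from tendsto_min[OF this tendsto_const[of "\<bar>h0 x\<bar>"]]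
      have "(\<lambda>n. min (F n x) \<bar>h0 x\<bar>) \<longlonglongrightarrow> 0" by simp
      from tendsto_ennrealI[OF this] show ?case by simp
    qed
  qed (use Fm hm in \<open>auto intro!: ennreal_leI\<close>)
  moreover have "(\<lambda>n. \<integral>\<^sup>+x. ennreal \<bar>h n x - h0 x\<bar> \<partial>lebesgue) \<longlonglongrightarrow> 0"
  proof -
    have "(\<integral>\<^sup>+x. ennreal \<bar>h n x - h0 x\<bar> \<partial>lebesgue) = ennreal (LINT x|lebesgue. \<bar>h n x - h0 x\<bar>)" for n
      using h by (intro nn_integral_eq_integral) auto
    then show ?thesis using tendsto_ennrealI[OF h(3)] by simp
  qed
  ultimately have lim: "(\<lambda>n. (\<integral>\<^sup>+x. ennreal (min (F n x) \<bar>h0 x\<bar>) \<partial>lebesgue) + (\<integral>\<^sup>+x. ennreal \<bar>h n x - h0 x\<bar> \<partial>lebesgue)) \<longlonglongrightarrow> 0 + 0"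
    by (intro tendsto_add) simp_all
  have bound: "modular M l (d n) \<le> (\<integral>\<^sup>+x. ennreal (min (F n x) \<bar>h0 x\<bar>) \<partial>lebesgue) + (\<integral>\<^sup>+x. ennreal \<bar>h n x - h0 x\<bar> \<partial>lebesgue)" for n
  proof -
    have "modular M l (d n) \<le> (\<integral>\<^sup>+x. ennreal (min (F n x) \<bar>h0 x\<bar>) + ennreal \<bar>h n x - h0 x\<bar> \<partial>lebesgue)"
      unfolding modular_def
    proof (rule nn_integral_mono_AE)
      show "AE x in lebesgue. ennreal (M x (\<bar>d n x\<bar> / l)) \<le> ennreal (min (F n x) \<bar>h0 x\<bar>) + ennreal \<bar>h n x - h0 x\<bar>"
        using le[of n] y
      proof eventually_elim
        case (elim x)
        have F0: "F n x \<ge> 0" using l young_nonneg[OF elim(2)] by (simp add: F_def)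
        have "F n x \<le> min (F n x) \<bar>h0 x\<bar> + \<bar>h n x - h0 x\<bar>"
          using elim(1) by (auto simp: F_def min_def)
        then show ?case using F0 by (simp add: F_def[symmetric] ennreal_plus[symmetric] ennreal_leI del: ennreal_plus)
      qed
    qed
    also have "\<dots> = (\<integral>\<^sup>+x. ennreal (min (F n x) \<bar>h0 x\<bar>) \<partial>lebesgue) + (\<integral>\<^sup>+x. ennreal \<bar>h n x - h0 x\<bar> \<partial>lebesgue)"
      using Fm hm by (intro nn_integral_add) auto
    finally show ?thesis .
  qed
  show ?thesis
    by (rule tendsto_sandwich[OF _ _ tendsto_const lim[unfolded add_0_right]]) (simp_all add: bound)
qed

text \<open>By contradiction: along a subsequence the modular stays at least \<open>e\<close>, yet
  convergence in the mean provides a further subsequence converging almost everywhere. The first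
  subsequence is taken beyond \<open>N\<close>, since the bound holds only eventually.\<close>

lemma modular_tendsto_0_L1:
  fixes M :: "real ^ 'n \<Rightarrow> real \<Rightarrow> real"
  assumes M: "musielak M" and l: "l > 0"
    and d: "\<And>n. integrable lebesgue (d n)" "(\<lambda>n. LINT x|lebesgue. \<bar>d n x\<bar>) \<longlonglongrightarrow> 0"
    and h: "\<And>n. integrable lebesgue (h n)" "integrable lebesgue h0" "(\<lambda>n. LINT x|lebesgue. \<bar>h n x - h0 x\<bar>) \<longlonglongrightarrow> 0"
    and le: "eventually (\<lambda>n. AE x in lebesgue. M x (\<bar>d n x\<bar> / l) \<le> h n x) sequentially"
  shows "(\<lambda>n. modular M l (d n)) \<longlonglongrightarrow> 0"
proof (rule ccontr)
  assume "\<not> ?thesis"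
  then obtain e where e: "e > 0" "\<not> eventually (\<lambda>n. modular M l (d n) < e) sequentially"
    by (auto simp: order_tendsto_iff)
  obtain N where N: "\<And>n. n \<ge> N \<Longrightarrow> AE x in lebesgue. M x (\<bar>d n x\<bar> / l) \<le> h n x"
    using le by (auto simp: eventually_sequentially)
  have "infinite {n. n \<ge> N \<and> \<not> modular M l (d n) < e}"
    unfolding infinite_nat_iff_unbounded_le
  proof
    fix k
    obtain n where "n \<ge> max k N" "\<not> modular M l (d n) < e"
      using e(2) unfolding eventually_sequentially by blast
    then show "\<exists>n\<ge>k. n \<in> {n. n \<ge> N \<and> \<not> modular M l (d n) < e}" by auto
  qed
  from infinite_enumerate[OF this] obtain r :: "nat \<Rightarrow> nat" where r: "strict_mono r" "\<And>n. r n \<ge> N" "\<And>n. \<not> modular M l (d (r n)) < e" by auto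
  have "(\<lambda>n. LINT x|lebesgue. norm (d (r n) x)) \<longlonglongrightarrow> 0"
    using LIMSEQ_subseq_LIMSEQ[OF d(2) r(1)] by (simp add: o_def)
  from tendsto_L1_AE_subseq[OF d(1) this]
  obtain s :: "nat \<Rightarrow> nat" where s: "strict_mono s" "AE x in lebesgue. (\<lambda>n. d (r (s n)) x) \<longlonglongrightarrow> 0" by auto
  have "(\<lambda>n. LINT x|lebesgue. \<bar>h (r (s n)) x - h0 x\<bar>) \<longlonglongrightarrow> 0"
    using LIMSEQ_subseq_LIMSEQ[OF LIMSEQ_subseq_LIMSEQ[OF h(3) r(1)] s(1)] by (simp add: o_def)
  then have "(\<lambda>n. modular M l (d (r (s n)))) \<longlonglongrightarrow> 0"
    using d(1) h N r(2) by (intro modular_tendsto_0_AE[OF M l _ s(2), where h = "\<lambda>n. h (r (s n))" and ?h0.0 = h0]) auto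
  then have "eventually (\<lambda>n. modular M l (d (r (s n))) < e) sequentially"
    using e(1) by (rule order_tendstoD)
  then show False using r(3) by (auto simp: eventually_sequentially)
qed

lemma modular_finite_integrable:
  fixes M :: "real ^ 'n \<Rightarrow> real \<Rightarrow> real"
  assumes M: "musielak M" and l: "l > 0" and w: "w \<in> borel_measurable lebesgue" and fin: "modular M l w < \<infinity>"
  shows "integrable lebesgue (\<lambda>x. M x (\<bar>w x\<bar> / l))"
proof (rule integrableI_nonneg)
  show "(\<lambda>x. M x (\<bar>w x\<bar> / l)) \<in> borel_measurable lebesgue"
    using w l by (intro musielak_measurable[OF M]) auto
  have "AE x in lebesgue. young (M x)" using M by (simp add: musielak_def)
  then show "AE x in lebesgue. 0 \<le> M x (\<bar>w x\<bar> / l)"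
  proof eventually_elim
    case (elim x)
    then show ?case using l young_nonneg[OF elim, of "\<bar>w x\<bar> / l"] by simp
  qed
qed (use fin in \<open>simp add: modular_def\<close>)

lemma conv_nonneg_AE:
  fixes f :: "real ^ 'n \<Rightarrow> real"
  assumes "AE x in lebesgue. 0 \<le> f x" "e > 0"
  shows "0 \<le> conv f (mollifier e) x"
  unfolding conv_def
  by (intro integral_nonneg_AE, use assms(1) in eventually_elim) (auto simp: mollifier_nonneg[OF assms(2)])

text \<open>The supporting line of \<open>M x\<close> at \<open>t\<close> is integrated against
  \<open>y \<mapsto> \<rho> (x - y)\<close>. This density has mass one and gives \<open>a\<close>
  the mean \<open>t\<close>, so the integral is exactly \<open>M x t\<close>; under the integral the
  line is replaced by \<open>2 * C * M y (a y)\<close>. For \<open>t = 0\<close>, where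
  \<open>young_subgradient\<close> does not apply, the left-hand side is 0.\<close>

lemma young_conv_le:
  fixes M :: "real ^ 'n \<Rightarrow> real \<Rightarrow> real"
  assumes M: "musielak M" and e: "e > 0" and C: "C \<ge> 0" and x: "young (M x)"
    and a: "integrable lebesgue a" "\<And>y. 0 \<le> a y" and g: "integrable lebesgue (\<lambda>y. M y (a y))"
    and s: "conv a (mollifier e) x \<le> s"
    and le: "\<And>y r. norm (x - y) < e \<Longrightarrow> young (M y) \<Longrightarrow> 0 \<le> r \<Longrightarrow> r \<le> 2 * s \<Longrightarrow> M x r \<le> C * M y r"
  shows "M x (conv a (mollifier e) x) \<le> 2 * C * conv (\<lambda>y. M y (a y)) (mollifier e) x"
proof -
  define t where "t = conv a (mollifier e) x"
  let ?\<rho> = "\<lambda>y. mollifier e (x - y)"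
  have \<rho>: "mollifier e \<in> (test_functions :: (real ^ 'n \<Rightarrow> real) set)" by (rule mollifier_test[OF e])
  have y: "AE y in lebesgue. young (M y)" using M by (simp add: musielak_def)
  have t0: "t \<ge> 0" unfolding t_def using a(2) by (intro conv_nonneg_AE e) auto
  have "AE y in lebesgue. 0 \<le> M y (a y)" using y by eventually_elim (rule young_nonneg[OF _ a(2)])
  then have g0: "conv (\<lambda>y. M y (a y)) (mollifier e) x \<ge> 0" by (intro conv_nonneg_AE e)
  show ?thesis
  proof (cases "t = 0")
    case True
    then show ?thesis using g0 C x by (simp add: t_def[symmetric] young_def)
  next
    case False
    then have t: "t > 0" using t0 by simp
    obtain \<kappa> where k: "\<kappa> \<ge> 0" "\<And>r. r \<ge> 0 \<Longrightarrow> M x t + \<kappa> * (r - t) \<le> M x r"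
      using young_subgradient[OF x t] by metis
    have i1: "integrable lebesgue ?\<rho>" by (intro test_integrable test_reflect \<rho>)
    have i2: "integrable lebesgue (\<lambda>y. a y * ?\<rho> y)" by (intro conv_integrable a \<rho>)
    have i3: "integrable lebesgue (\<lambda>y. M y (a y) * ?\<rho> y)" by (intro conv_integrable g \<rho>)
    have eq: "(M x t + \<kappa> * (a y - t)) * ?\<rho> y = (M x t - \<kappa> * t) * ?\<rho> y + \<kappa> * (a y * ?\<rho> y)" for y
      by (simp add: algebra_simps)
    have "M x t = (M x t - \<kappa> * t) * 1 + \<kappa> * t" by simp
    also have "\<dots> = (M x t - \<kappa> * t) * (LINT y|lebesgue. ?\<rho> y) + \<kappa> * (LINT y|lebesgue. a y * ?\<rho> y)"
      using integral_mollifier_reflect[OF e, of x] by (simp add: t_def conv_def)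
    also have "\<dots> = (LINT y|lebesgue. (M x t + \<kappa> * (a y - t)) * ?\<rho> y)"
      unfolding eq using i1 i2 by simp
    also have "\<dots> \<le> (LINT y|lebesgue. 2 * C * (M y (a y) * ?\<rho> y))"
    proof (rule integral_mono_AE)
      show "integrable lebesgue (\<lambda>y. (M x t + \<kappa> * (a y - t)) * ?\<rho> y)" unfolding eq using i1 i2 by simp
      show "integrable lebesgue (\<lambda>y. 2 * C * (M y (a y) * ?\<rho> y))" using i3 by simp
      show "AE y in lebesgue. (M x t + \<kappa> * (a y - t)) * ?\<rho> y \<le> 2 * C * (M y (a y) * ?\<rho> y)"
        using y
      proof eventually_elim
        case (elim y)
        show ?case
        proof (cases "?\<rho> y = 0")
          case False
          then have "norm (x - y) < e" by (intro mollifier_support[OF e])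
          then have "M x t + \<kappa> * (a y - t) \<le> 2 * C * M y (a y)"
            using s le elim by (intro supporting_line_le[OF x elim t _ C _ k a(2), where s = s]) (auto simp: t_def)
          from mult_right_mono[OF this mollifier_nonneg[OF e, of "x - y"]]
          show ?thesis by (simp add: mult.assoc)
        qed simp
      qed
    qed
    also have "\<dots> = 2 * C * conv (\<lambda>y. M y (a y)) (mollifier e) x" by (simp add: conv_def)
    finally show ?thesis by (simp add: t_def)
  qed
qed

text \<open>Monotonicity in each variable replaces \<open>\<phi> (norm (x - y)) r\<close> by its
  value at the corner \<open>(e, c * e powr (- q))\<close>, where the limsup condition gives a bound
  for small \<open>e\<close>. The minimum with 1/2 stays in the domain of \<open>\<phi>\<close>, and
  \<open>max 0 C\<close> makes the constant nonnegative.\<close>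

lemma cond_M2_exponent_bound:
  fixes M :: "real ^ 'n \<Rightarrow> real \<Rightarrow> real"
  assumes "cond_M2_exponent q M" "c > 0"
  obtains C d where "C \<ge> 0" "d > 0"
    "\<And>e x y r. 0 < e \<Longrightarrow> e < d \<Longrightarrow> norm (x - y) < e \<Longrightarrow> young (M y) \<Longrightarrow> 0 \<le> r \<Longrightarrow> r \<le> c * e powr (- q) \<Longrightarrow> M x r \<le> C * M y r"
proof -
  obtain \<phi> :: "real \<Rightarrow> real \<Rightarrow> real" where
     m1: "\<forall>s\<ge>0. mono_on {0..1/2} (\<lambda>t. \<phi> t s)"
    and m2: "\<forall>t\<in>{0..1/2}. mono_on {0..} (\<phi> t)"
    and M2: "\<forall>x y. norm (x - y) \<le> 1/2 \<longrightarrow> (\<forall>s\<ge>0. M x s \<le> \<phi> (norm (x - y)) s * M y s)"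
    and lim: "\<forall>c>0. Limsup (at_right 0) (\<lambda>e. ereal (\<phi> e (c * e powr (- q)))) < \<infinity>"
    using assms(1) unfolding cond_M2_exponent_def by (elim exE conjE) (rule that)
  have "Limsup (at_right 0) (\<lambda>e. ereal (\<phi> e (c * e powr (- q)))) \<noteq> \<infinity>"
    using lim[rule_format, OF assms(2)] by (rule less_imp_neq)
  then obtain C :: real where C: "Limsup (at_right 0) (\<lambda>e. ereal (\<phi> e (c * e powr (- q)))) < ereal C"
    unfolding less_PInf_Ex_of_nat by (elim exE) (rule that)
  have "eventually (\<lambda>e. \<phi> e (c * e powr (- q)) < C) (at_right 0)"
    using Limsup_lessD[OF C] by simp
  then obtain d where d: "d > 0" "\<forall>e>0. e < d \<longrightarrow> \<phi> e (c * e powr (- q)) < C"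
    unfolding eventually_at_right_field by (elim exE conjE) (rule that)
  have "M x r \<le> max 0 C * M y r"
    if e: "0 < e" "e < min d (1 / 2)" "norm (x - y) < e" and y: "young (M y)" and r: "0 \<le> r" "r \<le> c * e powr (- q)" for e x y r
  proof -
    have "\<phi> (norm (x - y)) r \<le> \<phi> e r"
      using mono_onD[OF m1[rule_format, OF r(1)], of "norm (x - y)" e] e by simp
    also have "\<phi> e r \<le> \<phi> e (c * e powr (- q))"
      using mono_onD[OF m2[rule_format, of e], of r "c * e powr (- q)"] e r assms(2) by simp
    also have "\<dots> \<le> max 0 C" using d(2)[rule_format, of e] e by simp
    finally have f: "\<phi> (norm (x - y)) r \<le> max 0 C" .
    have "M x r \<le> \<phi> (norm (x - y)) r * M y r" using M2[rule_format, of x y r] e r by simp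
    also have "\<dots> \<le> max 0 C * M y r" by (intro mult_right_mono f young_nonneg[OF y] r)
    finally show ?thesis .
  qed
  then show ?thesis using d(1) by (intro that[of "max 0 C" "min d (1 / 2)"]) simp_all
qed

text \<open>The Jensen bound provides the majorants: \<open>2 * C\<close> times the mollification of
  \<open>g\<close>, plus \<open>g\<close> for the subtracted \<open>w\<close>. They converge in the
  mean because \<open>g\<close> itself is integrable.\<close>

lemma modular_mollifier_tendsto_0:
  fixes M :: "real ^ 'n \<Rightarrow> real \<Rightarrow> real"
  assumes M: "musielak M" and M2: "cond_M2_exponent q M"
    and w: "integrable lebesgue w" and l: "l > 0" and fin: "modular M l w < \<infinity>"
    and bnd: "c > 0" "\<And>e x. e > 0 \<Longrightarrow> conv (\<lambda>y. \<bar>w y\<bar> / l) (mollifier e) x \<le> c * e powr (- q)"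
    and e: "\<And>n. e n > 0" "e \<longlonglongrightarrow> 0"
  shows "(\<lambda>n. modular M (2 * l) (\<lambda>x. conv w (mollifier (e n)) x - w x)) \<longlonglongrightarrow> 0"
proof -
  define a where "a y = \<bar>w y\<bar> / l" for y
  define g where "g y = M y (a y)" for y
  have a: "integrable lebesgue a" "\<And>y. 0 \<le> a y" using w l by (auto simp: a_def[abs_def])
  have g: "integrable lebesgue g"
    unfolding g_def a_def using w by (intro modular_finite_integrable M l fin) auto
  have y: "AE y in lebesgue. young (M y)" using M by (simp add: musielak_def)
  \<comment> \<open>The comparison is required up to \<open>2 * s\<close> with
    \<open>s = c * e powr (- q)\<close>, hence \<open>2 * c\<close>.\<close>
  obtain C d where C: "C \<ge> 0" "d > 0"
    "\<And>e x y r. 0 < e \<Longrightarrow> e < d \<Longrightarrow> norm (x - y) < e \<Longrightarrow> young (M y) \<Longrightarrow> 0 \<le> r \<Longrightarrow> r \<le> (2 * c) * e powr (- q) \<Longrightarrow> M x r \<le> C * M y r"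
    using cond_M2_exponent_bound[OF M2, of "2 * c"] bnd(1) by (metis mult_pos_pos zero_less_numeral)
  have ev: "eventually (\<lambda>n. e n < d) sequentially" using e(2) C(2) by (rule order_tendstoD)
  show ?thesis
  proof (rule modular_tendsto_0_L1[OF M, where h = "\<lambda>n x. 2 * C * conv g (mollifier (e n)) x + g x" and ?h0.0 = "\<lambda>x. 2 * C * g x + g x"])
    show "2 * l > 0" using l by simp
    show "integrable lebesgue (\<lambda>x. conv w (mollifier (e n)) x - w x)" for n
      using w integrable_conv_mollifier[OF w e(1)] by auto
    show "(\<lambda>n. LINT x|lebesgue. \<bar>conv w (mollifier (e n)) x - w x\<bar>) \<longlonglongrightarrow> 0"
      by (rule conv_mollifier_L1_tendsto[OF w e])
    show "integrable lebesgue (\<lambda>x. 2 * C * conv g (mollifier (e n)) x + g x)" for n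
      using g integrable_conv_mollifier[OF g e(1)] by auto
    show "integrable lebesgue (\<lambda>x. 2 * C * g x + g x)" using g by auto
    have "\<bar>2 * C * conv g (mollifier (e n)) x + g x - (2 * C * g x + g x)\<bar> = 2 * C * \<bar>conv g (mollifier (e n)) x - g x\<bar>" for n x
      using C(1) by (simp add: abs_mult right_diff_distrib[symmetric])
    then show "(\<lambda>n. LINT x|lebesgue. \<bar>2 * C * conv g (mollifier (e n)) x + g x - (2 * C * g x + g x)\<bar>) \<longlonglongrightarrow> 0"
      using tendsto_mult_left[OF conv_mollifier_L1_tendsto[OF g e], of "2 * C"] by simp
    show "eventually (\<lambda>n. AE x in lebesgue. M x (\<bar>conv w (mollifier (e n)) x - w x\<bar> / (2 * l)) \<le> 2 * C * conv g (mollifier (e n)) x + g x) sequentially"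
      using ev
    proof eventually_elim
      case (elim n)
      let ?\<rho> = "mollifier (e n) :: real ^ 'n \<Rightarrow> real"
      have \<rho>: "?\<rho> \<in> test_functions" by (rule mollifier_test[OF e(1)])
      show ?case using y
      proof eventually_elim
        case x: (elim x)
        have "M x (conv a ?\<rho> x) \<le> 2 * C * conv (\<lambda>y. M y (a y)) ?\<rho> x"
        proof (rule young_conv_le[OF M e(1) C(1) x a])
          show "integrable lebesgue (\<lambda>y. M y (a y))" using g by (simp add: g_def[abs_def])
          show "conv a ?\<rho> x \<le> c * e n powr (- q)" using bnd(2)[OF e(1)] by (simp add: a_def[abs_def])
          show "M x r \<le> C * M y r" if "norm (x - y) < e n" "young (M y)" "0 \<le> r" "r \<le> 2 * (c * e n powr (- q))" for y r
            using that elim e(1)[of n] by (intro C(3)[of "e n"]) auto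
        qed
        then have t: "M x (conv a ?\<rho> x) \<le> 2 * C * conv g ?\<rho> x" by (simp add: g_def[abs_def])
        have "\<bar>conv w ?\<rho> x\<bar> \<le> (LINT y|lebesgue. \<bar>w y * ?\<rho> (x - y)\<bar>)"
          unfolding conv_def by (rule integral_abs_bound)
        also have "\<dots> = l * conv a ?\<rho> x"
          using l by (simp add: conv_def a_def abs_mult mollifier_nonneg[OF e(1)])
        finally have cw: "\<bar>conv w ?\<rho> x\<bar> / l \<le> conv a ?\<rho> x" using l by (simp add: divide_le_eq mult.commute)
        have c0: "0 \<le> conv a ?\<rho> x" using a(2) by (intro conv_nonneg_AE e) auto
        \<comment> \<open>At scale \<open>2 * l\<close> the difference is bounded by the mean of two
          quantities controlled at scale \<open>l\<close>, and so by their maximum.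
          \<open>M x\<close> of a maximum is at most the sum of the two values.\<close>
        have "\<bar>conv w ?\<rho> x - w x\<bar> / (2 * l) \<le> (\<bar>conv w ?\<rho> x\<bar> / l + \<bar>w x\<bar> / l) / 2"
          using l by (simp add: field_simps)
        also have "\<dots> \<le> max (conv a ?\<rho> x) (a x)"
        proof -
          have "(p + q) / 2 \<le> max r q" if "p \<le> r" for p q r :: real using that by (auto simp: max_def)
          from this[OF cw, of "a x"] show ?thesis by (simp add: a_def)
        qed
        finally have "M x (\<bar>conv w ?\<rho> x - w x\<bar> / (2 * l)) \<le> M x (max (conv a ?\<rho> x) (a x))"
          using l by (intro young_mono[OF x]) auto
        also have "\<dots> \<le> M x (conv a ?\<rho> x) + M x (a x)"
          using young_nonneg[OF x c0] young_nonneg[OF x a(2)[of x]] by (auto simp: max_def)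
        finally show ?case using t by (simp add: g_def)
      qed
    qed
  qed
qed

text \<open>Supremum of the kernel times the integral of \<open>a\<close>; the added 1 keeps the
  constant positive when \<open>a\<close> vanishes almost everywhere.\<close>

lemma conv_mollifier_bound_L1:
  fixes a :: "real ^ 'n \<Rightarrow> real"
  assumes a: "integrable lebesgue a" "\<And>y. 0 \<le> a y"
  obtains c where "c > 0" "\<And>e x. e > 0 \<Longrightarrow> conv a (mollifier e) x \<le> c * e powr (- real CARD('n))"
proof -
  obtain K where K: "K > 0" "\<And>e x. e > 0 \<Longrightarrow> mollifier e (x :: real ^ 'n) \<le> K / e ^ CARD('n)"
    using mollifier_bound by metis
  have a0: "(LINT y|lebesgue. a y) \<ge> 0" using a(2) by (intro integral_nonneg_AE) auto
  have "conv a (mollifier e) x \<le> (K * (LINT y|lebesgue. a y) + 1) * e powr (- real CARD('n))" if e: "e > 0" for e x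
  proof -
    have "conv a (mollifier e) x \<le> (LINT y|lebesgue. a y * (K / e ^ CARD('n)))"
      unfolding conv_def
      by (intro integral_mono conv_integrable mollifier_test e a mult_left_mono K integrable_mult_left)
    also have "\<dots> = (K * (LINT y|lebesgue. a y)) * e powr (- real CARD('n))"
      using e by (simp add: powr_minus powr_realpow divide_inverse mult.commute mult.left_commute)
    also have "\<dots> \<le> (K * (LINT y|lebesgue. a y) + 1) * e powr (- real CARD('n))"
      by (intro mult_right_mono) auto
    finally show ?thesis .
  qed
  moreover have "K * (LINT y|lebesgue. a y) + 1 > 0" using K(1) a0 by (simp add: add_nonneg_pos)
  ultimately show ?thesis using that by blast
qed

text \<open>Instead of Hoelder's inequality: \<open>a \<le> \<tau> + \<tau>\<^sup>1\<^sup>-\<^sup>p a\<^sup>p\<close> with \<open>\<tau> = e\<^sup>-\<^sup>N\<^sup>/\<^sup>p\<close>.\<close>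

lemma conv_mollifier_bound_Lp:
  fixes a :: "real ^ 'n \<Rightarrow> real"
  assumes p: "p > 1" and a: "integrable lebesgue a" "\<And>y. 0 \<le> a y" and ap: "integrable lebesgue (\<lambda>y. a y powr p)"
  obtains c where "c > 0" "\<And>e x. e > 0 \<Longrightarrow> conv a (mollifier e) x \<le> c * e powr (- (real CARD('n) / p))"
proof -
  obtain c where c: "c > 0" "\<And>e x. e > 0 \<Longrightarrow> conv (\<lambda>y. a y powr p) (mollifier e) x \<le> c * e powr (- real CARD('n))"
    using conv_mollifier_bound_L1[OF ap] by (metis powr_ge_zero)
  have "conv a (mollifier e) x \<le> (1 + c) * e powr (- (real CARD('n) / p))" if e: "e > 0" for e x
  proof -
    define \<tau> where "\<tau> = e powr (- (real CARD('n) / p))"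
    have \<tau>: "\<tau> > 0" using e by (simp add: \<tau>_def)
    have le: "a y \<le> \<tau> + \<tau> powr (1 - p) * a y powr p" for y
    proof (cases "a y \<le> \<tau>")
      case False
      then have ay: "a y > 0" using \<tau> by simp
      have "1 \<le> (a y / \<tau>) powr (p - 1)" using False \<tau> p ay by (intro ge_one_powr_ge_zero) auto
      then have "a y * 1 \<le> a y * (a y / \<tau>) powr (p - 1)" using ay by (intro mult_left_mono) auto
      also have "(a y / \<tau>) powr (p - 1) = a y powr (p - 1) * \<tau> powr (1 - p)"
        using ay \<tau> by (simp add: powr_divide powr_diff field_simps)
      also have "a y * (a y powr (p - 1) * \<tau> powr (1 - p)) = \<tau> powr (1 - p) * a y powr p"
        using ay by (simp add: powr_diff field_simps)
      finally show ?thesis using \<tau> by simp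
    qed (simp add: add_increasing2)
    let ?\<rho> = "\<lambda>y. mollifier e (x - y)"
    have \<rho>: "mollifier e \<in> (test_functions :: (real ^ 'n \<Rightarrow> real) set)" by (rule mollifier_test[OF e])
    have i1: "integrable lebesgue ?\<rho>" by (intro test_integrable test_reflect \<rho>)
    have i2: "integrable lebesgue (\<lambda>y. a y powr p * ?\<rho> y)" by (intro conv_integrable ap \<rho>)
    have "conv a (mollifier e) x \<le> (LINT y|lebesgue. \<tau> * ?\<rho> y + \<tau> powr (1 - p) * (a y powr p * ?\<rho> y))"
      unfolding conv_def
    proof (rule integral_mono)
      show "integrable lebesgue (\<lambda>y. a y * ?\<rho> y)" by (intro conv_integrable a \<rho>)
      show "integrable lebesgue (\<lambda>y. \<tau> * ?\<rho> y + \<tau> powr (1 - p) * (a y powr p * ?\<rho> y))" using i1 i2 by auto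
      show "a y * ?\<rho> y \<le> \<tau> * ?\<rho> y + \<tau> powr (1 - p) * (a y powr p * ?\<rho> y)" for y
        using mult_right_mono[OF le mollifier_nonneg[OF e, of "x - y"], of y] by (simp add: algebra_simps)
    qed
    also have "\<dots> = \<tau> + \<tau> powr (1 - p) * conv (\<lambda>y. a y powr p) (mollifier e) x"
      using i1 i2 integral_mollifier_reflect[OF e, of x] by (simp add: conv_def)
    also have "\<dots> \<le> \<tau> + \<tau> powr (1 - p) * (c * e powr (- real CARD('n)))"
      by (intro add_left_mono mult_left_mono c e) auto
    also have "\<tau> powr (1 - p) * (c * e powr (- real CARD('n))) = c * \<tau>"
    proof -
      \<comment> \<open>This \<open>\<tau>\<close> balances the two contributions: the exponents add
        up so that the second one is again a multiple of \<open>\<tau>\<close>.\<close>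
      have "\<tau> powr (1 - p) * e powr (- real CARD('n)) = e powr (- (real CARD('n) / p) * (1 - p) + - real CARD('n))"
        unfolding \<tau>_def powr_powr powr_add ..
      also have "- (real CARD('n) / p) * (1 - p) + - real CARD('n) = - (real CARD('n) / p)"
        using p by (simp add: field_simps)
      finally show ?thesis by (simp add: \<tau>_def)
    qed
    finally show ?thesis by (simp add: \<tau>_def distrib_right)
  qed
  then show ?thesis using that[of "1 + c"] c(1) by auto
qed

text \<open>The two alternatives differ only in the exponent \<open>q\<close>. Under
  \<open>cond_G\<close> the integrable function \<open>M x (\<bar>w x\<bar> / l)\<close> dominates a
  multiple of the p-th power, which lowers the growth of the mollification from N to N/p.\<close>

lemma modular_mollifier:
  fixes M :: "real ^ 'n \<Rightarrow> real \<Rightarrow> real"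
  assumes M: "musielak M" and cond: "cond_M2 M \<or> (\<exists>p>1. cond_G p M \<and> cond_M2p p M)"
    and w: "integrable lebesgue w" and l: "l > 0" and fin: "modular M l w < \<infinity>"
    and e: "\<And>n. e n > 0" "e \<longlonglongrightarrow> 0"
  shows "(\<lambda>n. modular M (2 * l) (\<lambda>x. conv w (mollifier (e n)) x - w x)) \<longlonglongrightarrow> 0"
  using cond
proof
  have a: "integrable lebesgue (\<lambda>y. \<bar>w y\<bar> / l)" "\<And>y. 0 \<le> \<bar>w y\<bar> / l" using w l by auto
  {
    assume "cond_M2 M"
    then have "cond_M2_exponent (real CARD('n)) M" by (simp add: cond_M2_def)
    moreover obtain c where "c > 0" "\<And>e x. e > 0 \<Longrightarrow> conv (\<lambda>y. \<bar>w y\<bar> / l) (mollifier e) x \<le> c * e powr (- real CARD('n))"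
      using conv_mollifier_bound_L1[OF a] by metis
    ultimately show ?thesis using modular_mollifier_tendsto_0[OF M _ w l fin _ _ e] by blast
  next
    assume "\<exists>p>1. cond_G p M \<and> cond_M2p p M"
    then obtain p where p: "p > 1" "cond_G p M" "cond_M2_exponent (real CARD('n) / p) M"
      by (auto simp: cond_M2p_def)
    from p(2) obtain c where c: "c > 0" "AE x in lebesgue. \<forall>s\<ge>0. c * s powr p \<le> M x s" by (auto simp: cond_G_def)
    have g: "integrable lebesgue (\<lambda>x. M x (\<bar>w x\<bar> / l))"
      using w by (intro modular_finite_integrable M l fin) auto
    have "integrable lebesgue (\<lambda>x. (\<bar>w x\<bar> / l) powr p)"
    proof (rule Bochner_Integration.integrable_bound)
      show "integrable lebesgue (\<lambda>x. M x (\<bar>w x\<bar> / l) / c)" using g by simp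
      show "(\<lambda>x. (\<bar>w x\<bar> / l) powr p) \<in> borel_measurable lebesgue" using w by measurable
      show "AE x in lebesgue. norm ((\<bar>w x\<bar> / l) powr p) \<le> norm (M x (\<bar>w x\<bar> / l) / c)"
        using c(2)
      proof eventually_elim
        case (elim x)
        then have "c * (\<bar>w x\<bar> / l) powr p \<le> M x (\<bar>w x\<bar> / l)" using l by simp
        then have "(\<bar>w x\<bar> / l) powr p \<le> M x (\<bar>w x\<bar> / l) / c" using c(1) by (simp add: le_divide_eq mult.commute)
        also have "\<dots> \<le> \<bar>M x (\<bar>w x\<bar> / l) / c\<bar>" by (rule abs_ge_self)
        finally show ?case by simp
      qed
    qed
    then obtain c where "c > 0" "\<And>e x. e > 0 \<Longrightarrow> conv (\<lambda>y. \<bar>w y\<bar> / l) (mollifier e) x \<le> c * e powr (- (real CARD('n) / p))"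
      using conv_mollifier_bound_Lp[OF p(1) a] by metis
    then show ?thesis using modular_mollifier_tendsto_0[OF M p(3) w l fin _ _ e] by blast
  }
qed

section \<open>Truncation and density\<close>

lemma integrable_sum_list:
  assumes "\<And>c bs gs. (c, bs, gs) \<in> set K \<Longrightarrow> integrable lebesgue (F c bs gs)"
  shows "integrable lebesgue (\<lambda>x. \<Sum>(c, bs, gs) \<leftarrow> K. (F c bs gs x :: real))"
  using assms by (induction K) auto

text \<open>Normalised to 1 at the origin. It need not equal 1 on any ball; pointwise convergence to
  1 with a uniform bound is what dominated convergence uses.\<close>

definition cutoff :: "nat \<Rightarrow> real ^ 'n \<Rightarrow> real" where
  "cutoff k x = bump ((1 / real (Suc k)) *\<^sub>R x) / bump (0 :: real ^ 'n)"

lemma cutoff_affine: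
  "cutoff k = (\<lambda>x :: real ^ 'n. (1 / bump (0 :: real ^ 'n)) * bump (0 + (1 / real (Suc k)) *\<^sub>R x))"
  by (simp add: cutoff_def fun_eq_iff)

lemma cutoff_test: "cutoff k \<in> (test_functions :: (real ^ 'n \<Rightarrow> real) set)"
  unfolding cutoff_affine by (intro test_mult' test_affine bump_test smooth_const) auto

lemma iter_partial_cutoff:
  "iter_partial gs (cutoff k) = (\<lambda>x :: real ^ 'n. (1 / real (Suc k)) ^ length gs *
     (iter_partial gs bump ((1 / real (Suc k)) *\<^sub>R x) / bump (0 :: real ^ 'n)))"
  unfolding cutoff_affine
  by (subst iter_partial_cmult[OF smooth_affine[OF smooth_bump]], subst iter_partial_affine[OF smooth_bump])
     (simp add: fun_eq_iff)

lemma iter_partial_cutoff_bound: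
  obtains B where "B > 0" "\<And>k x. \<bar>iter_partial gs (cutoff k) (x :: real ^ 'n)\<bar> \<le> (1 / real (Suc k)) ^ length gs * B"
proof -
  obtain B where B: "B > 0" "\<And>x :: real ^ 'n. \<bar>iter_partial gs bump x\<bar> \<le> B"
    by (meson test_bounded[OF test_iter_partial[OF bump_test]])
  have "\<bar>iter_partial gs (cutoff k) (x :: real ^ 'n)\<bar> \<le> (1 / real (Suc k)) ^ length gs * (B / bump (0 :: real ^ 'n))" for k x
    unfolding iter_partial_cutoff abs_mult
    using B(2) bump_0[where 'n = 'n] by (intro mult_mono) (auto intro: divide_right_mono)
  then show ?thesis using that[of "B / bump (0 :: real ^ 'n)"] B(1) bump_0[where 'n = 'n] by auto
qed

lemma cutoff_tendsto_1:
  fixes x :: "real ^ 'n"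
  shows "(\<lambda>k. cutoff k x) \<longlonglongrightarrow> 1"
proof -
  from tendsto_divide[OF bump_rescale_tendsto[of x] tendsto_const, of "bump (0 :: real ^ 'n)"]
  show ?thesis using bump_0[where 'n = 'n] by (simp add: cutoff_def)
qed

text \<open>In every correction term the cut-off is differentiated at least once, which contributes
  a factor \<open>1 / real (Suc k)\<close>; these terms vanish in the limit. The constant
  \<open>A\<close> does not depend on \<open>k\<close>, because the Leibniz list is chosen before
  the cut-off.\<close>

lemma truncation:
  fixes u :: "real ^ 'n \<Rightarrow> real"
  assumes V: "\<And>\<beta>. mi_order \<beta> \<le> m \<Longrightarrow> has_distr_deriv \<beta> u (V \<beta>)" and \<alpha>: "mi_order \<alpha> \<le> m"
  shows "\<exists>w A. (\<forall>k. has_distr_deriv \<alpha> (\<lambda>x. u x * cutoff k x) (w k)) \<and> (\<forall>k. integrable lebesgue (w k)) \<and>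
    A > 0 \<and> (\<forall>k x. \<bar>w k x\<bar> \<le> A * (\<Sum>\<beta> | mi_order \<beta> \<le> m. \<bar>V \<beta> x\<bar>)) \<and> (\<forall>x. (\<lambda>k. w k x) \<longlonglongrightarrow> V \<alpha> x)"
proof -
  let ?S = "\<lambda>x. \<Sum>\<beta> | mi_order \<beta> \<le> m. \<bar>V \<beta> x\<bar>"
  have VS: "\<bar>V \<beta> x\<bar> \<le> ?S x" if "mi_order \<beta> \<le> m" for \<beta> x
    using that finite_mi_order_le by (intro member_le_sum[of \<beta>]) auto
  have S0: "?S x \<ge> 0" for x by (intro sum_nonneg) auto
  obtain L where L: "\<forall>(c, bs, gs) \<in> set L. length bs \<le> length (index_list \<alpha>) \<and> gs \<noteq> []"
    "\<And>\<theta> \<psi> x. smooth \<theta> \<Longrightarrow> smooth \<psi> \<Longrightarrow> \<theta> x * iter_partial (index_list \<alpha>) \<psi> x = iter_partial (index_list \<alpha>) (\<lambda>x. \<theta> x * \<psi> x) x +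
        (\<Sum>(c, bs, gs) \<leftarrow> L. c * iter_partial bs (\<lambda>x. \<psi> x * iter_partial gs \<theta> x) x)"
    using iter_partial_leibniz[of "index_list \<alpha>"] by blast
  define T where "T K k x = (\<Sum>(c, bs, gs) \<leftarrow> K. (- 1) ^ (length bs + mi_order \<alpha>) * c * (V (count_list bs) x * iter_partial gs (cutoff k) x))"
    for K :: "(real \<times> 'n list \<times> 'n list) list" and k x
  define w where "w k x = V \<alpha> x * cutoff k x + T L k x" for k x
  have Lm: "length bs \<le> mi_order \<alpha>" "gs \<noteq> []" "mi_order (count_list bs) \<le> m" if "(c, bs, gs) \<in> set L" for c bs gs
    using L(1) that \<alpha> by (auto simp: length_index_list mi_order_count_list)
  have "has_distr_deriv \<alpha> (\<lambda>x. u x * cutoff k x) (w k)" for k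
    unfolding w_def[abs_def] T_def
  proof (rule has_distr_deriv_mult)
    show "has_distr_deriv \<beta> u (V \<beta>)" if "mi_order \<beta> \<le> mi_order \<alpha>" for \<beta>
      using that \<alpha> by (intro V) simp
    show "smooth (cutoff k)" by (intro test_smooth cutoff_test)
    show "\<forall>(c, bs, gs) \<in> set L. length bs \<le> mi_order \<alpha>" using Lm by auto
    show "cutoff k x * iter_partial (index_list \<alpha>) \<psi> x = iter_partial (index_list \<alpha>) (\<lambda>x. cutoff k x * \<psi> x) x +
        (\<Sum>(c, bs, gs) \<leftarrow> L. c * iter_partial bs (\<lambda>x. \<psi> x * iter_partial gs (cutoff k) x) x)" if "smooth \<psi>" for \<psi> x
      by (intro L(2) that test_smooth cutoff_test)
  qed
  moreover have "integrable lebesgue (w k)" for k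
  proof -
    have l: "locally_integrable (V \<beta>)" if "mi_order \<beta> \<le> m" for \<beta>
      using V[OF that] by (simp add: has_distr_deriv_def)
    have "integrable lebesgue (T L k)"
      unfolding T_def[abs_def]
      by (intro integrable_sum_list integrable_mult_right integrable_mult_test l test_iter_partial cutoff_test Lm)
    moreover have "integrable lebesgue (\<lambda>x. V \<alpha> x * cutoff k x)"
      by (intro integrable_mult_test l \<alpha> cutoff_test)
    ultimately show ?thesis unfolding w_def[abs_def] by auto
  qed
  \<comment> \<open>Proved for every list with entries from \<open>L\<close>, so that the constants
    of the terms can be added up one by one.\<close>
  moreover have "\<exists>A>0. \<forall>k x. \<bar>T K k x\<bar> \<le> A * (1 / real (Suc k)) * ?S x" if "set K \<subseteq> set L" for K
    using that
  proof (induction K)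
    case Nil
    show ?case using S0 by (intro exI[of _ 1]) (simp add: T_def)
  next
    case (Cons t K)
    obtain c bs gs where t: "t = (c, bs, gs)" by (cases t)
    have tL: "(c, bs, gs) \<in> set L" using Cons.prems by (simp add: t)
    obtain A where A: "A > 0" "\<And>k x. \<bar>T K k x\<bar> \<le> A * (1 / real (Suc k)) * ?S x" using Cons by auto
    obtain B where B: "B > 0" "\<And>k x. \<bar>iter_partial gs (cutoff k) (x :: real ^ 'n)\<bar> \<le> (1 / real (Suc k)) ^ length gs * B"
      using iter_partial_cutoff_bound by blast
    have "\<bar>T (t # K) k x\<bar> \<le> (A + \<bar>c\<bar> * B) * (1 / real (Suc k)) * ?S x" for k x
    proof -
      \<comment> \<open>Here \<open>gs \<noteq> []\<close> enters: at least one power of the small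
        factor is present.\<close>
      have "(1 / real (Suc k)) ^ length gs \<le> (1 / real (Suc k)) ^ 1"
        using Lm(2)[OF tL] by (intro power_decreasing) (auto simp: Suc_le_eq)
      then have "(1 / real (Suc k)) ^ length gs * B \<le> (1 / real (Suc k)) * B" using B(1) by (intro mult_right_mono) auto
      then have b: "\<bar>iter_partial gs (cutoff k) x\<bar> \<le> (1 / real (Suc k)) * B" using B(2)[of k x] by linarith
      have "\<bar>V (count_list bs) x * iter_partial gs (cutoff k) x\<bar> \<le> ?S x * ((1 / real (Suc k)) * B)"
        unfolding abs_mult by (intro mult_mono VS b Lm(3)[OF tL] S0) simp
      from mult_left_mono[OF this, of "\<bar>c\<bar>"]
      have "\<bar>(- 1) ^ (length bs + mi_order \<alpha>) * c * (V (count_list bs) x * iter_partial gs (cutoff k) x)\<bar> \<le> \<bar>c\<bar> * B * (1 / real (Suc k)) * ?S x"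
        by (simp add: abs_mult power_abs mult_ac del: of_nat_Suc)
      moreover have "T (t # K) k x = (- 1) ^ (length bs + mi_order \<alpha>) * c * (V (count_list bs) x * iter_partial gs (cutoff k) x) + T K k x"
        by (simp add: T_def t)
      ultimately have "\<bar>T (t # K) k x\<bar> \<le> \<bar>c\<bar> * B * (1 / real (Suc k)) * ?S x + A * (1 / real (Suc k)) * ?S x"
        using A(2)[of k x] by linarith
      then show ?thesis by (simp add: algebra_simps del: of_nat_Suc)
    qed
    moreover have "A + \<bar>c\<bar> * B > 0" using A(1) B(1) by (intro add_pos_nonneg) auto
    ultimately show ?case by blast
  qed
  then obtain A where A: "A > 0" "\<And>k x. \<bar>T L k x\<bar> \<le> A * (1 / real (Suc k)) * ?S x" by blast
  obtain B where B: "B > 0" "\<And>k x. \<bar>cutoff k (x :: real ^ 'n)\<bar> \<le> B"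
    using iter_partial_cutoff_bound[of "[] :: 'n list"] by auto
  have "\<bar>w k x\<bar> \<le> (B + A) * ?S x" for k x
  proof -
    have "A * (1 / real (Suc k)) * ?S x \<le> A * 1 * ?S x"
      using A(1) S0 by (intro mult_right_mono mult_left_mono) auto
    then have "\<bar>T L k x\<bar> \<le> A * ?S x" using A(2)[of k x] by simp
    moreover have "\<bar>V \<alpha> x * cutoff k x\<bar> \<le> ?S x * B"
      unfolding abs_mult by (intro mult_mono VS \<alpha> B S0) simp
    ultimately show ?thesis unfolding w_def by (simp add: algebra_simps)
  qed
  moreover have "(\<lambda>k. w k x) \<longlonglongrightarrow> V \<alpha> x" for x
  proof -
    have "(\<lambda>k. A * (1 / real (Suc k)) * ?S x) \<longlonglongrightarrow> A * 0 * ?S x"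
      using LIMSEQ_inverse_real_of_nat by (intro tendsto_mult tendsto_const) (simp add: inverse_eq_divide)
    then have "(\<lambda>k. T L k x) \<longlonglongrightarrow> 0"
      by (intro Lim_null_comparison[of "\<lambda>k. T L k x" "\<lambda>k. A * (1 / real (Suc k)) * ?S x"]) (use A(2) in \<open>auto intro!: always_eventually\<close>)
    from tendsto_add[OF tendsto_mult[OF tendsto_const cutoff_tendsto_1[of x]] this, of "V \<alpha> x"]
    show ?thesis by (simp add: w_def)
  qed
  moreover have "B + A > 0" using A(1) B(1) by simp
  ultimately show ?thesis by blast
qed

text \<open>At each point the sum is at most \<open>card B\<close> times its largest term, so
  \<open>M x\<close> need only be evaluated there, and that single value is below the sum over all
  \<open>\<beta>\<close>. The successor keeps the divisor positive for empty
  \<open>B\<close>.\<close>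

lemma modular_sum_finite:
  fixes M :: "real ^ 'n \<Rightarrow> real \<Rightarrow> real"
  assumes M: "musielak M" and B: "finite B" and l: "l > 0" and A: "A > 0"
    and V: "\<And>\<beta>. \<beta> \<in> B \<Longrightarrow> V \<beta> \<in> borel_measurable lebesgue"
    and fin: "\<And>\<beta>. \<beta> \<in> B \<Longrightarrow> modular M (l / (A * real (Suc (card B)))) (V \<beta>) < \<infinity>"
  shows "modular M l (\<lambda>x. A * (\<Sum>\<beta>\<in>B. \<bar>V \<beta> x\<bar>)) < \<infinity>"
proof -
  let ?l = "l / (A * real (Suc (card B)))"
  have l': "?l > 0" using l A by simp
  have "modular M l (\<lambda>x. A * (\<Sum>\<beta>\<in>B. \<bar>V \<beta> x\<bar>)) \<le> (\<integral>\<^sup>+x. (\<Sum>\<beta>\<in>B. ennreal (M x (\<bar>V \<beta> x\<bar> / ?l))) \<partial>lebesgue)"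
    unfolding modular_def
  proof (rule nn_integral_mono_AE)
    have "AE x in lebesgue. young (M x)" using M by (simp add: musielak_def)
    then show "AE x in lebesgue. ennreal (M x (\<bar>A * (\<Sum>\<beta>\<in>B. \<bar>V \<beta> x\<bar>)\<bar> / l)) \<le> (\<Sum>\<beta>\<in>B. ennreal (M x (\<bar>V \<beta> x\<bar> / ?l)))"
    proof eventually_elim
      case (elim x)
      show ?case
      proof (cases "B = {}")
        case True
        then show ?thesis using elim by (simp add: young_def)
      next
        case False
        obtain \<gamma> where \<gamma>: "\<gamma> \<in> B" "\<And>\<beta>. \<beta> \<in> B \<Longrightarrow> \<bar>V \<beta> x\<bar> \<le> \<bar>V \<gamma> x\<bar>"
        proof -
          have "Max ((\<lambda>\<beta>. \<bar>V \<beta> x\<bar>) ` B) \<in> (\<lambda>\<beta>. \<bar>V \<beta> x\<bar>) ` B" using B False by (intro Max_in) auto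
          then obtain \<gamma> where "\<gamma> \<in> B" "\<bar>V \<gamma> x\<bar> = Max ((\<lambda>\<beta>. \<bar>V \<beta> x\<bar>) ` B)" by auto
          then show ?thesis using that[of \<gamma>] B by auto
        qed
        have "(\<Sum>\<beta>\<in>B. \<bar>V \<beta> x\<bar>) \<le> real (card B) * \<bar>V \<gamma> x\<bar>"
          using \<gamma>(2) sum_bounded_above[of B "\<lambda>\<beta>. \<bar>V \<beta> x\<bar>" "\<bar>V \<gamma> x\<bar>"] by simp
        also have "\<dots> \<le> real (Suc (card B)) * \<bar>V \<gamma> x\<bar>" by (intro mult_right_mono) auto
        finally have "A * (\<Sum>\<beta>\<in>B. \<bar>V \<beta> x\<bar>) / l \<le> A * (real (Suc (card B)) * \<bar>V \<gamma> x\<bar>) / l"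
          using A l by (intro divide_right_mono mult_left_mono) auto
        also have "\<dots> = \<bar>V \<gamma> x\<bar> / ?l" by (simp add: mult_ac)
        finally have "\<bar>A * (\<Sum>\<beta>\<in>B. \<bar>V \<beta> x\<bar>)\<bar> / l \<le> \<bar>V \<gamma> x\<bar> / ?l"
          using A by (simp add: abs_mult sum_nonneg)
        then have "M x (\<bar>A * (\<Sum>\<beta>\<in>B. \<bar>V \<beta> x\<bar>)\<bar> / l) \<le> M x (\<bar>V \<gamma> x\<bar> / ?l)"
          using l by (intro young_mono[OF elim]) auto
        then have "ennreal (M x (\<bar>A * (\<Sum>\<beta>\<in>B. \<bar>V \<beta> x\<bar>)\<bar> / l)) \<le> ennreal (M x (\<bar>V \<gamma> x\<bar> / ?l))" by (rule ennreal_leI)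
        also have "\<dots> \<le> (\<Sum>\<beta>\<in>B. ennreal (M x (\<bar>V \<beta> x\<bar> / ?l)))" by (intro member_le_sum \<gamma> B) auto
        finally show ?thesis .
      qed
    qed
  qed
  also have "\<dots> = (\<Sum>\<beta>\<in>B. modular M ?l (V \<beta>))"
    unfolding modular_def
  proof (intro nn_integral_sum)
    fix \<beta> assume "\<beta> \<in> B"
    then have "(\<lambda>x. \<bar>V \<beta> x\<bar> / ?l) \<in> borel_measurable lebesgue" using V by measurable
    then have "(\<lambda>x. M x (\<bar>V \<beta> x\<bar> / ?l)) \<in> borel_measurable lebesgue"
      using l' by (intro musielak_measurable[OF M] divide_nonneg_pos abs_ge_zero)
    then show "(\<lambda>x. ennreal (M x (\<bar>V \<beta> x\<bar> / ?l))) \<in> borel_measurable lebesgue"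
      by (rule measurable_compose[OF _ measurable_ennreal])
  qed
  also have "\<dots> < \<infinity>" using fin B by (auto simp: ennreal_sum_less_top)
  finally show ?thesis .
qed

text \<open>Common core of both density claims. The factor \<open>A\<close> is chosen before
  \<open>l\<close> and \<open>\<delta>\<close>, and one test function works for all derivatives
  simultaneously. Finite modulars are assumed only at the scale \<open>l / A\<close>, so the lemma
  applies at all scales to E-functions and at large scales to L-functions.\<close>

lemma modular_test_approximation:
  fixes M :: "real ^ 'n \<Rightarrow> real \<Rightarrow> real"
  assumes M: "musielak M" and cond: "cond_M2 M \<or> (\<exists>p>1. cond_G p M \<and> cond_M2p p M)"
    and V: "\<And>\<beta>. mi_order \<beta> \<le> m \<Longrightarrow> has_distr_deriv \<beta> u (V \<beta>)"
    and Vm: "\<And>\<beta>. mi_order \<beta> \<le> m \<Longrightarrow> V \<beta> \<in> borel_measurable lebesgue"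
  shows "\<exists>A>0. \<forall>l>0. \<forall>\<delta>>0. (\<forall>\<beta>. mi_order \<beta> \<le> m \<longrightarrow> modular M (l / A) (V \<beta>) < \<infinity>) \<longrightarrow>
    (\<exists>\<psi>\<in>test_functions. \<forall>\<alpha>. mi_order \<alpha> \<le> m \<longrightarrow> modular M l (\<lambda>x. mi_deriv \<alpha> \<psi> x - V \<alpha> x) < \<delta>)"
proof -
  let ?B = "{\<beta> :: 'n \<Rightarrow> nat. mi_order \<beta> \<le> m}"
  let ?S = "\<lambda>x. \<Sum>\<beta>\<in>?B. \<bar>V \<beta> x\<bar>"
  define P where "P \<alpha> w A \<longleftrightarrow> (\<forall>k. has_distr_deriv \<alpha> (\<lambda>x. u x * cutoff k x) (w k)) \<and> (\<forall>k. integrable lebesgue (w k)) \<and>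
    A > 0 \<and> (\<forall>k x. \<bar>w k x\<bar> \<le> A * ?S x) \<and> (\<forall>x. (\<lambda>k. w k x) \<longlonglongrightarrow> V \<alpha> x)" for \<alpha> w A
  have "\<forall>\<alpha>\<in>?B. \<exists>w A. P \<alpha> w A"
    unfolding P_def by (intro ballI truncation V) simp_all
  from bchoice[OF this] obtain w where "\<forall>\<alpha>\<in>?B. \<exists>A. P \<alpha> (w \<alpha>) A" ..
  from bchoice[OF this] obtain A where "\<forall>\<alpha>\<in>?B. P \<alpha> (w \<alpha>) (A \<alpha>)" ..
  then have P: "P \<alpha> (w \<alpha>) (A \<alpha>)" if "mi_order \<alpha> \<le> m" for \<alpha> using that by simp
  have w: "has_distr_deriv \<alpha> (\<lambda>x. u x * cutoff k x) (w \<alpha> k)" "integrable lebesgue (w \<alpha> k)"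
    and A: "A \<alpha> > 0" "\<bar>w \<alpha> k x\<bar> \<le> A \<alpha> * ?S x"
    and wlim: "(\<lambda>k. w \<alpha> k x) \<longlonglongrightarrow> V \<alpha> x" if "mi_order \<alpha> \<le> m" for \<alpha> k x
    using P[OF that] unfolding P_def by blast+
  define A0 where "A0 = 1 + (\<Sum>\<alpha>\<in>?B. A \<alpha>)"
  have A0: "A0 > 0" "A0 \<ge> 1" "\<And>\<alpha>. mi_order \<alpha> \<le> m \<Longrightarrow> A \<alpha> \<le> A0"
  proof -
    have "(\<Sum>\<alpha>\<in>?B. A \<alpha>) \<ge> 0" using A(1) by (intro sum_nonneg) (auto intro: less_imp_le)
    then show "A0 > 0" "A0 \<ge> 1" by (auto simp: A0_def)
    fix \<alpha> :: "'n \<Rightarrow> nat" assume "mi_order \<alpha> \<le> m"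
    then have "A \<alpha> \<le> (\<Sum>\<alpha>\<in>?B. A \<alpha>)"
      using A(1) finite_mi_order_le by (intro member_le_sum) (auto intro: less_imp_le)
    then show "A \<alpha> \<le> A0" by (simp add: A0_def)
  qed
  have S0: "?S x \<ge> 0" for x by (intro sum_nonneg) auto
  have Sm: "?S \<in> borel_measurable lebesgue" using Vm by (intro borel_measurable_sum) auto
  have wA: "\<bar>w \<alpha> k x\<bar> \<le> A0 * ?S x" if "mi_order \<alpha> \<le> m" for \<alpha> k x
    using A(2)[OF that, of k x] mult_right_mono[OF A0(3)[OF that] S0[of x]] by linarith
  \<comment> \<open>The uniform bound on \<open>w\<close> survives the pointwise limit in
    \<open>k\<close>.\<close>
  have VA: "\<bar>V \<alpha> x\<bar> \<le> A0 * ?S x" if "mi_order \<alpha> \<le> m" for \<alpha> x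
    using tendsto_rabs[OF wlim[OF that, of x]] wA[OF that] by (intro LIMSEQ_le_const2) auto
  \<comment> \<open>Factor 2 because \<open>w \<alpha> k\<close> and \<open>V \<alpha>\<close> are
    each bounded by \<open>A0 * ?S\<close>, so \<open>C * ?S\<close> dominates their difference.
    \<open>Q\<close> is the divisor demanded by \<open>modular_sum_finite\<close>.\<close>
  define C where "C = 2 * A0"
  define Q where "Q = C * real (Suc (card ?B))"
  have C: "C > 0" "Q > 0" using A0 by (auto simp: C_def Q_def)
  \<comment> \<open>Scale \<open>4 * l\<close>: mollification already works at \<open>2 * l\<close>,
    and adding the truncation error doubles once more.\<close>
  have main: "\<exists>\<psi>\<in>test_functions. \<forall>\<alpha>. mi_order \<alpha> \<le> m \<longrightarrow> modular M (4 * l) (\<lambda>x. mi_deriv \<alpha> \<psi> x - V \<alpha> x) < \<delta>"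
    if l: "l > 0" and fin: "\<And>\<beta>. mi_order \<beta> \<le> m \<Longrightarrow> modular M (l / Q) (V \<beta>) < \<infinity>" and \<delta>: "\<delta> > 0" for l :: real and \<delta> :: ennreal
  proof -
    have finS: "modular M l (\<lambda>x. C * ?S x) < \<infinity>"
      using fin Vm by (intro modular_sum_finite M finite_mi_order_le l C) (auto simp: Q_def)
    have iS: "integrable lebesgue (\<lambda>x. M x (\<bar>C * ?S x\<bar> / l))"
      using Sm by (intro modular_finite_integrable M l finS) auto
    obtain \<delta>' where \<delta>': "\<delta>' > 0" "\<delta>' + \<delta>' \<le> \<delta>"
    proof (cases "\<delta> = \<infinity>")
      case True then show ?thesis using that[of 1] by simp
    next
      case False
      then obtain r where r: "\<delta> = ennreal r" "r > 0" using \<delta> by (cases \<delta>) (auto simp: ennreal_zero_less_top)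
      have "ennreal (r / 2) + ennreal (r / 2) = ennreal r" using r(2) by (simp add: ennreal_plus[symmetric] del: ennreal_plus)
      then show ?thesis using that[of "ennreal (r / 2)"] r by simp
    qed
    have tr: "(\<lambda>k. modular M l (\<lambda>x. w \<alpha> k x - V \<alpha> x)) \<longlonglongrightarrow> 0" if \<alpha>: "mi_order \<alpha> \<le> m" for \<alpha>
    proof (rule modular_tendsto_0_AE[OF M l, where h = "\<lambda>_ x. M x (\<bar>C * ?S x\<bar> / l)" and ?h0.0 = "\<lambda>x. M x (\<bar>C * ?S x\<bar> / l)"])
      show "(\<lambda>x. w \<alpha> k x - V \<alpha> x) \<in> borel_measurable lebesgue" for k
        using w(2)[OF \<alpha>] Vm[OF \<alpha>] by auto
      show "AE x in lebesgue. (\<lambda>k. w \<alpha> k x - V \<alpha> x) \<longlonglongrightarrow> 0"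
      proof (rule AE_I2)
        fix x
        from tendsto_diff[OF wlim[OF \<alpha>, of x] tendsto_const, of "V \<alpha> x"]
        show "(\<lambda>k. w \<alpha> k x - V \<alpha> x) \<longlonglongrightarrow> 0" by simp
      qed
      have "AE x in lebesgue. young (M x)" using M by (simp add: musielak_def)
      then show "AE x in lebesgue. M x (\<bar>w \<alpha> k x - V \<alpha> x\<bar> / l) \<le> M x (\<bar>C * ?S x\<bar> / l)" for k
      proof eventually_elim
        case (elim x)
        have "\<bar>w \<alpha> k x - V \<alpha> x\<bar> \<le> \<bar>C * ?S x\<bar>"
          using wA[OF \<alpha>, of k x] VA[OF \<alpha>, of x] by (simp add: C_def)
        then show ?case using l by (intro young_mono[OF elim]) (auto intro: divide_right_mono)
      qed
    qed (use iS in auto)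
    have "eventually (\<lambda>k. \<forall>\<alpha>\<in>?B. modular M l (\<lambda>x. w \<alpha> k x - V \<alpha> x) < \<delta>') sequentially"
      by (intro eventually_ball_finite finite_mi_order_le ballI order_tendstoD(2)[OF tr] \<delta>'(1)) simp
    then obtain k where k: "\<And>\<alpha>. mi_order \<alpha> \<le> m \<Longrightarrow> modular M l (\<lambda>x. w \<alpha> k x - V \<alpha> x) < \<delta>'"
      by (auto simp: eventually_sequentially)
    \<comment> \<open>From here on \<open>k\<close> is fixed. The mollification parameter is chosen
      afterwards and may depend on it.\<close>
    define e where "e = (\<lambda>n. inverse (real (Suc n)))"
    have e: "e n > 0" "e \<longlonglongrightarrow> 0" for n
      unfolding e_def by (simp, rule LIMSEQ_inverse_real_of_nat)
    have mo: "(\<lambda>n. modular M (2 * l) (\<lambda>x. conv (w \<alpha> k) (mollifier (e n)) x - w \<alpha> k x)) \<longlonglongrightarrow> 0" if \<alpha>: "mi_order \<alpha> \<le> m" for \<alpha>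
    proof (rule modular_mollifier[OF M cond w(2)[OF \<alpha>] l _ e])
      have "modular M l (w \<alpha> k) \<le> modular M l (\<lambda>x. C * ?S x)"
      proof (rule modular_mono[OF M l l], rule AE_I2)
        fix x
        have "A0 * ?S x \<ge> 0" using A0 S0[of x] by simp
        then have "\<bar>w \<alpha> k x\<bar> \<le> \<bar>C * ?S x\<bar>" using wA[OF \<alpha>, of k x] by (simp add: C_def)
        then show "\<bar>w \<alpha> k x\<bar> / l \<le> \<bar>C * ?S x\<bar> / l" using l by (intro divide_right_mono) auto
      qed
      then show "modular M l (w \<alpha> k) < \<infinity>" using finS by (rule le_less_trans)
    qed
    have "eventually (\<lambda>n. \<forall>\<alpha>\<in>?B. modular M (2 * l) (\<lambda>x. conv (w \<alpha> k) (mollifier (e n)) x - w \<alpha> k x) < \<delta>') sequentially"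
      by (intro eventually_ball_finite finite_mi_order_le ballI order_tendstoD(2)[OF mo] \<delta>'(1)) simp
    then obtain n where n: "\<And>\<alpha>. mi_order \<alpha> \<le> m \<Longrightarrow> modular M (2 * l) (\<lambda>x. conv (w \<alpha> k) (mollifier (e n)) x - w \<alpha> k x) < \<delta>'"
      by (auto simp: eventually_sequentially)
    let ?u = "\<lambda>x. u x * cutoff k x" and ?\<rho> = "mollifier (e n) :: real ^ 'n \<Rightarrow> real"
    have \<rho>: "?\<rho> \<in> test_functions" by (rule mollifier_test[OF e(1)])
    have "locally_integrable u" using V[of "\<lambda>_. 0"] by (simp add: has_distr_deriv_def mi_order_def)
    then have iu: "integrable lebesgue ?u" by (intro integrable_mult_test cutoff_test)
    obtain R where R: "\<And>x. norm x \<ge> R \<Longrightarrow> cutoff k (x :: real ^ 'n) = 0" by (meson test_support[OF cutoff_test])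
    have \<psi>: "conv ?u ?\<rho> \<in> test_functions" using R by (intro test_conv[OF iu _ \<rho>, of R]) auto
    show ?thesis
    proof (intro bexI[OF _ \<psi>] allI impI)
      fix \<alpha> :: "'n \<Rightarrow> nat" assume \<alpha>: "mi_order \<alpha> \<le> m"
      have eq: "mi_deriv \<alpha> (conv ?u ?\<rho>) x - V \<alpha> x = (conv (w \<alpha> k) ?\<rho> x - w \<alpha> k x) + (w \<alpha> k x - V \<alpha> x)" for x
        by (simp add: mi_deriv_conv[OF w(1)[OF \<alpha>] iu \<rho>])
      have mw: "(\<lambda>x. conv (w \<alpha> k) ?\<rho> x - w \<alpha> k x) \<in> borel_measurable lebesgue" "(\<lambda>x. w \<alpha> k x - V \<alpha> x) \<in> borel_measurable lebesgue"
        using integrable_conv_mollifier[OF w(2)[OF \<alpha>] e(1)] w(2)[OF \<alpha>] Vm[OF \<alpha>] by auto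
      have "modular M (4 * l) (\<lambda>x. mi_deriv \<alpha> (conv ?u ?\<rho>) x - V \<alpha> x)
        \<le> modular M (2 * l) (\<lambda>x. conv (w \<alpha> k) ?\<rho> x - w \<alpha> k x) + modular M (2 * l) (\<lambda>x. w \<alpha> k x - V \<alpha> x)"
        unfolding eq using modular_add[OF M _ mw, of "2 * l"] l by simp
      also have "modular M (2 * l) (\<lambda>x. w \<alpha> k x - V \<alpha> x) \<le> modular M l (\<lambda>x. w \<alpha> k x - V \<alpha> x)"
        using l by (intro modular_mono M AE_I2) (auto intro: divide_left_mono)
      also have "modular M (2 * l) (\<lambda>x. conv (w \<alpha> k) ?\<rho> x - w \<alpha> k x) + modular M l (\<lambda>x. w \<alpha> k x - V \<alpha> x) < \<delta>' + \<delta>'"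
        by (intro add_strict_mono n k \<alpha>)
      also note \<delta>'(2)
      finally show "modular M (4 * l) (\<lambda>x. mi_deriv \<alpha> (conv ?u ?\<rho>) x - V \<alpha> x) < \<delta>"
        by (auto intro: add_left_mono)
    qed
  qed
  show ?thesis
  proof (intro exI[of _ "4 * Q"] conjI allI impI)
    show "4 * Q > 0" using C by simp
    fix l :: real and \<delta> :: ennreal
    assume "l > 0" "\<delta> > 0" "\<forall>\<beta>. mi_order \<beta> \<le> m \<longrightarrow> modular M (l / (4 * Q)) (V \<beta>) < \<infinity>"
    then show "\<exists>\<psi>\<in>test_functions. \<forall>\<alpha>. mi_order \<alpha> \<le> m \<longrightarrow> modular M l (\<lambda>x. mi_deriv \<alpha> \<psi> x - V \<alpha> x) < \<delta>"
      using main[of "l / 4" \<delta>] by simp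
  qed
qed

text \<open>Every derivative of a test function is bounded by some \<open>B\<close> and lives in a
  ball, so \<open>cond_M1\<close> with the constant \<open>B / l\<close> on that ball bounds its
  modular at each scale.\<close>

lemma test_in_WE_space:
  fixes M :: "real ^ 'n \<Rightarrow> real \<Rightarrow> real"
  assumes M: "musielak M" and M1: "cond_M1 M"
  shows "test_functions \<subseteq> WE_space m M"
proof
  fix \<psi> :: "real ^ 'n \<Rightarrow> real" assume \<psi>: "\<psi> \<in> test_functions"
  have "mi_deriv \<alpha> \<psi> \<in> E_space M" for \<alpha>
  proof -
    have t: "mi_deriv \<alpha> \<psi> \<in> test_functions" by (rule test_mi_deriv[OF \<psi>])
    obtain R where R: "\<And>x. norm x \<ge> R \<Longrightarrow> mi_deriv \<alpha> \<psi> x = 0" by (meson test_support[OF t])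
    obtain B where B: "B > 0" "\<And>x. \<bar>mi_deriv \<alpha> \<psi> x\<bar> \<le> B" by (meson test_bounded[OF t])
    have "modular M l (mi_deriv \<alpha> \<psi>) < \<infinity>" if l: "l > 0" for l
    proof -
      have "modular M l (mi_deriv \<alpha> \<psi>) \<le> (\<integral>\<^sup>+ x\<in>cball 0 R. ennreal (M x (B / l)) \<partial>lebesgue)"
        unfolding modular_def
      proof (rule nn_integral_mono_AE)
        have "AE x in lebesgue. young (M x)" using M by (simp add: musielak_def)
        then show "AE x in lebesgue. ennreal (M x (\<bar>mi_deriv \<alpha> \<psi> x\<bar> / l)) \<le> ennreal (M x (B / l)) * indicator (cball 0 R) x"
        proof eventually_elim
          case (elim x)
          show ?case
          proof (cases "norm x \<le> R")
            case True
            have "M x (\<bar>mi_deriv \<alpha> \<psi> x\<bar> / l) \<le> M x (B / l)"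
              using l B(2) by (intro young_mono[OF elim]) (auto intro: divide_right_mono)
            then show ?thesis using True by (simp add: ennreal_leI)
          next
            case False
            then show ?thesis using R[of x] elim by (simp add: young_def)
          qed
        qed
      qed
      also have "\<dots> < \<infinity>" using M1 l B(1) unfolding cond_M1_def by simp
      finally show ?thesis .
    qed
    then show ?thesis using smooth_measurable[OF test_smooth[OF t]] by (simp add: E_space_def)
  qed
  then show "\<psi> \<in> WE_space m M"
    using has_distr_deriv_smooth[OF test_smooth[OF \<psi>]] unfolding WE_space_def by blast
qed

text \<open>Both claims instantiate \<open>modular_test_approximation\<close>: the first at the
  prescribed scale \<open>\<epsilon> / 2\<close>, the second at one sufficiently large scale with
  tolerances tending to 0.\<close>

theorem theorem1:
  fixes M :: "real ^ 'n \<Rightarrow> real \<Rightarrow> real" and m :: nat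
  assumes "N_function M"
    and "0 < m"
    and "(cond_M1 M \<and> cond_M2 M) \<or>
         (\<exists>p>1. cond_G p M \<and> cond_M1 M \<and> cond_M2p p M)"
  shows "(test_functions \<subseteq> WE_space m M \<and>
          (\<forall>u\<in>WE_space m M. \<forall>\<epsilon>>0. \<exists>\<psi>\<in>test_functions. W_norm m M (\<lambda>x. \<psi> x - u x) < \<epsilon>)) \<and>
         (\<forall>u\<in>WL_space m M. \<exists>l>0. \<exists>U :: nat \<Rightarrow> real ^ 'n \<Rightarrow> real.
            (\<forall>k. U k \<in> test_functions) \<and>
            (\<forall>\<alpha>. mi_order \<alpha> \<le> m \<longrightarrow>
              ((\<lambda>k. \<integral>\<^sup>+ x. ennreal (M x (\<bar>mi_deriv \<alpha> (U k) x - distr_deriv \<alpha> u x\<bar> / l)) \<partial>lebesgue)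
                 \<longlonglongrightarrow> 0)))"
proof (intro conjI ballI allI impI)
  have M: "musielak M" using assms(1) by (rule N_function_musielak)
  have M1: "cond_M1 M" and cond: "cond_M2 M \<or> (\<exists>p>1. cond_G p M \<and> cond_M2p p M)"
    using assms(3) by auto
  show "test_functions \<subseteq> WE_space m M" by (rule test_in_WE_space[OF M M1])
  {
    fix u and \<epsilon> :: real assume u: "u \<in> WE_space m M" and \<epsilon>: "\<epsilon> > 0"
    let ?B = "{\<beta> :: 'n \<Rightarrow> nat. mi_order \<beta> \<le> m}"
    have "\<forall>\<beta>\<in>?B. \<exists>v. v \<in> E_space M \<and> has_distr_deriv \<beta> u v" using u unfolding WE_space_def by blast
    from bchoice[OF this] obtain V where "\<forall>\<beta>\<in>?B. V \<beta> \<in> E_space M \<and> has_distr_deriv \<beta> u (V \<beta>)" ..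
    then have V: "V \<beta> \<in> E_space M" "has_distr_deriv \<beta> u (V \<beta>)" if "mi_order \<beta> \<le> m" for \<beta> using that by auto
    have Vm: "V \<beta> \<in> borel_measurable lebesgue" if "mi_order \<beta> \<le> m" for \<beta> using V(1)[OF that] by (simp add: E_space_def)
    have "\<exists>A>0. \<forall>l>0. \<forall>\<delta>>0. (\<forall>\<beta>. mi_order \<beta> \<le> m \<longrightarrow> modular M (l / A) (V \<beta>) < \<infinity>) \<longrightarrow>
      (\<exists>\<psi>\<in>test_functions. \<forall>\<alpha>. mi_order \<alpha> \<le> m \<longrightarrow> modular M l (\<lambda>x. mi_deriv \<alpha> \<psi> x - V \<alpha> x) < \<delta>)"
      by (intro modular_test_approximation[OF M cond, where u = u and V = V] V Vm)
    then obtain A where A: "A > 0" "\<And>l \<delta>. l > 0 \<Longrightarrow> \<delta> > 0 \<Longrightarrow> (\<And>\<beta>. mi_order \<beta> \<le> m \<Longrightarrow> modular M (l / A) (V \<beta>) < \<infinity>) \<Longrightarrow>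
      \<exists>\<psi>\<in>test_functions. \<forall>\<alpha>. mi_order \<alpha> \<le> m \<longrightarrow> modular M l (\<lambda>x. mi_deriv \<alpha> \<psi> x - V \<alpha> x) < \<delta>"
      by blast
    \<comment> \<open>With this tolerance the sum over all multi-indices is at most
      \<open>card ?B / (card ?B + 1)\<close>, below the threshold 1 of the norm. Hence
      \<open>\<epsilon> / 2\<close> is admissible in the infimum, and the norm is strictly below
      \<open>\<epsilon>\<close>.\<close>
    define \<delta> where "\<delta> = ennreal (1 / real (Suc (card ?B)))"
    have "\<exists>\<psi>\<in>test_functions. \<forall>\<alpha>. mi_order \<alpha> \<le> m \<longrightarrow> modular M (\<epsilon> / 2) (\<lambda>x. mi_deriv \<alpha> \<psi> x - V \<alpha> x) < \<delta>"
      using V(1) \<epsilon> A(1) by (intro A(2)) (auto simp: E_space_def \<delta>_def)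
    then obtain \<psi> where \<psi>: "\<psi> \<in> test_functions" "\<And>\<alpha>. mi_order \<alpha> \<le> m \<Longrightarrow> modular M (\<epsilon> / 2) (\<lambda>x. mi_deriv \<alpha> \<psi> x - V \<alpha> x) < \<delta>" by blast
    have "modular M (\<epsilon> / 2) (distr_deriv \<alpha> (\<lambda>x. \<psi> x - u x)) \<le> \<delta>" if \<alpha>: "mi_order \<alpha> \<le> m" for \<alpha>
    proof -
      have "has_distr_deriv \<alpha> (\<lambda>x. \<psi> x - u x) (\<lambda>x. mi_deriv \<alpha> \<psi> x - V \<alpha> x)"
        by (intro has_distr_deriv_diff has_distr_deriv_smooth test_smooth \<psi> V(2) \<alpha>)
      from modular_cong_AE[OF distr_deriv_AE[OF this], of M "\<epsilon> / 2"]
      show ?thesis using \<psi>(2)[OF \<alpha>] by simp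
    qed
    then have "(\<Sum>\<alpha>\<in>?B. modular M (\<epsilon> / 2) (distr_deriv \<alpha> (\<lambda>x. \<psi> x - u x))) \<le> of_nat (card ?B) * \<delta>"
      by (intro sum_bounded_above) auto
    also have "\<dots> = ennreal (real (card ?B) * (1 / real (Suc (card ?B))))"
      unfolding \<delta>_def by (subst ennreal_mult) (auto simp: ennreal_of_nat_eq_real_of_nat)
    also have "\<dots> \<le> 1" by (auto simp: divide_le_eq)
    finally have "W_norm m M (\<lambda>x. \<psi> x - u x) \<le> \<epsilon> / 2"
      unfolding W_norm_def using \<epsilon> by (intro cInf_lower) (auto intro!: bdd_belowI[of _ 0])
    then show "\<exists>\<psi>\<in>test_functions. W_norm m M (\<lambda>x. \<psi> x - u x) < \<epsilon>"
      using \<epsilon> by (intro bexI[OF _ \<psi>(1)]) auto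
  next
    fix u assume u: "u \<in> WL_space m M"
    let ?B = "{\<beta> :: 'n \<Rightarrow> nat. mi_order \<beta> \<le> m}"
    have "\<forall>\<beta>\<in>?B. \<exists>v. v \<in> L_space M \<and> has_distr_deriv \<beta> u v" using u unfolding WL_space_def by blast
    from bchoice[OF this] obtain V where "\<forall>\<beta>\<in>?B. V \<beta> \<in> L_space M \<and> has_distr_deriv \<beta> u (V \<beta>)" ..
    then have V: "V \<beta> \<in> L_space M" "has_distr_deriv \<beta> u (V \<beta>)" if "mi_order \<beta> \<le> m" for \<beta> using that by auto
    have Vm: "V \<beta> \<in> borel_measurable lebesgue" if "mi_order \<beta> \<le> m" for \<beta> using V(1)[OF that] by (simp add: L_space_def)
    have "\<forall>\<beta>\<in>?B. \<exists>l>0. modular M l (V \<beta>) < \<infinity>" using V(1) by (auto simp: L_space_def)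
    then have "\<forall>\<beta>\<in>?B. \<exists>l. l > 0 \<and> modular M l (V \<beta>) < \<infinity>" by blast
    from bchoice[OF this] obtain lf where "\<forall>\<beta>\<in>?B. lf \<beta> > 0 \<and> modular M (lf \<beta>) (V \<beta>) < \<infinity>" ..
    then have lf: "lf \<beta> > 0" "modular M (lf \<beta>) (V \<beta>) < \<infinity>" if "mi_order \<beta> \<le> m" for \<beta> using that by auto
    have "\<exists>A>0. \<forall>l>0. \<forall>\<delta>>0. (\<forall>\<beta>. mi_order \<beta> \<le> m \<longrightarrow> modular M (l / A) (V \<beta>) < \<infinity>) \<longrightarrow>
      (\<exists>\<psi>\<in>test_functions. \<forall>\<alpha>. mi_order \<alpha> \<le> m \<longrightarrow> modular M l (\<lambda>x. mi_deriv \<alpha> \<psi> x - V \<alpha> x) < \<delta>)"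
      by (intro modular_test_approximation[OF M cond, where u = u and V = V] V Vm)
    then obtain A where A: "A > 0" "\<And>l \<delta>. l > 0 \<Longrightarrow> \<delta> > 0 \<Longrightarrow> (\<And>\<beta>. mi_order \<beta> \<le> m \<Longrightarrow> modular M (l / A) (V \<beta>) < \<infinity>) \<Longrightarrow>
      \<exists>\<psi>\<in>test_functions. \<forall>\<alpha>. mi_order \<alpha> \<le> m \<longrightarrow> modular M l (\<lambda>x. mi_deriv \<alpha> \<psi> x - V \<alpha> x) < \<delta>"
      by blast
    \<comment> \<open>A common scale above all the individual ones, so every derivative has finite
      modular at \<open>l\<close>. The approximation then takes place at
      \<open>A * l\<close>.\<close>
    define l where "l = 1 + (\<Sum>\<beta>\<in>?B. lf \<beta>)"
    have lle: "lf \<beta> \<le> l" if "mi_order \<beta> \<le> m" for \<beta>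
    proof -
      have "lf \<beta> \<le> (\<Sum>\<beta>\<in>?B. lf \<beta>)"
        using that lf(1) finite_mi_order_le by (intro member_le_sum) (auto intro: less_imp_le)
      then show ?thesis by (simp add: l_def)
    qed
    have l: "l > 0" unfolding l_def using lf(1) by (intro add_pos_nonneg sum_nonneg) (auto intro: less_imp_le)
    have fin: "modular M (A * l / A) (V \<beta>) < \<infinity>" if "mi_order \<beta> \<le> m" for \<beta>
    proof -
      have "modular M l (V \<beta>) \<le> modular M (lf \<beta>) (V \<beta>)"
        using l lf(1)[OF that] lle[OF that] by (intro modular_mono M AE_I2) (auto intro: divide_left_mono)
      then show ?thesis using lf(2)[OF that] A(1) by simp
    qed
    have "\<forall>k. \<exists>\<psi>\<in>test_functions. \<forall>\<alpha>. mi_order \<alpha> \<le> m \<longrightarrow> modular M (A * l) (\<lambda>x. mi_deriv \<alpha> \<psi> x - V \<alpha> x) < ennreal (inverse (real (Suc k)))"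
      using fin A(1) l by (intro allI A(2)) auto
    then obtain U where U: "\<And>k. U k \<in> test_functions"
      "\<And>k \<alpha>. mi_order \<alpha> \<le> m \<Longrightarrow> modular M (A * l) (\<lambda>x. mi_deriv \<alpha> (U k) x - V \<alpha> x) < ennreal (inverse (real (Suc k)))"
      by metis
    have "(\<lambda>k. modular M (A * l) (\<lambda>x. mi_deriv \<alpha> (U k) x - distr_deriv \<alpha> u x)) \<longlonglongrightarrow> 0" if \<alpha>: "mi_order \<alpha> \<le> m" for \<alpha>
    proof (rule tendsto_sandwich[OF _ _ tendsto_const])
      \<comment> \<open>\<open>distr_deriv \<alpha> u\<close> is an arbitrarily chosen
        representative; uniqueness up to null sets identifies it with \<open>V \<alpha>\<close>
        inside the modular.\<close>
      have "modular M (A * l) (\<lambda>x. mi_deriv \<alpha> (U k) x - distr_deriv \<alpha> u x) = modular M (A * l) (\<lambda>x. mi_deriv \<alpha> (U k) x - V \<alpha> x)" for k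
        using distr_deriv_AE[OF V(2)[OF \<alpha>]] by (intro modular_cong_AE) auto
      then show "eventually (\<lambda>k. modular M (A * l) (\<lambda>x. mi_deriv \<alpha> (U k) x - distr_deriv \<alpha> u x) \<le> ennreal (inverse (real (Suc k)))) sequentially"
        using U(2)[OF \<alpha>] by (intro always_eventually allI) (auto intro: less_imp_le)
      show "(\<lambda>k. ennreal (inverse (real (Suc k)))) \<longlonglongrightarrow> 0"
        using tendsto_ennrealI[OF LIMSEQ_inverse_real_of_nat] by simp
    qed simp
    then show "\<exists>l>0. \<exists>U :: nat \<Rightarrow> real ^ 'n \<Rightarrow> real. (\<forall>k. U k \<in> test_functions) \<and>
            (\<forall>\<alpha>. mi_order \<alpha> \<le> m \<longrightarrow>
              ((\<lambda>k. \<integral>\<^sup>+ x. ennreal (M x (\<bar>mi_deriv \<alpha> (U k) x - distr_deriv \<alpha> u x\<bar> / l)) \<partial>lebesgue) \<longlonglongrightarrow> 0))"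
      using U(1) A(1) l unfolding modular_def by (intro exI[of _ "A * l"] conjI exI[of _ U] allI impI) auto
  }
qed

end
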